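(* Let $t\in[0,T]$ and let $0=t_0<\dots<t_n=t$ be a discrete time partition for $n\in\mathbb N$, which yields a recursive representation of the solution $X$ of the stochastic heat equation $dX(t)=\Delta_{\mathbb S^2}X(t)\,dt+dW(t)$, $X(0)=X_0\in L^2(\Omega;L^2(\mathbb S^2))$. Furthermore assume that there exist $\ell_0\in\mathbb N$, $\alpha>0$ and a constant $C$ such that the angular power spectrum $(A_\ell,\ell\in\mathbb N_0)$ of $W$ satisfies $A_\ell\le C\cdot\ell^{-\alpha}$ for all $\ell>\ell_0$. Then the error of the approximate solution $X^\kappa$ is bounded uniformly in time, independently of the time discretization and asymptotically in $\kappa$ by $$\|X(t)-X^\kappa(t)\|_{L^2(\mathbb S^2)}\le\kappa^{-\beta},\qquad\mathbb P\text{-a.s.}$$ for all $\beta<\alpha/2$.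
   Context: $0<T<\infty$; $\mathbb S^2$ is the unit sphere in $\mathbb R^3$, $\Delta_{\mathbb S^2}$ its Laplace–Beltrami operator, and $(Y_{\ell m},\ \ell\in\mathbb N_0,\ m=-\ell,\dots,\ell)$ the standard complex orthonormal spherical harmonics ($\Delta_{\mathbb S^2}Y_{\ell m}=-\ell(\ell+1)Y_{\ell m}$, $Y_{\ell,-m}=(-1)^m\overline{Y_{\ell m}}$). The isotropic $Q$-Wiener process with angular power spectrum $(A_\ell)$, $A_\ell\ge0$, is given by $$W(t)=\sum_{\ell=0}^\infty\Bigl(\sqrt{A_\ell}\,\beta^1_{\ell0}(t)Y_{\ell0}+\sqrt{2A_\ell}\sum_{m=1}^\ell\bigl(\beta^1_{\ell m}(t)\,\mathrm{Re}\,Y_{\ell m}+\beta^2_{\ell m}(t)\,\mathrm{Im}\,Y_{\ell m}\bigr)\Bigr)$$ with independent real standard Brownian motions $\beta^1_{\ell m}$, $\beta^2_{\ell m}$. The solution is $X(t)=\sum_{\ell=0}^\infty X_\ell(t)$ with $$\begin{aligned}X_\ell(t)={}&\sum_{m=-\ell}^\ell e^{-\ell(\ell+1)t}(X_0,Y_{\ell m})_{L^2(\mathbb S^2)}Y_{\ell m}+\sqrt{A_\ell}\Bigl(\int_0^te^{-\ell(\ell+1)(t-s)}d\beta^1_{\ell0}(s)\,Y_{\ell0}\\&+\sqrt2\sum_{m=1}^\ell\Bigl(\int_0^te^{-\ell(\ell+1)(t-s)}d\beta^1_{\ell m}(s)\,\mathrm{Re}\,Y_{\ell m}+\int_0^te^{-\ell(\ell+1)(t-s)}d\beta^2_{\ell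 m}(s)\,\mathrm{Im}\,Y_{\ell m}\Bigr)\Bigr).\end{aligned}$$ On a time grid it is computed exactly by the recursion $X_\ell(t_{k+1})=e^{-\ell(\ell+1)(t_{k+1}-t_k)}X_\ell(t_k)+\psi_\ell(k)$, where $\psi_\ell(k)$ is the noise term above with $\int_0^te^{-\ell(\ell+1)(t-s)}d\beta$ replaced by $\int_{t_k}^{t_{k+1}}e^{-\ell(\ell+1)(t_{k+1}-s)}d\beta$. The approximate solution is $X^\kappa=\sum_{\ell=0}^\kappa X_\ell$, $\kappa\in\mathbb N$.
   Formalization: "Uniformly in time" is proved with a random threshold for κ uniform over t in [δ,T], for every δ>0 (so for each fixed t>0), not down to t=0: for general X_0 in L^2 the claim fails at t=0 and uniformly as t→0, since the tail of X_0 need not decay at any rate. *)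

theory Defs
  imports "HOL-Probability.Probability" "HOL-Computational_Algebra.Polynomial"
begin

definition sphere_point :: "real \<times> real \<Rightarrow> real ^ 3" where
  "sphere_point = (\<lambda>(\<theta>, \<phi>). vector [sin \<theta> * cos \<phi>, sin \<theta> * sin \<phi>, cos \<theta>])"

text \<open>Surface measure \<open>sin \<theta> d\<theta> d\<phi>\<close>, as a measure whose space is the unit sphere.\<close>

definition sphere_measure :: "(real ^ 3) measure" where
  "sphere_measure =
     distr (density lborel
             (\<lambda>(\<theta>, \<phi>). ennreal (sin \<theta>) * indicator ({0..pi} \<times> {0..<2 * pi}) (\<theta>, \<phi>)))
           (restrict_space borel (sphere 0 1)) sphere_point"

definition L2_sphere :: "(real ^ 3 \<Rightarrow> complex) set" where
  "L2_sphere = {f \<in> borel_measurable sphere_measure.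
                  integrable sphere_measure (\<lambda>x. (cmod (f x))\<^sup>2)}"

definition L2_norm :: "(real ^ 3 \<Rightarrow> complex) \<Rightarrow> real" where
  "L2_norm f = sqrt (\<integral>x. (cmod (f x))\<^sup>2 \<partial>sphere_measure)"

definition L2_inner :: "(real ^ 3 \<Rightarrow> complex) \<Rightarrow> (real ^ 3 \<Rightarrow> complex) \<Rightarrow> complex" where
  "L2_inner f g = (\<integral>x. f x * cnj (g x) \<partial>sphere_measure)"

text \<open>The space \<open>L\<^sup>2(\<Omega>; L\<^sup>2(S\<^sup>2))\<close>.  As \<open>L\<^sup>2(S\<^sup>2)\<close> is separable, its Borel sigma-algebra is
  generated by the balls, so Borel measurability of \<open>Z\<close> amounts to measurability of its
  distance to each fixed element.\<close>

definition L2_random_field :: "'w measure \<Rightarrow> ('w \<Rightarrow> real ^ 3 \<Rightarrow> complex) \<Rightarrow> bool" where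
  "L2_random_field M Z \<longleftrightarrow>
     (\<forall>\<omega>\<in>space M. Z \<omega> \<in> L2_sphere) \<and>
     (\<forall>g\<in>L2_sphere. (\<lambda>\<omega>. L2_norm (\<lambda>x. Z \<omega> x - g x)) \<in> borel_measurable M) \<and>
     integrable M (\<lambda>\<omega>. (L2_norm (Z \<omega>))\<^sup>2)"

text \<open>Legendre polynomials by Rodrigues' formula; associated Legendre functions with the
  Condon--Shortley phase \<open>(-1)\<^sup>m\<close>.\<close>

definition legendre_poly :: "nat \<Rightarrow> real poly" where
  "legendre_poly l = smult (1 / (2 ^ l * fact l)) ((pderiv ^^ l) ([:-1, 0, 1:] ^ l))"

definition assoc_legendre :: "nat \<Rightarrow> nat \<Rightarrow> real \<Rightarrow> real" where
  "assoc_legendre l m \<mu> =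
     (-1) ^ m * sqrt (1 - \<mu>\<^sup>2) ^ m * poly ((pderiv ^^ m) (legendre_poly l)) \<mu>"

text \<open>On the unit sphere \<open>x $ 3\<close> is the cosine of the colatitude and
  \<open>Arg2pi (Complex (x $ 1) (x $ 2))\<close>, with values in \<open>[0, 2 \<pi>)\<close>, is the longitude.\<close>

definition sph_harm_nonneg :: "nat \<Rightarrow> nat \<Rightarrow> real ^ 3 \<Rightarrow> complex" where
  "sph_harm_nonneg l m x =
     of_real (sqrt ((2 * real l + 1) / (4 * pi) * (fact (l - m) / fact (l + m)))
              * assoc_legendre l m (x $ 3))
     * cis (real m * Arg2pi (Complex (x $ 1) (x $ 2)))"

definition sph_harm :: "nat \<Rightarrow> int \<Rightarrow> real ^ 3 \<Rightarrow> complex" where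
  "sph_harm l m x =
     (if 0 \<le> m then sph_harm_nonneg l (nat m) x
      else (-1) ^ nat (- m) * cnj (sph_harm_nonneg l (nat (- m)) x))"

text \<open>\<open>time_partition \<tau> n a b\<close>: the points \<open>a = \<tau>\<^sub>0 < ... < \<tau>\<^sub>n = b\<close>.\<close>

definition time_partition :: "(nat \<Rightarrow> real) \<Rightarrow> nat \<Rightarrow> real \<Rightarrow> real \<Rightarrow> bool" where
  "time_partition \<tau> n a b \<longleftrightarrow> \<tau> 0 = a \<and> \<tau> n = b \<and> (\<forall>k<n. \<tau> k < \<tau> (Suc k))"

definition brownian_motion_on :: "'w measure \<Rightarrow> real \<Rightarrow> (real \<Rightarrow> 'w \<Rightarrow> real) \<Rightarrow> bool" where
  "brownian_motion_on M T B \<longleftrightarrow>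
     (\<forall>t\<in>{0..T}. B t \<in> borel_measurable M) \<and>
     (AE \<omega> in M. B 0 \<omega> = 0) \<and>
     (\<forall>s t. 0 \<le> s \<and> s < t \<and> t \<le> T \<longrightarrow>
        distributed M lborel (\<lambda>\<omega>. B t \<omega> - B s \<omega>) (normal_density 0 (sqrt (t - s)))) \<and>
     (\<forall>n \<tau> t. t \<le> T \<and> time_partition \<tau> n 0 t \<longrightarrow>
        prob_space.indep_vars M (\<lambda>_. borel) (\<lambda>k \<omega>. B (\<tau> (Suc k)) \<omega> - B (\<tau> k) \<omega>) {..<n}) \<and>
     (AE \<omega> in M. continuous_on {0..T} (\<lambda>t. B t \<omega>))"

definition step_fun :: "(nat \<Rightarrow> real) \<Rightarrow> nat \<Rightarrow> (nat \<Rightarrow> real) \<Rightarrow> real \<Rightarrow> real" where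
  "step_fun \<tau> n c s = (\<Sum>k<n. c k * indicator {\<tau> k<..\<tau> (Suc k)} s)"

definition step_integral ::
    "(real \<Rightarrow> 'w \<Rightarrow> real) \<Rightarrow> (nat \<Rightarrow> real) \<Rightarrow> nat \<Rightarrow> (nat \<Rightarrow> real) \<Rightarrow> 'w \<Rightarrow> real" where
  "step_integral B \<tau> n c \<omega> = (\<Sum>k<n. c k * (B (\<tau> (Suc k)) \<omega> - B (\<tau> k) \<omega>))"

text \<open>\<open>I\<close> is a version of \<open>\<integral>\<^sub>a\<^sup>b f dB\<close>: the limit in \<open>L\<^sup>2(\<Omega>)\<close> of the integrals of step
  functions that converge to \<open>f\<close> in \<open>L\<^sup>2(a, b)\<close>.\<close>

definition has_wiener_integral ::
    "'w measure \<Rightarrow> (real \<Rightarrow> 'w \<Rightarrow> real) \<Rightarrow> real \<Rightarrow> real \<Rightarrow> (real \<Rightarrow> real) \<Rightarrow> ('w \<Rightarrow> real) \<Rightarrow> bool" where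
  "has_wiener_integral M B a b f I \<longleftrightarrow>
     I \<in> borel_measurable M \<and>
     (\<exists>\<tau> n c.
        (\<forall>j. time_partition (\<tau> j) (n j) a b) \<and>
        (\<lambda>j. \<integral>\<^sup>+s\<in>{a..b}. ennreal ((f s - step_fun (\<tau> j) (n j) (c j) s)\<^sup>2) \<partial>lborel)
          \<longlonglongrightarrow> 0 \<and>
        (\<lambda>j. \<integral>\<^sup>+\<omega>. ennreal ((I \<omega> - step_integral B (\<tau> j) (n j) (c j) \<omega>)\<^sup>2) \<partial>M)
          \<longlonglongrightarrow> 0)"

definition wiener_integral ::
    "'w measure \<Rightarrow> (real \<Rightarrow> 'w \<Rightarrow> real) \<Rightarrow> real \<Rightarrow> real \<Rightarrow> (real \<Rightarrow> real) \<Rightarrow> 'w \<Rightarrow> real" where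
  "wiener_integral M B a b f = (SOME I. has_wiener_integral M B a b f I)"

text \<open>\<open>B i l m\<close> is the real Brownian motion \<open>\<beta>\<^sup>i\<^sub>l\<^sub>m\<close>; those that occur in the expansion of
  \<open>W\<close> have \<open>i = 1\<close>, \<open>0 \<le> m \<le> l\<close> or \<open>i = 2\<close>, \<open>1 \<le> m \<le> l\<close>.\<close>

definition noise_indices :: "(nat \<times> nat \<times> nat) set" where
  "noise_indices = {(i, l, m). i = 1 \<and> m \<le> l \<or> i = 2 \<and> 1 \<le> m \<and> m \<le> l}"

text \<open>The isotropic Q-Wiener process
  \<open>W(t) = \<Sum>\<^sub>l (sqrt (A l) B\<^sub>1\<^sub>l\<^sub>0(t) Y\<^sub>l\<^sub>0 + sqrt (2 A l) \<Sum>\<^sub>m\<^sub>\<ge>\<^sub>1 (B\<^sub>1\<^sub>l\<^sub>m(t) Re Y\<^sub>l\<^sub>m + B\<^sub>2\<^sub>l\<^sub>m(t) Im Y\<^sub>l\<^sub>m))\<close>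
  is represented by the data of its expansion, the angular power spectrum \<open>A\<close> and the
  independent Brownian motions \<open>B\<close>.  Independence is that of the processes, i.e. of the
  random elements \<open>B i l m\<close> of the path space over \<open>[0, T]\<close>.\<close>

definition isotropic_Q_wiener ::
    "'w measure \<Rightarrow> real \<Rightarrow> (nat \<Rightarrow> real) \<Rightarrow> (nat \<Rightarrow> nat \<Rightarrow> nat \<Rightarrow> real \<Rightarrow> 'w \<Rightarrow> real) \<Rightarrow> bool" where
  "isotropic_Q_wiener M T A B \<longleftrightarrow>
     (\<forall>l. 0 \<le> A l) \<and>
     (\<forall>(i, l, m)\<in>noise_indices. brownian_motion_on M T (B i l m)) \<and>
     prob_space.indep_vars M (\<lambda>_. \<Pi>\<^sub>M t\<in>{0..T}. borel)
       (\<lambda>(i, l, m) \<omega>. \<lambda>t\<in>{0..T}. B i l m t \<omega>) noise_indices"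

definition eigval :: "nat \<Rightarrow> real" where
  "eigval l = real l * (real l + 1)"

definition noise_coeff ::
    "'w measure \<Rightarrow> (nat \<Rightarrow> nat \<Rightarrow> nat \<Rightarrow> real \<Rightarrow> 'w \<Rightarrow> real) \<Rightarrow> nat \<Rightarrow> nat \<Rightarrow> nat
       \<Rightarrow> real \<Rightarrow> real \<Rightarrow> 'w \<Rightarrow> real" where
  "noise_coeff M B i l m a b = wiener_integral M (B i l m) a b (\<lambda>s. exp (- eigval l * (b - s)))"

text \<open>The degree \<open>l\<close> part of the noise accumulated over \<open>[a, b]\<close>: it is the stochastic
  convolution for \<open>a = 0\<close>, \<open>b = t\<close> and the increment \<open>\<psi>\<^sub>l(k)\<close> for \<open>a = t\<^sub>k\<close>, \<open>b = t\<^sub>k\<^sub>+\<^sub>1\<close>.\<close>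

definition heat_noise ::
    "'w measure \<Rightarrow> (nat \<Rightarrow> real) \<Rightarrow> (nat \<Rightarrow> nat \<Rightarrow> nat \<Rightarrow> real \<Rightarrow> 'w \<Rightarrow> real) \<Rightarrow> nat
       \<Rightarrow> real \<Rightarrow> real \<Rightarrow> 'w \<Rightarrow> real ^ 3 \<Rightarrow> complex" where
  "heat_noise M A B l a b \<omega> x =
     of_real (sqrt (A l)) *
       (of_real (noise_coeff M B 1 l 0 a b \<omega>) * sph_harm l 0 x
        + of_real (sqrt 2) *
          (\<Sum>m=1..l. of_real (noise_coeff M B 1 l m a b \<omega> * Re (sph_harm l (int m) x)
                             + noise_coeff M B 2 l m a b \<omega> * Im (sph_harm l (int m) x))))"

definition initial_part ::
    "('w \<Rightarrow> real ^ 3 \<Rightarrow> complex) \<Rightarrow> nat \<Rightarrow> 'w \<Rightarrow> real ^ 3 \<Rightarrow> complex" where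
  "initial_part X0 l \<omega> x =
     (\<Sum>m\<in>{- int l..int l}. L2_inner (X0 \<omega>) (sph_harm l m) * sph_harm l m x)"

definition heat_component ::
    "'w measure \<Rightarrow> (nat \<Rightarrow> real) \<Rightarrow> (nat \<Rightarrow> nat \<Rightarrow> nat \<Rightarrow> real \<Rightarrow> 'w \<Rightarrow> real)
       \<Rightarrow> ('w \<Rightarrow> real ^ 3 \<Rightarrow> complex) \<Rightarrow> nat \<Rightarrow> real \<Rightarrow> 'w \<Rightarrow> real ^ 3 \<Rightarrow> complex" where
  "heat_component M A B X0 l t \<omega> x =
     of_real (exp (- eigval l * t)) * initial_part X0 l \<omega> x + heat_noise M A B l 0 t \<omega> x"

text \<open>\<open>X(t) = \<Sum>\<^sub>l X\<^sub>l(t)\<close>, with convergence in \<open>L\<^sup>2(S\<^sup>2)\<close> almost surely for each \<open>t\<close>.\<close>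

definition heat_solution ::
    "'w measure \<Rightarrow> real \<Rightarrow> (nat \<Rightarrow> real) \<Rightarrow> (nat \<Rightarrow> nat \<Rightarrow> nat \<Rightarrow> real \<Rightarrow> 'w \<Rightarrow> real)
       \<Rightarrow> ('w \<Rightarrow> real ^ 3 \<Rightarrow> complex) \<Rightarrow> (real \<Rightarrow> 'w \<Rightarrow> real ^ 3 \<Rightarrow> complex) \<Rightarrow> bool" where
  "heat_solution M T A B X0 X \<longleftrightarrow>
     (\<forall>t\<in>{0..T}. AE \<omega> in M.
        X t \<omega> \<in> L2_sphere \<and>
        (\<lambda>N. L2_norm (\<lambda>x. X t \<omega> x - (\<Sum>l\<le>N. heat_component M A B X0 l t \<omega> x))) \<longlonglongrightarrow> 0)"

text \<open>The recursive representation of \<open>X\<^sub>l\<close> at the grid points of \<open>\<tau>\<close>.  A single step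
  from \<open>0\<close> to \<open>t\<close> gives \<open>heat_component\<close> at time \<open>t\<close>.\<close>

primrec heat_recursion ::
    "'w measure \<Rightarrow> (nat \<Rightarrow> real) \<Rightarrow> (nat \<Rightarrow> nat \<Rightarrow> nat \<Rightarrow> real \<Rightarrow> 'w \<Rightarrow> real)
       \<Rightarrow> ('w \<Rightarrow> real ^ 3 \<Rightarrow> complex) \<Rightarrow> nat \<Rightarrow> (nat \<Rightarrow> real) \<Rightarrow> nat \<Rightarrow> 'w \<Rightarrow> real ^ 3 \<Rightarrow> complex" where
  "heat_recursion M A B X0 l \<tau> 0 = initial_part X0 l"
| "heat_recursion M A B X0 l \<tau> (Suc k) =
     (\<lambda>\<omega> x. of_real (exp (- eigval l * (\<tau> (Suc k) - \<tau> k))) * heat_recursion M A B X0 l \<tau> k \<omega> x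
             + heat_noise M A B l (\<tau> k) (\<tau> (Suc k)) \<omega> x)"

definition heat_approx ::
    "'w measure \<Rightarrow> (nat \<Rightarrow> real) \<Rightarrow> (nat \<Rightarrow> nat \<Rightarrow> nat \<Rightarrow> real \<Rightarrow> 'w \<Rightarrow> real)
       \<Rightarrow> ('w \<Rightarrow> real ^ 3 \<Rightarrow> complex) \<Rightarrow> nat \<Rightarrow> (nat \<Rightarrow> real) \<Rightarrow> nat \<Rightarrow> 'w \<Rightarrow> real ^ 3 \<Rightarrow> complex" where
  "heat_approx M A B X0 \<kappa> \<tau> n \<omega> x = (\<Sum>l\<le>\<kappa>. heat_recursion M A B X0 l \<tau> n \<omega> x)"

end

theory Submission
  imports Defs "HOL-Real_Asymp.Real_Asymp"
begin

text \<open>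
  The error \<open>X t - X\<^sup>\<kappa> t\<close> is the part of the expansion of \<open>X t\<close> in degrees \<open>l > \<kappa>\<close>.  As the
  \<open>Y\<^sub>l\<^sub>m\<close> are orthonormal (\<open>L2_inner_sph_harm\<close>), its squared norm is the sum of the squared moduli
  of the coefficients.  For \<open>t \<ge> \<delta>\<close> those of the initial value carry the factor
  \<open>exp (- l (l + 1) \<delta>)\<close>, which beats every power of \<open>l\<close>.  Those of the noise are \<open>sqrt (A l)\<close> times
  values of Ornstein--Uhlenbeck processes with rate \<open>\<nu> = l (l + 1)\<close>, hence of variance at most
  \<open>1 / (2 \<nu>)\<close>; there are \<open>2 l + 1\<close> of them in degree \<open>l\<close>, so the expected tail is of the order of
  \<open>\<Sum>\<^sub>l\<^sub>>\<^sub>\<kappa> l powr (- \<alpha> - 1)\<close>, that is, of \<open>\<kappa> powr (- \<alpha>)\<close>.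

  The threshold \<open>\<kappa>\<^sub>0\<close> is one random variable that serves all times and all grids; only the
  exceptional null set may depend on them.  Pointwise moments do not suffice for that.  The
  processes are therefore controlled by one random variable each, the weighted sum \<open>ou_modulus\<close> of
  the \<open>2p\<close>-th powers of all increments over dyadic intervals.  Chaining bounds the values at dyadic
  times by it, and a value at any other fixed time is almost surely a limit of such values
  (\<open>ou_le_modulus\<close>).  Its expectation is \<open>O(\<nu> ^ (3 - p))\<close> instead of the \<open>O(\<nu> ^ (- p))\<close> of a single
  value (\<open>ou_modulus_integral\<close>).  After taking \<open>p\<close>-th roots and collecting all modes in one
  variable (\<open>noise_envelope\<close>) the loss is a factor \<open>l powr (11 / p)\<close> in all; for large \<open>p\<close> the
  strict inequality \<open>\<beta> < \<alpha> / 2\<close> absorbs it.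

  A Wiener integral is an unspecified \<open>L\<^sup>2\<close> limit of integrals of step functions, so everything
  about it comes from the isometry for step functions (\<open>nn_isometry\<close>): its existence for Lipschitz
  integrands, its moments, and its additivity over adjacent intervals up to null sets
  (\<open>wiener_integral_split\<close>).  Additivity shows that the recursion reproduces the stochastic
  convolution almost surely (\<open>heat_recursion_eq_component\<close>); this is why the grid does not matter.
\<close>

section \<open>Legendre polynomials\<close>

definition poly_integral :: "real poly \<Rightarrow> real" where
  "poly_integral p = integral {-1..1} (poly p)"

lemma poly_integral_pderiv: "poly_integral (pderiv p) = poly p 1 - poly p (-1)"
proof -
  have "(poly (pderiv p) has_integral (poly p 1 - poly p (-1))) {-1..1}"
    by (intro fundamental_theorem_of_calculus)
       (auto simp: has_real_derivative_iff_has_vector_derivative[symmetric]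
             intro: has_field_derivative_at_within poly_DERIV)
  then show ?thesis
    unfolding poly_integral_def by (rule integral_unique)
qed

lemma poly_integrable_interval: "poly p integrable_on {-1..1::real}"
  by (intro integrable_continuous_interval continuous_intros)

lemma poly_integral_add: "poly_integral (p + q) = poly_integral p + poly_integral q"
  unfolding poly_integral_def poly_add
  by (rule Henstock_Kurzweil_Integration.integral_add) (rule poly_integrable_interval)+

lemma poly_integral_smult: "poly_integral (smult c p) = c * poly_integral p"
  unfolding poly_integral_def poly_smult by simp

lemma poly_integral_parts:
  "poly_integral (pderiv p * q)
     = poly p 1 * poly q 1 - poly p (-1) * poly q (-1) - poly_integral (p * pderiv q)"
proof -
  have "poly_integral (pderiv p * q) + poly_integral (p * pderiv q) = poly_integral (pderiv (p * q))"
    by (simp add: pderiv_mult poly_integral_add[symmetric] algebra_simps)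
  then show ?thesis
    by (simp add: poly_integral_pderiv)
qed

text \<open>
  Without boundary terms each of the \<open>n\<close> derivatives moves to the other factor at the cost of a
  sign.  The polynomials to which this applies are \<open>(1 - x\<^sup>2)\<^sup>m\<close> times another one, and
  \<open>(x\<^sup>2 - 1)\<^sup>l\<close> from the formula of Rodrigues.
\<close>

lemma poly_integral_parts_iterated:
  assumes "\<And>j. j < n \<Longrightarrow> poly ((pderiv ^^ j) p) 1 = 0 \<and> poly ((pderiv ^^ j) p) (-1) = 0"
  shows "poly_integral ((pderiv ^^ n) p * q) = (-1) ^ n * poly_integral (p * (pderiv ^^ n) q)"
  using assms
proof (induction n arbitrary: q)
  case (Suc n)
  have "poly_integral ((pderiv ^^ Suc n) p * q) = - poly_integral ((pderiv ^^ n) p * pderiv q)"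
    using Suc.prems[of n] by (simp add: poly_integral_parts)
  also have "\<dots> = - ((-1) ^ n * poly_integral (p * (pderiv ^^ n) (pderiv q)))"
    using Suc by simp
  finally show ?case
    by (simp add: funpow_swap1)
qed simp

abbreviation x2m1 :: "real poly" where "x2m1 \<equiv> [:-1, 0, 1:]"

lemma power_dvd_pderiv:
  fixes u p :: "real poly"
  assumes "u ^ Suc n dvd p" shows "u ^ n dvd pderiv p"
proof -
  obtain r where "p = u ^ Suc n * r"
    using assms by (auto elim: dvdE)
  then have "pderiv p = u ^ n * (u * pderiv r + smult (of_nat (Suc n)) (pderiv u) * r)"
    by (simp only: pderiv_mult pderiv_power_Suc) (simp add: algebra_simps)
  then show ?thesis by simp
qed

lemma power_dvd_higher_pderiv:
  fixes u p :: "real poly"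
  assumes "u ^ (n + j) dvd p" shows "u ^ n dvd (pderiv ^^ j) p"
  using assms
proof (induction j arbitrary: n)
  case (Suc j)
  then show ?case using Suc.IH[of "Suc n"] power_dvd_pderiv by simp
qed simp

lemma higher_pderiv_vanishes:
  assumes "x2m1 ^ n dvd p" "j < n"
  shows "poly ((pderiv ^^ j) p) 1 = 0 \<and> poly ((pderiv ^^ j) p) (-1) = 0"
proof -
  have "x2m1 ^ (Suc 0 + j) dvd p"
    by (rule dvd_trans[OF le_imp_power_dvd assms(1)]) (use assms(2) in linarith)
  then have "x2m1 ^ Suc 0 dvd (pderiv ^^ j) p" by (rule power_dvd_higher_pderiv)
  then show ?thesis by (auto elim!: dvdE)
qed

text \<open>
  Integration by parts with \<open>1\<close> as the derivative of \<open>x\<close> gives the two-term recursion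
  \<open>(2 l + 3) I\<^sub>l\<^sub>+\<^sub>1 = - 2 (l + 1) I\<^sub>l\<close>.
\<close>

lemma poly_integral_x2m1_power:
  "poly_integral (x2m1 ^ l) = (-1) ^ l * 2 ^ (2 * l + 1) * (fact l)\<^sup>2 / fact (2 * l + 1)"
proof (induction l)
  case 0
  have "poly_integral 1 = poly_integral (pderiv [:0, 1:])" by (simp add: pderiv_pCons one_pCons)
  then show ?case by (simp only: poly_integral_pderiv) (simp add: poly_integral_pderiv)
next
  case (Suc l)
  let ?I = "\<lambda>l. poly_integral (x2m1 ^ l)"
  have "?I (Suc l) = poly_integral (pderiv [:0, 1:] * x2m1 ^ Suc l)"
    by (simp add: pderiv_pCons)
  also have "\<dots> = - poly_integral ([:0, 1:] * pderiv (x2m1 ^ Suc l))"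
    by (simp add: poly_integral_parts)
  also have "[:0, 1:] * pderiv (x2m1 ^ Suc l) =
      smult (2 * real (Suc l)) (x2m1 ^ Suc l + x2m1 ^ l)"
  proof -
    have "[:0, 1:] * [:0, 2:] = smult 2 (x2m1 + 1)" by (simp add: one_pCons)
    note * = this
    have "[:0, 1:] * (smult c (x2m1 ^ l) * [:0, 2:]) = smult (2 * c) (x2m1 ^ Suc l + x2m1 ^ l)" for c
    proof -
      have "[:0, 1:] * (smult c (x2m1 ^ l) * [:0, 2:]) = smult c (([:0, 1:] * [:0, 2:]) * x2m1 ^ l)"
        by (simp only: mult_smult_left mult_smult_right mult_ac)
      also have "\<dots> = smult (2 * c) ((x2m1 + 1) * x2m1 ^ l)"
        by (simp only: * mult_smult_left smult_smult mult.commute[of c 2])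
      finally show ?thesis
        by (simp only: distrib_right mult_1 power_Suc)
    qed
    then show ?thesis
      by (simp only: pderiv_power_Suc) (simp add: pderiv_pCons)
  qed
  finally have "?I (Suc l) = - (2 * real (Suc l) * (?I (Suc l) + ?I l))"
    by (simp only: poly_integral_smult poly_integral_add)
  moreover have "(2 * real l + 3) * a = - (2 * (real l + 1)) * b"
    if "a = - (2 * real (Suc l) * (a + b))" for a b
    using that by (simp add: algebra_simps)
  ultimately have "(2 * real l + 3) * ?I (Suc l) = - (2 * (real l + 1)) * ?I l"
    by blast
  then have *: "?I (Suc l) = - (2 * (real l + 1)) * ?I l / (2 * real l + 3)"
    by (simp add: field_simps)
  have f: "fact (2 * Suc l + 1) = (2 * real l + 3) * (2 * (real l + 1)) * fact (2 * l + 1)"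
    by (simp add: algebra_simps)
  have cancel: "- (2 * b) * (s * p * q\<^sup>2 / g) / c = (- s) * (4 * p) * (b * q)\<^sup>2 / (c * (2 * b) * g)"
    if "b \<noteq> 0" "c \<noteq> 0" "g \<noteq> 0" for b c g s p q :: real
    using that by (simp add: divide_simps power2_eq_square)
  have pow: "(2::real) ^ (2 * Suc l + 1) = 4 * 2 ^ (2 * l + 1)" "fact (Suc l) = (real l + 1) * fact l"
      "(- 1 :: real) ^ Suc l = - ((- 1) ^ l)"
    by simp_all
  show ?case
    unfolding * Suc.IH f pow by (rule cancel) (simp_all add: add_nonneg_eq_0_iff)
qed

lemma coeff_higher_pderiv_fact:
  fixes p :: "real poly"
  shows "coeff ((pderiv ^^ m) p) n = fact (n + m) / fact n * coeff p (n + m)"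
proof -
  have "fact n * pochhammer (real (Suc n)) m = fact (n + m)"
    using pochhammer_product'[of "1::real" n m] by (simp add: pochhammer_fact)
  then show ?thesis
    by (simp add: coeff_higher_pderiv field_simps)
qed

lemma coeff_legendre: "coeff (legendre_poly l) l = fact (2 * l) / (2 ^ l * (fact l)\<^sup>2)"
proof -
  have "coeff (x2m1 ^ l) (2 * l) = 1"
    using lead_coeff_power[of x2m1 l]
    by (simp add: degree_power_eq mult_2)
  then show ?thesis
    by (simp add: legendre_poly_def coeff_higher_pderiv_fact mult_2[symmetric] power2_eq_square)
qed

lemma degree_legendre: "Polynomial.degree (legendre_poly l) \<le> l"
  by (simp add: legendre_poly_def degree_higher_pderiv degree_power_eq)

text \<open>
  After \<open>m\<close> integrations by parts \<open>P\<^sub>l\<close> stands against \<open>D\<^sup>m ((1 - x\<^sup>2)\<^sup>m D\<^sup>m p)\<close>, whose degree is at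
  most \<open>l\<close>.  By Rodrigues' formula \<open>l\<close> further integrations by parts leave the \<open>l\<close>-th derivative of
  that polynomial, a constant, against \<open>(x\<^sup>2 - 1)\<^sup>l\<close>.  So only the coefficient of \<open>x\<^sup>l\<close> in \<open>p\<close> counts;
  both the orthogonality and the normalisation follow by specialising \<open>p\<close>.
\<close>

lemma legendre_orthogonal_general:
  assumes "m \<le> l" "Polynomial.degree p \<le> l"
  shows "poly_integral ((- x2m1) ^ m * (pderiv ^^ m) p * (pderiv ^^ m) (legendre_poly l))
    = 2 * 2 ^ l * fact l * (fact (l + m) / (fact (l - m) * fact (2 * l + 1))) * fact l * coeff p l"
proof -
  define R where "R = (- x2m1) ^ m * (pderiv ^^ m) p"
  define Q where "Q = (pderiv ^^ m) R"
  have "x2m1 ^ m dvd R"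
    unfolding R_def power_minus[of x2m1] by (metis dvd_triv_left dvd_mult2 mult.commute)
  then have v1: "j < m \<Longrightarrow> poly ((pderiv ^^ j) R) 1 = 0 \<and> poly ((pderiv ^^ j) R) (-1) = 0" for j
    by (rule higher_pderiv_vanishes)
  have v2: "j < l \<Longrightarrow> poly ((pderiv ^^ j) (x2m1 ^ l)) 1 = 0 \<and>
      poly ((pderiv ^^ j) (x2m1 ^ l)) (-1) = 0" for j
    by (rule higher_pderiv_vanishes) simp_all
  have dm: "Polynomial.degree ((- x2m1) ^ m) = 2 * m" by (simp add: degree_power_eq)
  have dR: "Polynomial.degree R \<le> l + m"
  proof -
    have "Polynomial.degree R \<le> 2 * m + (Polynomial.degree p - m)"
      unfolding R_def by (rule order_trans[OF degree_mult_le]) (simp only: dm degree_higher_pderiv le_refl)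
    then show ?thesis using assms by simp
  qed
  then have dQ: "Polynomial.degree Q \<le> l"
    unfolding Q_def by (simp add: degree_higher_pderiv)
  have lc: "coeff ((- x2m1) ^ m) (2 * m) = (-1) ^ m"
    using lead_coeff_power[of "- x2m1" m] by (simp add: degree_power_eq mult_2)
  have cR: "coeff R (l + m) = (-1) ^ m * (fact l / fact (l - m) * coeff p l)"
  proof -
    have eq: "l + m = 2 * m + (l - m)" using assms by simp
    have "coeff R (2 * m + (l - m)) = coeff ((- x2m1) ^ m) (2 * m) * coeff ((pderiv ^^ m) p) (l - m)"
    proof (cases "Polynomial.degree ((pderiv ^^ m) p) = l - m")
      case True
      then show ?thesis unfolding R_def using coeff_mult_degree_sum[of "(- x2m1) ^ m" "(pderiv ^^ m) p"]
        by (simp only: dm)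
    next
      case False
      then have lt: "Polynomial.degree ((pderiv ^^ m) p) < l - m"
        using assms by (simp add: degree_higher_pderiv)
      have "Polynomial.degree R < 2 * m + (l - m)"
        unfolding R_def by (rule le_less_trans[OF degree_mult_le]) (use lt dm in linarith)
      then show ?thesis using lt by (simp add: coeff_eq_0)
    qed
    then show ?thesis using assms lc by (simp add: eq[symmetric] coeff_higher_pderiv_fact)
  qed
  have cQ: "coeff Q l = fact (l + m) / fact l * coeff R (l + m)"
    unfolding Q_def by (rule coeff_higher_pderiv_fact)
  have DQ: "(pderiv ^^ l) Q = [:fact l * coeff Q l:]"
  proof (rule poly_eqI)
    fix n show "coeff ((pderiv ^^ l) Q) n = coeff [:fact l * coeff Q l:] n"
      using dQ by (cases n) (auto simp: coeff_higher_pderiv_fact coeff_eq_0)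
  qed
  have "poly_integral (R * (pderiv ^^ m) (legendre_poly l))
     = (-1) ^ m * poly_integral (Q * legendre_poly l)"
    using poly_integral_parts_iterated[OF v1, of m "legendre_poly l"]
    by (simp add: Q_def power_mult_distrib[symmetric] flip: mult.assoc)
  also have "Q * legendre_poly l = smult (1 / (2 ^ l * fact l)) ((pderiv ^^ l) (x2m1 ^ l) * Q)"
    by (simp add: legendre_poly_def mult.commute)
  also have "poly_integral \<dots>
      = 1 / (2 ^ l * fact l) * ((-1) ^ l * poly_integral (smult (fact l * coeff Q l) (x2m1 ^ l)))"
    using poly_integral_parts_iterated[OF v2, of l Q] DQ
    by (simp add: poly_integral_smult)
  finally have "poly_integral (R * (pderiv ^^ m) (legendre_poly l))
     = (-1) ^ m * (1 / (2 ^ l * fact l) * ((-1) ^ l * (fact l * coeff Q l * poly_integral (x2m1 ^ l))))"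
    by (simp add: poly_integral_smult)
  note gen = this
  have cancel: "s * (1 / (p * f) * (r * (f * (a / f * (s * (f / b * c))) * (r * (2 * (p * p)) * f\<^sup>2 / g))))
      = 2 * p * f * (a / (b * g)) * f * c"
    if "s * s = 1" "r * r = 1" "p \<noteq> 0" "f \<noteq> 0" "b \<noteq> 0" "g \<noteq> 0" for s p f r a b c g :: real
  proof -
    have "s * (1 / (p * f) * (r * (f * (a / f * (s * (f / b * c))) * (r * (2 * (p * p)) * f\<^sup>2 / g))))
      = (s * s) * (r * r) * (2 * p * f * (a / (b * g)) * f * c)"
    proof -
      have e1: "f * (a / f * x) = a * x" for x
        using that by simp
      have e2: "1 / (p * f) * (r * (y * (r * (2 * (p * p)) * f\<^sup>2 / g))) = r * r * (y * (2 * p * f / g))" for y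
        using that(3-) by (simp add: power2_eq_square)
      show ?thesis
        unfolding e1 e2 by (simp add: mult_ac)
    qed
    then show ?thesis using that by simp
  qed
  have pow: "(2::real) ^ (2 * l + 1) = 2 * (2 ^ l * 2 ^ l)"
    using power_add[of "2::real" l l] by (simp add: mult_2[of l])
  have sgn: "(- 1 :: real) ^ k * (- 1) ^ k = 1" for k
    by (simp add: power_mult_distrib[symmetric])
  show ?thesis
    unfolding R_def[symmetric] gen cQ cR poly_integral_x2m1_power pow
    by (rule cancel[OF sgn sgn]) simp_all
qed

lemma legendre_orthogonality:
  assumes "m \<le> l" "m \<le> l'"
  shows "poly_integral ((- x2m1) ^ m * (pderiv ^^ m) (legendre_poly l) * (pderiv ^^ m) (legendre_poly l'))
    = (if l = l' then 2 / (2 * real l + 1) * (fact (l + m) / fact (l - m)) else 0)"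
proof (cases l l' rule: linorder_cases)
  case less
  then show ?thesis
    using legendre_orthogonal_general[of m l' "legendre_poly l"] degree_legendre[of l] assms
    by (simp add: coeff_eq_0)
next
  case greater
  then have "poly_integral ((- x2m1) ^ m * (pderiv ^^ m) (legendre_poly l') * (pderiv ^^ m) (legendre_poly l)) = 0"
    using legendre_orthogonal_general[of m l "legendre_poly l'"] degree_legendre[of l'] assms
    by (simp add: coeff_eq_0)
  then show ?thesis using greater by (simp add: mult_ac)
next
  case equal
  define h where "h = 2 * real l + 1"
  have "h \<noteq> 0" by (simp add: h_def add_nonneg_eq_0_iff)
  have fac: "fact (2 * l + 1) = h * fact (2 * l)" by (simp add: h_def)
  have cancel: "2 * p * f * (a / (b * (h * g))) * f * (g / (p * f\<^sup>2)) = 2 / h * (a / b)"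
    if "p \<noteq> 0" "f \<noteq> 0" "b \<noteq> 0" "g \<noteq> 0" for p f a b g :: real
    using that \<open>h \<noteq> 0\<close> by (simp add: divide_simps power2_eq_square)
  have "poly_integral ((- x2m1) ^ m * (pderiv ^^ m) (legendre_poly l) * (pderiv ^^ m) (legendre_poly l))
      = 2 / h * (fact (l + m) / fact (l - m))"
    unfolding legendre_orthogonal_general[OF assms(1) degree_legendre] coeff_legendre fac
    by (rule cancel) simp_all
  then show ?thesis
    unfolding h_def using equal by (simp only: refl if_True)
qed

section \<open>Orthonormality of the spherical harmonics\<close>

lemma sphere_point_simps [simp]:
  "sphere_point (\<theta>, \<phi>) $ 1 = sin \<theta> * cos \<phi>"
  "sphere_point (\<theta>, \<phi>) $ 2 = sin \<theta> * sin \<phi>"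
  "sphere_point (\<theta>, \<phi>) $ 3 = cos \<theta>"
  by (simp_all add: sphere_point_def)

lemma norm_sphere_point: "norm (sphere_point z) = 1"
proof -
  obtain \<theta> \<phi> where z: "z = (\<theta>, \<phi>)" by (cases z)
  have "(sin \<theta> * cos \<phi>)\<^sup>2 + (sin \<theta> * sin \<phi>)\<^sup>2 + (cos \<theta>)\<^sup>2 = 1"
  proof -
    have "(sin \<theta> * cos \<phi>)\<^sup>2 + (sin \<theta> * sin \<phi>)\<^sup>2 + (cos \<theta>)\<^sup>2
        = (sin \<theta>)\<^sup>2 * ((cos \<phi>)\<^sup>2 + (sin \<phi>)\<^sup>2) + (cos \<theta>)\<^sup>2"
      by (simp only: power_mult_distrib distrib_left)
    then show ?thesis by simp
  qed
  then show ?thesis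
    unfolding z norm_vec_def L2_set_def by (simp add: sum_3)
qed

lemma measurable_sphere_point [measurable]:
  "sphere_point \<in> lborel \<rightarrow>\<^sub>M restrict_space borel (sphere 0 1)"
proof (rule measurable_restrict_space2)
  show "sphere_point \<in> space lborel \<rightarrow> sphere 0 1"
    by (simp add: norm_sphere_point)
  have "continuous_on UNIV (\<lambda>z. sphere_point z)"
  proof -
    have "sphere_point z = (\<chi> i. if i = 1 then sin (fst z) * cos (snd z)
        else if i = 2 then sin (fst z) * sin (snd z) else cos (fst z))" for z
      by (cases z) (simp add: vec_eq_iff forall_3)
    moreover have "continuous_on UNIV (\<lambda>z :: real \<times> real. if i = 1 then sin (fst z) * cos (snd z)
        else if i = 2 then sin (fst z) * sin (snd z) else cos (fst z))" for i :: 3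
      by (cases "i = 1"; cases "i = 2") (auto intro!: continuous_intros)
    ultimately show ?thesis by (simp add: continuous_on_vec_lambda)
  qed
  then show "sphere_point \<in> lborel \<rightarrow>\<^sub>M borel"
    by (simp add: borel_measurable_continuous_onI)
qed

lemma space_sphere_measure [simp]: "space sphere_measure = sphere 0 1"
  by (simp add: sphere_measure_def space_restrict_space)

lemma sets_sphere_measure [measurable_cong]:
  "sets sphere_measure = sets (restrict_space borel (sphere 0 1))"
  by (simp add: sphere_measure_def)

definition sphere_density :: "real \<times> real \<Rightarrow> real" where
  "sphere_density z = sin (fst z) * indicator ({0..pi} \<times> {0..<2 * pi}) z"

lemma sphere_density_nonneg: "0 \<le> sphere_density z"
  by (auto simp: sphere_density_def indicator_def sin_ge_zero)

lemma measurable_sphere_density [measurable]: "sphere_density \<in> borel_measurable lborel"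
proof -
  have [measurable]: "{0..pi} \<times> {0..<2 * pi} \<in> sets (borel :: (real \<times> real) measure)"
    unfolding borel_prod[symmetric] by measurable
  have [measurable]: "(\<lambda>z :: real \<times> real. sin (fst z)) \<in> borel_measurable borel"
    by (intro borel_measurable_continuous_onI continuous_intros)
  show ?thesis
    unfolding sphere_density_def[abs_def] by measurable
qed

lemma sphere_measure_eq:
  "sphere_measure = distr (density lborel (\<lambda>z. ennreal (sphere_density z)))
     (restrict_space borel (sphere 0 1)) sphere_point"
proof -
  have "(\<lambda>(\<theta>, \<phi>). ennreal (sin \<theta>) * indicator ({0..pi} \<times> {0..<2 * pi}) (\<theta>, \<phi>))
      = (\<lambda>z. ennreal (sphere_density z))"
    by (auto simp: sphere_density_def indicator_def)
  then show ?thesis by (simp add: sphere_measure_def)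
qed

lemma
  fixes f :: "real ^ 3 \<Rightarrow> complex"
  assumes f [measurable]: "f \<in> borel_measurable sphere_measure"
  shows integral_sphere_measure:
      "(\<integral>x. f x \<partial>sphere_measure) = (\<integral>z. sphere_density z *\<^sub>R f (sphere_point z) \<partial>lborel)" (is ?eq)
    and integrable_sphere_measure_iff:
      "integrable sphere_measure f \<longleftrightarrow> integrable lborel (\<lambda>z. sphere_density z *\<^sub>R f (sphere_point z))"
      (is ?iff)
proof -
  have [measurable]: "f \<in> borel_measurable (restrict_space borel (sphere 0 1))"
    using f by (simp cong: measurable_cong_sets add: sets_sphere_measure)
  have [measurable]: "(\<lambda>z. f (sphere_point z)) \<in> borel_measurable lborel"
    by measurable
  show ?eq
    unfolding sphere_measure_eq
    by (simp add: integral_distr integral_density sphere_density_nonneg)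
  show ?iff
    unfolding sphere_measure_eq
    by (simp add: integrable_distr_eq integrable_density sphere_density_nonneg)
qed

lemma finite_measure_sphere: "finite_measure sphere_measure"
proof
  have "emeasure sphere_measure (space sphere_measure) = (\<integral>\<^sup>+z. ennreal (sphere_density z) \<partial>lborel)"
  proof -
    have "sphere_point -` sphere 0 1 = UNIV" by (auto simp: norm_sphere_point)
    then show ?thesis
      unfolding sphere_measure_eq
      using sets.top[of "restrict_space borel (sphere (0 :: real ^ 3) 1)"]
      by (subst emeasure_distr) (auto simp: emeasure_density space_restrict_space)
  qed
  also have "\<dots> \<le> (\<integral>\<^sup>+z. indicator ({0..pi} \<times> {0..2 * pi}) z \<partial>lborel)"
    by (intro nn_integral_mono) (auto simp: sphere_density_def indicator_def)
  also have "\<dots> = emeasure lborel ({0..pi} \<times> {0..2 * pi})"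
    by (rule nn_integral_indicator) (simp add: lborel_prod[symmetric])
  also have "\<dots> < \<infinity>"
  proof -
    have "{0..pi} \<times> {0..2 * pi} = cbox (0, 0) (pi, 2 * pi)" by (simp add: cbox_Pair_eq)
    then show ?thesis using emeasure_lborel_cbox_finite by metis
  qed
  finally show "emeasure sphere_measure (space sphere_measure) \<noteq> \<infinity>" by simp
qed

definition sph_arg :: "real ^ 3 \<Rightarrow> real" where
  "sph_arg x = Arg2pi (Complex (x $ 1) (x $ 2))"

lemma borel_measurable_Arg2pi [measurable]: "Arg2pi \<in> borel_measurable borel"
  unfolding borel_measurable_iff_greater using open_Arg2pi2pi_gt by simp

lemma sph_arg_sphere_point:
  assumes "0 < sin \<theta>" "0 \<le> \<phi>" "\<phi> < 2 * pi"
  shows "sph_arg (sphere_point (\<theta>, \<phi>)) = \<phi>"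
  unfolding sph_arg_def
  by (rule Arg2pi_unique[of "sin \<theta>"])
     (use assms in \<open>simp_all add: cis_conv_exp[symmetric] complex_eq_iff\<close>)

lemma borel_measurable_vec_component [measurable]:
  "(\<lambda>x::real ^ 3. x $ i) \<in> borel_measurable borel"
  by (intro borel_measurable_continuous_onI continuous_intros)

lemma measurable_sph_arg [measurable]: "sph_arg \<in> borel_measurable borel"
  unfolding sph_arg_def[abs_def] Complex_eq by measurable

lemma borel_measurable_cnj_fun [measurable]: "cnj \<in> borel_measurable borel"
  by (intro borel_measurable_continuous_onI continuous_intros)

lemma borel_measurable_sphereI:
  "f \<in> borel_measurable borel \<Longrightarrow> f \<in> borel_measurable sphere_measure"
  by (simp cong: measurable_cong_sets add: sets_sphere_measure measurable_restrict_space1)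

lemma integrable_sphere_bounded:
  fixes f :: "real ^ 3 \<Rightarrow> complex"
  assumes "f \<in> borel_measurable borel" "\<And>x. norm x = 1 \<Longrightarrow> cmod (f x) \<le> K"
  shows "integrable sphere_measure f"
  using assms
  by (intro finite_measure.integrable_const_bound[OF finite_measure_sphere, of _ K] AE_I2
        borel_measurable_sphereI) auto

lemma integral_cis:
  fixes k :: int
  shows "(\<integral>\<phi>. indicator {0..<2 * pi} \<phi> *\<^sub>R cis (of_int k * \<phi>) \<partial>lborel) = (if k = 0 then 2 * pi else 0)"
proof -
  have "AE \<phi> in lborel. \<phi> \<noteq> 2 * pi" by (rule AE_lborel_singleton)
  then have eq: "(\<integral>\<phi>. indicator {0..<2 * pi} \<phi> *\<^sub>R cis (of_int k * \<phi>) \<partial>lborel)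
      = (\<integral>\<phi>. indicator {0..2 * pi} \<phi> *\<^sub>R cis (of_int k * \<phi>) \<partial>lborel)"
    by (intro integral_cong_AE) (auto simp: indicator_def cis_conv_exp)
  show ?thesis
  proof (cases "k = 0")
    case True
    then show ?thesis by (simp add: eq[unfolded True] scaleR_conv_of_real)
  next
    case False
    let ?F = "\<lambda>\<phi>. exp (\<i> * of_int k * of_real \<phi>) / (\<i> * of_int k)"
    have "(\<integral>\<phi>. indicator {0..2 * pi} \<phi> *\<^sub>R cis (of_int k * \<phi>) \<partial>lborel) = ?F (2 * pi) - ?F 0"
    proof (rule integral_FTC_Icc)
      fix \<phi> :: real
      show "(?F has_vector_derivative cis (of_int k * \<phi>)) (at \<phi> within {0..2 * pi})"
        using False
        by (auto intro!: derivative_eq_intros has_vector_derivative_real_field simp: cis_conv_exp mult_ac)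
    qed (auto intro!: continuous_intros simp: cis_conv_exp)
    also have "exp (\<i> * of_int k * of_real (2 * pi)) = 1"
      using exp_integer_2pi[of "of_int k"] by (simp add: mult_ac)
    finally show ?thesis using eq False by simp
  qed
qed

lemma integral_sin_poly_cos:
  "(\<integral>\<theta>. (sin \<theta> * poly p (cos \<theta>)) * indicator {0..pi} \<theta> \<partial>lborel) = poly_integral p"
proof -
  obtain q where q: "pderiv q = p"
  proof
    define d where "d = Polynomial.degree p"
    have "coeff (\<Sum>i\<le>d. monom (coeff p i / real (Suc i)) (Suc i)) (Suc n) * real (Suc n) = coeff p n" for n
    proof -
      have "coeff (\<Sum>i\<le>d. monom (coeff p i / real (Suc i)) (Suc i)) (Suc n)
          = (\<Sum>i\<le>d. if i = n then coeff p i / real (Suc i) else 0)"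
        by (simp add: coeff_sum coeff_monom)
      also have "\<dots> * real (Suc n) = coeff p n"
        by (cases "n \<le> d") (auto simp: sum.delta d_def coeff_eq_0)
      finally show ?thesis .
    qed
    then show "pderiv (\<Sum>i\<le>d. monom (coeff p i / real (Suc i)) (Suc i)) = p"
      by (intro poly_eqI) (simp add: coeff_pderiv mult.commute)
  qed
  have "(\<integral>\<theta>. (sin \<theta> * poly p (cos \<theta>)) * indicator {0..pi} \<theta> \<partial>lborel)
      = - poly q (cos pi) - (- poly q (cos 0))"
  proof (rule integral_FTC_Icc_real)
    fix \<theta> :: real
    show "((\<lambda>\<theta>. - poly q (cos \<theta>)) has_real_derivative sin \<theta> * poly p (cos \<theta>)) (at \<theta>)"
      unfolding q[symmetric]
      by (rule derivative_eq_intros DERIV_chain2[OF poly_DERIV] refl | simp)+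
    show "isCont (\<lambda>\<theta>. sin \<theta> * poly p (cos \<theta>)) \<theta>"
      by (intro continuous_intros)
  qed simp
  then show ?thesis
    using poly_integral_pderiv[of q] by (simp add: q)
qed

text \<open>
  The real factor of the spherical harmonic for an order \<open>m\<close> of either sign: the conjugation in
  \<open>sph_harm\<close> acts on the longitude factor only, so for \<open>m < 0\<close> just the sign \<open>(-1)\<^sup>m\<close> is added.
\<close>

definition sph_amp :: "nat \<Rightarrow> int \<Rightarrow> real \<Rightarrow> real" where
  "sph_amp l m \<mu> = (if 0 \<le> m then 1 else (-1) ^ nat (- m)) *
     (sqrt ((2 * real l + 1) / (4 * pi) * (fact (l - nat \<bar>m\<bar>) / fact (l + nat \<bar>m\<bar>)))
       * assoc_legendre l (nat \<bar>m\<bar>) \<mu>)"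

lemma sph_harm_polar:
  "sph_harm l m x = of_real (sph_amp l m (x $ 3)) * cis (of_int m * sph_arg x)"
  by (auto simp: sph_harm_def sph_harm_nonneg_def sph_amp_def sph_arg_def cis_cnj)

lemma continuous_on_sph_amp: "continuous_on S (sph_amp l m)"
  unfolding sph_amp_def[abs_def] assoc_legendre_def by (intro continuous_intros)

lemma measurable_sph_harm [measurable]: "sph_harm l m \<in> borel_measurable borel"
proof -
  have [measurable]: "sph_amp l m \<in> borel_measurable borel"
    by (intro borel_measurable_continuous_onI continuous_on_sph_amp)
  show ?thesis
    unfolding sph_harm_polar[abs_def] cis_conv_exp by measurable
qed

lemma sph_harm_bounded: "\<exists>K. \<forall>x. norm x = 1 \<longrightarrow> cmod (sph_harm l m x) \<le> K"
proof -
  have "compact (sph_amp l m ` {-1..1})"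
    by (intro compact_continuous_image continuous_on_sph_amp) simp
  then obtain K where K: "\<And>\<mu>. \<mu> \<in> {-1..1} \<Longrightarrow> \<bar>sph_amp l m \<mu>\<bar> \<le> K"
    by (metis compact_imp_bounded bounded_iff image_eqI real_norm_def)
  have "cmod (sph_harm l m x) \<le> K" if "norm x = 1" for x
    using K[of "x $ 3"] component_le_norm_cart[of x 3] that by (auto simp: sph_harm_polar norm_mult abs_le_iff)
  then show ?thesis by blast
qed

text \<open>
  In spherical coordinates the integral is a product.  The integral over the longitude vanishes
  unless \<open>m = m'\<close>, and the substitution of \<open>cos \<theta>\<close> turns the one over the colatitude into an
  integral of Legendre polynomials.  At the poles, where the longitude of a point is not
  determined, the density \<open>sin \<theta>\<close> vanishes.
\<close>

lemma L2_inner_sph_harm: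
  assumes "nat \<bar>m\<bar> \<le> l" "nat \<bar>m'\<bar> \<le> l'"
  shows "L2_inner (sph_harm l m) (sph_harm l' m') = (if l = l' \<and> m = m' then 1 else 0)"
proof -
  define F where "F = (\<lambda>x. sph_harm l m x * cnj (sph_harm l' m' x))"
  define u where "u = (\<lambda>\<theta>. (sin \<theta> * (sph_amp l m (cos \<theta>) * sph_amp l' m' (cos \<theta>))) * indicator {0..pi} \<theta>)"
  define v where "v = (\<lambda>\<phi>. indicator {0..<2 * pi} \<phi> *\<^sub>R cis (of_int (m - m') * \<phi>))"
  have F_meas [measurable]: "F \<in> borel_measurable borel"
    unfolding F_def by measurable
  obtain K K' where K: "\<And>x. norm x = 1 \<Longrightarrow> cmod (sph_harm l m x) \<le> K"
      "\<And>x. norm x = 1 \<Longrightarrow> cmod (sph_harm l' m' x) \<le> K'"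
    using sph_harm_bounded by metis
  have "cmod (F x) \<le> K * K'" if "norm x = 1" for x
    unfolding F_def norm_mult complex_mod_cnj using K[OF that]
    by (intro mult_mono) (auto intro: order_trans[OF norm_ge_zero])
  then have F_int: "integrable sphere_measure F"
    by (intro integrable_sphere_bounded F_meas)
  have F_sep: "sphere_density z *\<^sub>R F (sphere_point z) = (case z of (\<theta>, \<phi>) \<Rightarrow> u \<theta> *\<^sub>R v \<phi>)" for z
  proof (cases z)
    case (Pair \<theta> \<phi>)
    show ?thesis
    proof (cases "0 < sin \<theta> \<and> 0 \<le> \<phi> \<and> \<phi> < 2 * pi")
      case True
      have "cis (of_int m * \<phi>) * cis (- (of_int m' * \<phi>)) = cis (of_int (m - m') * \<phi>)"
        by (simp add: cis_mult algebra_simps)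
      then show ?thesis
        using True
        by (simp add: Pair F_def u_def v_def sph_harm_polar sph_arg_sphere_point sphere_density_def
            cis_cnj indicator_def scaleR_conv_of_real)
    next
      case False
      have "\<not> 0 < sin \<theta> \<Longrightarrow> \<theta> \<in> {0..pi} \<Longrightarrow> sin \<theta> = 0"
        using sin_ge_zero[of \<theta>] by auto
      then show ?thesis
        using False by (auto simp: Pair u_def v_def sphere_density_def indicator_def)
    qed
  qed
  have "integrable lborel (\<lambda>z. sphere_density z *\<^sub>R F (sphere_point z))"
    using F_int integrable_sphere_measure_iff[OF borel_measurable_sphereI[OF F_meas]] by simp
  then have int: "integrable (lborel \<Otimes>\<^sub>M lborel) (\<lambda>(\<theta>, \<phi>). u \<theta> *\<^sub>R v \<phi>)"
    by (simp add: F_sep lborel_prod)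
  have "L2_inner (sph_harm l m) (sph_harm l' m') = (\<integral>z. sphere_density z *\<^sub>R F (sphere_point z) \<partial>lborel)"
    unfolding L2_inner_def F_def[symmetric]
    by (rule integral_sphere_measure) (rule borel_measurable_sphereI[OF F_meas])
  also have "\<dots> = (\<integral>z. (case z of (\<theta>, \<phi>) \<Rightarrow> u \<theta> *\<^sub>R v \<phi>) \<partial>(lborel \<Otimes>\<^sub>M lborel))"
    by (simp add: F_sep lborel_prod)
  also have "\<dots> = (\<integral>\<theta>. (\<integral>\<phi>. u \<theta> *\<^sub>R v \<phi> \<partial>lborel) \<partial>lborel)"
    using lborel_pair.integral_fst'[OF int] by simp
  also have "\<dots> = (\<integral>\<theta>. u \<theta> \<partial>lborel) *\<^sub>R (\<integral>\<phi>. v \<phi> \<partial>lborel)"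
    by (simp add: scaleR_conv_of_real flip: integral_complex_of_real)
  finally have *: "L2_inner (sph_harm l m) (sph_harm l' m')
      = of_real ((\<integral>\<theta>. u \<theta> \<partial>lborel) * (if m = m' then 2 * pi else 0))"
    unfolding v_def integral_cis by (simp add: scaleR_conv_of_real)
  show ?thesis
  proof (cases "m = m'")
    case True
    define k where "k = nat \<bar>m\<bar>"
    define N where "N = (\<lambda>l. sqrt ((2 * real l + 1) / (4 * pi) * (fact (l - k) / fact (l + k))))"
    define p where "p = (- x2m1) ^ k * (pderiv ^^ k) (legendre_poly l) * (pderiv ^^ k) (legendre_poly l')"
    have "sph_amp l m \<mu> * sph_amp l' m' \<mu> = poly (smult (N l * N l') p) \<mu>"
      if "\<bar>\<mu>\<bar> \<le> 1" for \<mu>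
    proof -
      have "sqrt (1 - \<mu>\<^sup>2) ^ k * sqrt (1 - \<mu>\<^sup>2) ^ k = (1 - \<mu>\<^sup>2) ^ k"
        using that by (simp add: power_mult_distrib[symmetric] abs_square_le_1)
      also have "\<dots> = poly ((- x2m1) ^ k) \<mu>"
        by (simp add: power2_eq_square algebra_simps)
      finally have s: "sqrt (1 - \<mu>\<^sup>2) ^ k * sqrt (1 - \<mu>\<^sup>2) ^ k = poly ((- x2m1) ^ k) \<mu>" .
      have sgn: "(- 1 :: real) ^ j * (- 1) ^ j = 1" for j
        by (simp add: power_mult_distrib[symmetric])
      have arr: "e * (n * (e' * w * a)) * (e * (n' * (e' * w * b))) = n * n' * (w * w * a * b)"
        if "e * e = 1" "e' * e' = 1" for e e' n n' w a b :: real
      proof -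
        have "e * (n * (e' * w * a)) * (e * (n' * (e' * w * b)))
            = (e * e) * (e' * e') * (n * n' * (w * w * a * b))"
          by (simp only: mult_ac)
        then show ?thesis by (simp only: that mult_1)
      qed
      show ?thesis
        unfolding sph_amp_def True[symmetric] k_def[symmetric] assoc_legendre_def poly_smult p_def poly_mult
          s[symmetric] N_def
        by (rule arr) (auto simp: sgn)
    qed
    then have "(\<integral>\<theta>. u \<theta> \<partial>lborel) = poly_integral (smult (N l * N l') p)"
      unfolding u_def integral_sin_poly_cos[symmetric] by simp
    also have "\<dots> = N l * N l' * (if l = l' then 2 / (2 * real l + 1) * (fact (l + k) / fact (l - k)) else 0)"
      unfolding poly_integral_smult p_def using legendre_orthogonality[of k l l'] assms True
      by (simp add: k_def)
    also have "\<dots> = (if l = l' then 1 / (2 * pi) else 0)"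
    proof (cases "l = l'")
      case True
      have "N l * N l = (2 * real l + 1) / (4 * pi) * (fact (l - k) / fact (l + k))"
        unfolding N_def by simp
      note NN = this
      have cancel: "h / (4 * q) * (a / b) * (2 / h * (b / a)) = 1 / (2 * q)"
        if "h \<noteq> 0" "a \<noteq> 0" "b \<noteq> 0" "q \<noteq> 0" for a b h q :: real
        using that by simp
      have "N l * N l * (2 / (2 * real l + 1) * (fact (l + k) / fact (l - k))) = 1 / (2 * pi)"
        unfolding NN by (rule cancel) (simp_all add: add_nonneg_eq_0_iff)
      then show ?thesis unfolding True by (simp only: refl if_True)
    qed simp
    finally show ?thesis
      unfolding * using True by simp
  next
    case False
    then show ?thesis unfolding * by simp
  qed
qed

lemma L2_norm_sq: "(L2_norm f)\<^sup>2 = (\<integral>x. (cmod (f x))\<^sup>2 \<partial>sphere_measure)"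
  by (simp add: L2_norm_def)

lemma L2_norm_sq_sph_sum:
  assumes "finite S" "\<And>l m. (l, m) \<in> S \<Longrightarrow> nat \<bar>m\<bar> \<le> l"
  shows "(L2_norm (\<lambda>x. \<Sum>(l, m)\<in>S. c l m * sph_harm l m x))\<^sup>2 = (\<Sum>(l, m)\<in>S. (cmod (c l m))\<^sup>2)"
proof -
  let ?Y = "\<lambda>p. sph_harm (fst p) (snd p)" and ?c = "\<lambda>p. c (fst p) (snd p)"
  have int: "integrable sphere_measure (\<lambda>x. ?Y p x * cnj (?Y q x))" for p q
  proof -
    obtain K K' where K: "\<And>x. norm x = 1 \<Longrightarrow> cmod (?Y p x) \<le> K" "\<And>x. norm x = 1 \<Longrightarrow> cmod (?Y q x) \<le> K'"
      using sph_harm_bounded by metis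
    have "cmod (?Y p x * cnj (?Y q x)) \<le> K * K'" if "norm x = 1" for x
      unfolding norm_mult complex_mod_cnj using K[OF that]
      by (intro mult_mono) (auto intro: order_trans[OF norm_ge_zero])
    then show ?thesis
      by (intro integrable_sphere_bounded) measurable
  qed
  have "complex_of_real ((L2_norm (\<lambda>x. \<Sum>(l, m)\<in>S. c l m * sph_harm l m x))\<^sup>2)
      = (\<integral>x. (\<Sum>p\<in>S. \<Sum>q\<in>S. (?c p * cnj (?c q)) * (?Y p x * cnj (?Y q x))) \<partial>sphere_measure)"
    unfolding L2_norm_sq integral_complex_of_real[symmetric] complex_norm_square case_prod_beta
      cnj_sum sum_product complex_cnj_mult
    by (simp only: mult_ac)
  also have "\<dots> = (\<Sum>p\<in>S. \<Sum>q\<in>S. (?c p * cnj (?c q)) * L2_inner (?Y p) (?Y q))"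
    unfolding L2_inner_def
    by (simp add: Bochner_Integration.integral_sum integrable_sum int integrable_mult_right)
  also have "\<dots> = (\<Sum>p\<in>S. \<Sum>q\<in>S. if q = p then (?c p * cnj (?c p)) else 0)"
    using assms(2) by (intro sum.cong refl) (auto simp: L2_inner_sph_harm prod_eq_iff)
  also have "\<dots> = of_real (\<Sum>(l, m)\<in>S. (cmod (c l m))\<^sup>2)"
    using assms(1) by (simp add: sum.delta complex_norm_square case_prod_beta del: of_real_power)
  finally show ?thesis by (simp only: of_real_eq_iff)
qed


lemma cmod_diff_sq_le: "(cmod (a - b))\<^sup>2 \<le> 2 * (cmod a)\<^sup>2 + 2 * (cmod b)\<^sup>2"
proof -
  have "(cmod (a - b))\<^sup>2 \<le> (cmod a + cmod b)\<^sup>2"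
    by (intro power_mono norm_triangle_ineq4) simp
  also have "\<dots> \<le> 2 * (cmod a)\<^sup>2 + 2 * (cmod b)\<^sup>2"
    using sum_squares_bound[of "cmod a" "cmod b"] by (simp add: power2_sum)
  finally show ?thesis .
qed

lemma L2_sphere_diff:
  assumes "f \<in> L2_sphere" "g \<in> L2_sphere"
  shows "(\<lambda>x. f x - g x) \<in> L2_sphere"
proof -
  have [measurable]: "f \<in> borel_measurable sphere_measure" "g \<in> borel_measurable sphere_measure"
    using assms by (auto simp: L2_sphere_def)
  have "integrable sphere_measure (\<lambda>x. (cmod (f x - g x))\<^sup>2)"
  proof (rule Bochner_Integration.integrable_bound)
    show "integrable sphere_measure (\<lambda>x. 2 * (cmod (f x))\<^sup>2 + 2 * (cmod (g x))\<^sup>2)"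
      using assms by (simp add: L2_sphere_def)
  qed (auto intro: cmod_diff_sq_le)
  then show ?thesis by (simp add: L2_sphere_def)
qed

text \<open>
  A crude form of Minkowski's inequality; the factor \<open>2\<close> only affects the threshold.
\<close>

lemma L2_norm_sq_diff_le:
  assumes "f \<in> L2_sphere" "g \<in> L2_sphere"
  shows "(L2_norm (\<lambda>x. f x - g x))\<^sup>2 \<le> 2 * (L2_norm f)\<^sup>2 + 2 * (L2_norm g)\<^sup>2"
proof -
  have "(\<integral>x. (cmod (f x - g x))\<^sup>2 \<partial>sphere_measure)
      \<le> (\<integral>x. 2 * (cmod (f x))\<^sup>2 + 2 * (cmod (g x))\<^sup>2 \<partial>sphere_measure)"
    using L2_sphere_diff[OF assms] assms
    by (intro integral_mono cmod_diff_sq_le) (auto simp: L2_sphere_def)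
  then show ?thesis
    using assms by (simp add: L2_norm_sq L2_sphere_def)
qed

lemma sph_harm_L2_sphere: "sph_harm l m \<in> L2_sphere"
proof -
  obtain K where K: "\<And>x. norm x = 1 \<Longrightarrow> cmod (sph_harm l m x) \<le> K"
    using sph_harm_bounded by metis
  have "integrable sphere_measure (\<lambda>x. (cmod (sph_harm l m x))\<^sup>2)"
    using K
    by (intro finite_measure.integrable_const_bound[OF finite_measure_sphere, of _ "K\<^sup>2"] AE_I2
        borel_measurable_sphereI) (auto intro!: power_mono)
  then show ?thesis
    by (simp add: L2_sphere_def borel_measurable_sphereI)
qed

lemma L2_sphere_mult: "f \<in> L2_sphere \<Longrightarrow> (\<lambda>x. c * f x) \<in> L2_sphere"
  by (auto simp: L2_sphere_def norm_mult power_mult_distrib intro: borel_measurable_times)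

lemma L2_sphere_zero: "(\<lambda>x. 0) \<in> L2_sphere"
  by (simp add: L2_sphere_def)

lemma L2_sphere_sum:
  assumes "\<And>i. i \<in> I \<Longrightarrow> f i \<in> L2_sphere"
  shows "(\<lambda>x. \<Sum>i\<in>I. f i x) \<in> L2_sphere"
  using assms
proof (induction I rule: infinite_finite_induct)
  case (insert i I)
  have "(\<lambda>x. f i x - (-1) * (\<Sum>i\<in>I. f i x)) \<in> L2_sphere"
    using insert by (intro L2_sphere_diff L2_sphere_mult) auto
  then show ?case using insert by simp
qed (simp_all add: L2_sphere_zero)

lemma L2_norm_sph_harm: "nat \<bar>m\<bar> \<le> l \<Longrightarrow> (L2_norm (sph_harm l m))\<^sup>2 = 1"
  using L2_norm_sq_sph_sum[of "{(l, m)}" "\<lambda>l m. 1"] by simp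

text \<open>
  The inequality of arithmetic and geometric means under the integral.  Any bound that is uniform
  in \<open>l\<close> and \<open>m\<close> serves, because the coefficient will be multiplied by \<open>exp (- l (l + 1) t)\<close>.
\<close>

lemma L2_inner_sph_harm_le:
  assumes f: "f \<in> L2_sphere" and m: "nat \<bar>m\<bar> \<le> l"
  shows "cmod (L2_inner f (sph_harm l m)) \<le> ((L2_norm f)\<^sup>2 + 1) / 2"
proof -
  let ?Y = "sph_harm l m"
  have Y: "?Y \<in> L2_sphere" by (rule sph_harm_L2_sphere)
  have [measurable]: "f \<in> borel_measurable sphere_measure" "?Y \<in> borel_measurable sphere_measure"
    using f Y by (auto simp: L2_sphere_def)
  have int: "integrable sphere_measure (\<lambda>x. ((cmod (f x))\<^sup>2 + (cmod (?Y x))\<^sup>2) / 2)"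
    using f Y by (simp add: L2_sphere_def)
  have le: "cmod (f x * cnj (?Y x)) \<le> ((cmod (f x))\<^sup>2 + (cmod (?Y x))\<^sup>2) / 2" for x
    using sum_squares_bound[of "cmod (f x)" "cmod (?Y x)"] by (simp add: norm_mult)
  have "integrable sphere_measure (\<lambda>x. f x * cnj (?Y x))"
    by (rule Bochner_Integration.integrable_bound[OF int]) (use le in auto)
  then have "(\<integral>x. cmod (f x * cnj (?Y x)) \<partial>sphere_measure)
      \<le> (\<integral>x. ((cmod (f x))\<^sup>2 + (cmod (?Y x))\<^sup>2) / 2 \<partial>sphere_measure)"
    by (intro integral_mono int le integrable_norm)
  also have "\<dots> = ((L2_norm f)\<^sup>2 + 1) / 2"
    using f Y m by (simp add: L2_norm_sq[symmetric] L2_norm_sph_harm L2_sphere_def)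
  finally show ?thesis
    unfolding L2_inner_def by (rule order_trans[OF integral_norm_bound])
qed

section \<open>Integrals of step functions against Brownian motion\<close>

lemma (in prob_space) normal_even_moment:
  assumes X: "distributed M lborel X (normal_density 0 \<sigma>)" and \<sigma>: "0 < \<sigma>"
  shows "integrable M (\<lambda>\<omega>. X \<omega> ^ (2 * k))"
    and "(\<integral>\<omega>. X \<omega> ^ (2 * k) \<partial>M) = fact (2 * k) / (2 ^ k * fact k) * (\<sigma>\<^sup>2) ^ k"
proof -
  have hb: "has_bochner_integral lborel (\<lambda>x. normal_density 0 \<sigma> x * x ^ (2 * k))
      (fact (2 * k) / ((2 / \<sigma>\<^sup>2) ^ k * fact k))"
    using normal_moment_even[OF \<sigma>, of 0 k] by simp
  show "integrable M (\<lambda>\<omega>. X \<omega> ^ (2 * k))"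
    using distributed_integrable[OF X, of "\<lambda>x. x ^ (2 * k)"] integrable.intros[OF hb]
    by simp
  have "(\<integral>\<omega>. X \<omega> ^ (2 * k) \<partial>M) = fact (2 * k) / ((2 / \<sigma>\<^sup>2) ^ k * fact k)"
    using distributed_integral[OF X, of "\<lambda>x. x ^ (2 * k)"] has_bochner_integral_integral_eq[OF hb]
    by simp
  then show "(\<integral>\<omega>. X \<omega> ^ (2 * k) \<partial>M) = fact (2 * k) / (2 ^ k * fact k) * (\<sigma>\<^sup>2) ^ k"
    using \<sigma> by (simp add: power_divide)
qed

lemma time_partition_mono:
  assumes "time_partition \<tau> n a b" "i \<le> j" "j \<le> n"
  shows "\<tau> i \<le> \<tau> j"
  using assms(2,3)
proof (induction rule: dec_induct)
  case (step k)
  have "\<tau> k < \<tau> (Suc k)" using assms(1) step by (simp add: time_partition_def)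
  then show ?case using step by simp
qed simp

lemma time_partition_bounds:
  assumes "time_partition \<tau> n a b" "k \<le> n"
  shows "a \<le> \<tau> k" "\<tau> k \<le> b"
  using time_partition_mono[OF assms(1), of 0 k] time_partition_mono[OF assms(1), of k n] assms
  by (auto simp: time_partition_def)

lemma indicator_Ioc_integral:
  fixes s t :: real
  assumes "0 \<le> s" "0 \<le> t"
  shows "integrable lborel (\<lambda>x::real. indicator {0<..s} x * indicator {0<..t} x :: real)"
    and "(\<integral>x. indicator {0<..s} x * indicator {0<..t} x \<partial>lborel) = min s t"
proof -
  have "(\<lambda>x::real. indicator {0<..s} x * indicator {0<..t} x :: real) = indicator {0<..min s t}"
    by (auto simp: indicator_def)
  then show "integrable lborel (\<lambda>x::real. indicator {0<..s} x * indicator {0<..t} x :: real)"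
    "(\<integral>x. indicator {0<..s} x * indicator {0<..t} x \<partial>lborel) = min s t"
    using assms by (simp_all add: min_def)
qed

text \<open>
  A function with a finite integral is finite almost everywhere; apply this to the pointwise sum.
\<close>

lemma AE_summable_of_nn_integral:
  fixes g :: "nat \<Rightarrow> 'a \<Rightarrow> real"
  assumes meas: "\<And>j. g j \<in> borel_measurable M" and nonneg: "\<And>j x. 0 \<le> g j x"
    and fin: "(\<Sum>j. \<integral>\<^sup>+x. ennreal (g j x) \<partial>M) < \<infinity>"
  shows "AE x in M. summable (\<lambda>j. g j x)"
proof -
  note meas [measurable]
  have "(\<integral>\<^sup>+x. (\<Sum>j. ennreal (g j x)) \<partial>M) \<noteq> \<infinity>"
    using fin by (subst nn_integral_suminf) auto
  then have "AE x in M. (\<Sum>j. ennreal (g j x)) \<noteq> \<infinity>"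
    by (intro nn_integral_PInf_AE) auto
  then show ?thesis
    by eventually_elim (use nonneg in \<open>auto intro: summable_suminf_not_top\<close>)
qed

text \<open>
  Along a subsequence the integrals are at most \<open>2\<^sup>-\<^sup>k\<close>, hence summable.
\<close>

lemma AE_tendsto_0_subseq:
  fixes g :: "nat \<Rightarrow> 'a \<Rightarrow> real"
  assumes meas: "\<And>j. g j \<in> borel_measurable M" and nonneg: "\<And>j x. 0 \<le> g j x"
    and lim: "(\<lambda>j. \<integral>\<^sup>+x. ennreal (g j x) \<partial>M) \<longlonglongrightarrow> 0"
  shows "\<exists>r :: nat \<Rightarrow> nat. strict_mono r \<and> (AE x in M. (\<lambda>j. g (r j) x) \<longlonglongrightarrow> 0)"
proof -
  let ?u = "\<lambda>j. \<integral>\<^sup>+x. ennreal (g j x) \<partial>M"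
  have ev: "\<exists>i>m. ?u i \<le> ennreal ((1/2) ^ k)" for k m
  proof -
    have "eventually (\<lambda>j. ?u j < ennreal ((1/2) ^ k)) sequentially"
      using order_tendstoD(2)[OF lim] by simp
    then obtain N where "\<And>j. N \<le> j \<Longrightarrow> ?u j < ennreal ((1/2) ^ k)"
      by (auto simp: eventually_sequentially)
    then show ?thesis
      by (intro exI[of _ "max N (Suc m)"]) (auto intro: less_imp_le)
  qed
  obtain r where r: "\<And>k. ?u (r k) \<le> ennreal ((1/2) ^ k)" "\<And>k. r k < r (Suc k)"
    using dependent_nat_choice[of "\<lambda>k i. ?u i \<le> ennreal ((1/2) ^ k)" "\<lambda>k i j. i < j"] ev by blast
  have "(\<Sum>k. ?u (r k)) \<le> (\<Sum>k. ennreal ((1/2) ^ k))"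
    by (intro suminf_le r) auto
  also have "\<dots> = ennreal (\<Sum>k. (1/2) ^ k)"
    by (rule suminf_ennreal2) (auto intro: summable_geometric)
  finally have fin: "(\<Sum>k. ?u (r k)) < \<infinity>"
    by (simp add: less_top[symmetric] top_unique) (metis ennreal_neq_top neq_top_trans)
  have "AE x in M. summable (\<lambda>k. g (r k) x)"
    by (rule AE_summable_of_nn_integral) (use meas nonneg fin in auto)
  then have "AE x in M. (\<lambda>j. g (r j) x) \<longlonglongrightarrow> 0"
    by eventually_elim (rule summable_LIMSEQ_zero)
  moreover have "strict_mono r" using r(2) by (simp add: strict_mono_Suc_iff)
  ultimately show ?thesis by blast
qed

lemma nn_integral_Fatou:
  fixes u :: "nat \<Rightarrow> 'a \<Rightarrow> real"
  assumes [measurable]: "\<And>k. u k \<in> borel_measurable M"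
    and lim: "AE x in M. (\<lambda>k. u k x) \<longlonglongrightarrow> v x"
    and bound: "eventually (\<lambda>k. (\<integral>\<^sup>+x. ennreal (u k x) \<partial>M) \<le> C) sequentially"
  shows "(\<integral>\<^sup>+x. ennreal (v x) \<partial>M) \<le> C"
proof -
  have "(\<integral>\<^sup>+x. ennreal (v x) \<partial>M) = (\<integral>\<^sup>+x. liminf (\<lambda>k. ennreal (u k x)) \<partial>M)"
    using lim
    by (intro nn_integral_cong_AE, eventually_elim)
       (rule lim_imp_Liminf[symmetric], simp_all add: tendsto_ennrealI)
  also have "\<dots> \<le> liminf (\<lambda>k. \<integral>\<^sup>+x. ennreal (u k x) \<partial>M)"
    by (rule nn_integral_liminf) simp
  also have "\<dots> \<le> liminf (\<lambda>k. C)"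
    using bound by (intro Liminf_mono)
  finally show ?thesis by (simp add: Liminf_const)
qed

locale brownian = prob_space M for M :: "'w measure" +
  fixes T :: real and B :: "real \<Rightarrow> 'w \<Rightarrow> real"
  assumes brownian: "brownian_motion_on M T B"
begin

lemma measurable_B: "0 \<le> t \<Longrightarrow> t \<le> T \<Longrightarrow> B t \<in> borel_measurable M"
  using brownian by (auto simp: brownian_motion_on_def)

lemma increment_normal:
  "0 \<le> s \<Longrightarrow> s < t \<Longrightarrow> t \<le> T \<Longrightarrow>
    distributed M lborel (\<lambda>\<omega>. B t \<omega> - B s \<omega>) (normal_density 0 (sqrt (t - s)))"
  using brownian by (auto simp: brownian_motion_on_def)

lemma increment_sq:
  assumes "0 \<le> s" "s \<le> t" "t \<le> T"
  shows "integrable M (\<lambda>\<omega>. (B t \<omega> - B s \<omega>)\<^sup>2)" "(\<integral>\<omega>. (B t \<omega> - B s \<omega>)\<^sup>2 \<partial>M) = t - s"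
proof -
  have "integrable M (\<lambda>\<omega>. (B t \<omega> - B s \<omega>)\<^sup>2) \<and> (\<integral>\<omega>. (B t \<omega> - B s \<omega>)\<^sup>2 \<partial>M) = t - s"
  proof (cases "s = t")
    case False
    then have "s < t" using assms by simp
    then show ?thesis
      using normal_even_moment[OF increment_normal, of s t 1] assms by simp
  qed simp
  then show "integrable M (\<lambda>\<omega>. (B t \<omega> - B s \<omega>)\<^sup>2)" "(\<integral>\<omega>. (B t \<omega> - B s \<omega>)\<^sup>2 \<partial>M) = t - s"
    by auto
qed

text \<open>
  By polarisation the covariance is a combination of variances of increments.
\<close>

lemma covariance:
  assumes "0 \<le> s" "s \<le> T" "0 \<le> t" "t \<le> T"
  shows "integrable M (\<lambda>\<omega>. (B s \<omega> - B 0 \<omega>) * (B t \<omega> - B 0 \<omega>))"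
    and "(\<integral>\<omega>. (B s \<omega> - B 0 \<omega>) * (B t \<omega> - B 0 \<omega>) \<partial>M) = min s t"
proof -
  have *: "integrable M (\<lambda>\<omega>. (B s \<omega> - B 0 \<omega>) * (B t \<omega> - B 0 \<omega>)) \<and>
      (\<integral>\<omega>. (B s \<omega> - B 0 \<omega>) * (B t \<omega> - B 0 \<omega>) \<partial>M) = s"
    if "0 \<le> s" "s \<le> t" "t \<le> T" for s t
  proof -
    have polar: "(B s \<omega> - B 0 \<omega>) * (B t \<omega> - B 0 \<omega>)
        = ((B s \<omega> - B 0 \<omega>)\<^sup>2 + (B t \<omega> - B 0 \<omega>)\<^sup>2 - (B t \<omega> - B s \<omega>)\<^sup>2) / 2" for \<omega>
      by (simp add: power2_eq_square algebra_simps)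
    show ?thesis
      unfolding polar
      using increment_sq[of 0 s] increment_sq[of 0 t] increment_sq[of s t] that by simp
  qed
  show "integrable M (\<lambda>\<omega>. (B s \<omega> - B 0 \<omega>) * (B t \<omega> - B 0 \<omega>))"
    using *[of s t] *[of t s] assms by (cases "s \<le> t") (auto simp: mult.commute)
  show "(\<integral>\<omega>. (B s \<omega> - B 0 \<omega>) * (B t \<omega> - B 0 \<omega>) \<partial>M) = min s t"
    using *[of s t] *[of t s] assms by (cases "s \<le> t") (auto simp: mult.commute min_def)
qed

text \<open>
  The pairs of a step function and its integral, closed under linear combinations.  Differences
  of step functions on different partitions are thus covered without a common refinement.
\<close>

inductive simple_integral :: "('w \<Rightarrow> real) \<Rightarrow> (real \<Rightarrow> real) \<Rightarrow> bool" where
  point: "0 \<le> t \<Longrightarrow> t \<le> T \<Longrightarrow> simple_integral (\<lambda>\<omega>. B t \<omega> - B 0 \<omega>) (\<lambda>x. indicator {0<..t} x)"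
| add: "simple_integral S \<phi> \<Longrightarrow> simple_integral S' \<phi>' \<Longrightarrow>
    simple_integral (\<lambda>\<omega>. S \<omega> + S' \<omega>) (\<lambda>x. \<phi> x + \<phi>' x)"
| scale: "simple_integral S \<phi> \<Longrightarrow> simple_integral (\<lambda>\<omega>. r * S \<omega>) (\<lambda>x. r * \<phi> x)"

lemma simple_integral_measurable:
  assumes "simple_integral S \<phi>" "0 \<le> T"
  shows "S \<in> borel_measurable M" "\<phi> \<in> borel_measurable borel"
  using assms by (induction) (auto intro!: borel_measurable_diff measurable_B)

text \<open>
  The isometry in polarised form is linear in each argument, which makes it accessible to
  induction over both.
\<close>

definition isometric where
  "isometric S \<phi> S' \<phi>' \<longleftrightarrow> integrable M (\<lambda>\<omega>. S \<omega> * S' \<omega>) \<and> integrable lborel (\<lambda>x. \<phi> x * \<phi>' x) \<and>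
     (\<integral>\<omega>. S \<omega> * S' \<omega> \<partial>M) = (\<integral>x. \<phi> x * \<phi>' x \<partial>lborel)"

lemma isometric_point:
  assumes "simple_integral S \<phi>" "0 \<le> t" "t \<le> T"
  shows "isometric S \<phi> (\<lambda>\<omega>. B t \<omega> - B 0 \<omega>) (\<lambda>x. indicator {0<..t} x)"
  using assms
proof induction
  case (point s)
  then show ?case
    unfolding isometric_def using covariance[of s t] indicator_Ioc_integral[of s t] by simp
qed (simp_all add: isometric_def distrib_right mult.assoc)

lemma isometric_simple_integral:
  assumes "simple_integral S \<phi>" "simple_integral S' \<phi>'"
  shows "isometric S \<phi> S' \<phi>'"
  using assms(2,1)
proof induction
  case (point t)
  then show ?case by (intro isometric_point)
qed (simp_all add: isometric_def distrib_left mult.left_commute)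

lemma nn_isometry:
  assumes "simple_integral S \<phi>"
  shows "(\<integral>\<^sup>+\<omega>. ennreal ((S \<omega>)\<^sup>2) \<partial>M) = (\<integral>\<^sup>+x. ennreal ((\<phi> x)\<^sup>2) \<partial>lborel)"
  using isometric_simple_integral[OF assms assms]
  by (simp add: isometric_def power2_eq_square nn_integral_eq_integral)

lemma simple_integral_diff:
  assumes "simple_integral S \<phi>" "simple_integral S' \<phi>'"
  shows "simple_integral (\<lambda>\<omega>. S \<omega> - S' \<omega>) (\<lambda>x. \<phi> x - \<phi>' x)"
  using add[OF assms(1) scale[OF assms(2), of "-1"]] by simp

lemma simple_integral_increment:
  assumes "0 \<le> s" "s \<le> t" "t \<le> T"
  shows "simple_integral (\<lambda>\<omega>. B t \<omega> - B s \<omega>) (\<lambda>x. indicator {s<..t} x)"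
proof -
  have "simple_integral (\<lambda>\<omega>. (B t \<omega> - B 0 \<omega>) - (B s \<omega> - B 0 \<omega>))
      (\<lambda>x. indicator {0<..t} x - indicator {0<..s} x)"
    using assms by (intro simple_integral_diff point) auto
  moreover have "(\<lambda>x. indicator {0<..t} x - indicator {0<..s} x :: real) = (\<lambda>x. indicator {s<..t} x)"
    using assms by (intro ext) (auto simp: indicator_def)
  ultimately show ?thesis by simp
qed

lemma simple_integral_zero: "0 \<le> T \<Longrightarrow> simple_integral (\<lambda>\<omega>. 0) (\<lambda>x. 0)"
  using scale[OF point[of 0], of 0] by simp

lemma simple_integral_step:
  assumes "time_partition \<tau> n a b" "0 \<le> a" "a \<le> b" "b \<le> T"
  shows "simple_integral (step_integral B \<tau> n c) (step_fun \<tau> n c)"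
proof -
  have "simple_integral (\<lambda>\<omega>. \<Sum>k<m. c k * (B (\<tau> (Suc k)) \<omega> - B (\<tau> k) \<omega>))
      (\<lambda>x. \<Sum>k<m. c k * indicator {\<tau> k<..\<tau> (Suc k)} x)" if "m \<le> n" for m
    using that
  proof (induction m)
    case 0
    then show ?case using simple_integral_zero assms by simp
  next
    case (Suc m)
    have "0 \<le> \<tau> m" "\<tau> m \<le> \<tau> (Suc m)" "\<tau> (Suc m) \<le> T"
      using time_partition_bounds[OF assms(1), of m] time_partition_bounds[OF assms(1), of "Suc m"]
        time_partition_mono[OF assms(1), of m "Suc m"] Suc assms by auto
    then show ?case
      using Suc by (simp add: add scale simple_integral_increment)
  qed
  from this[of n] show ?thesis by (simp add: step_integral_def[abs_def] step_fun_def[abs_def])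
qed

lemma step_fun_outside:
  assumes "time_partition \<tau> n a b" "x \<notin> {a<..b}"
  shows "step_fun \<tau> n c x = 0"
  unfolding step_fun_def
proof (intro sum.neutral ballI)
  fix k assume "k \<in> {..<n}"
  then have "a \<le> \<tau> k" "\<tau> (Suc k) \<le> b"
    using time_partition_bounds[OF assms(1)] by auto
  then show "c k * indicator {\<tau> k<..\<tau> (Suc k)} x = 0"
    using assms(2) by auto
qed

end

section \<open>Moments of Wiener integrals\<close>

definition gaussian_moment :: "nat \<Rightarrow> real" where
  "gaussian_moment k = fact (2 * k) / (2 ^ k * fact k)"

lemma gaussian_moment_pos: "0 < gaussian_moment k"
  by (simp add: gaussian_moment_def)

lemma sq_diff_le: "((a::real) - b)\<^sup>2 \<le> 2 * a\<^sup>2 + 2 * b\<^sup>2"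
proof -
  have "2 * a\<^sup>2 + 2 * b\<^sup>2 - (a - b)\<^sup>2 = (a + b)\<^sup>2" by (simp add: power2_eq_square algebra_simps)
  then show ?thesis using zero_le_power2[of "a + b"] by linarith
qed

context brownian
begin

text \<open>
  The summands with coefficient \<open>0\<close> have to be left out, as they have no density.
\<close>

lemma step_integral_normal:
  assumes \<tau>: "time_partition \<tau> n 0 b" and b: "b \<le> T" and c: "\<exists>k<n. c k \<noteq> 0"
  obtains \<sigma> where "0 < \<sigma>" "distributed M lborel (step_integral B \<tau> n c) (normal_density 0 \<sigma>)"
proof -
  define K where "K = {k. k < n \<and> c k \<noteq> 0}"
  define \<sigma> where "\<sigma> = (\<lambda>k. \<bar>c k\<bar> * sqrt (\<tau> (Suc k) - \<tau> k))"
  let ?X = "\<lambda>k \<omega>. c k * (B (\<tau> (Suc k)) \<omega> - B (\<tau> k) \<omega>)"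
  have K: "finite K" "K \<noteq> {}" using c by (auto simp: K_def)
  have \<sigma>_pos: "0 < \<sigma> k" if "k \<in> K" for k
    using that \<tau> by (auto simp: K_def \<sigma>_def time_partition_def)
  have "indep_vars (\<lambda>_. borel) (\<lambda>k \<omega>. B (\<tau> (Suc k)) \<omega> - B (\<tau> k) \<omega>) {..<n}"
    using brownian \<tau> b unfolding brownian_motion_on_def by blast
  then have "indep_vars (\<lambda>_. borel) (\<lambda>k \<omega>. B (\<tau> (Suc k)) \<omega> - B (\<tau> k) \<omega>) K"
    by (rule indep_vars_subset) (auto simp: K_def)
  then have indep: "indep_vars (\<lambda>_. borel) ?X K"
    by (rule indep_vars_compose2[where Y="\<lambda>k x. c k * x"]) simp
  have normal: "distributed M lborel (?X k) (normal_density 0 (\<sigma> k))" if "k \<in> K" for k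
  proof -
    have k: "k < n" "c k \<noteq> 0" using that by (auto simp: K_def)
    then have le: "0 \<le> \<tau> k" "\<tau> k < \<tau> (Suc k)" "\<tau> (Suc k) \<le> T"
      using time_partition_bounds[OF \<tau>, of k] time_partition_bounds[OF \<tau>, of "Suc k"] \<tau> b
      by (auto simp: time_partition_def)
    show ?thesis
      using normal_density_affine[OF increment_normal[OF le], of "c k" 0] le k by (simp add: \<sigma>_def)
  qed
  have "distributed M lborel (\<lambda>\<omega>. \<Sum>k\<in>K. ?X k \<omega>) (normal_density (\<Sum>k\<in>K. 0) (sqrt (\<Sum>k\<in>K. (\<sigma> k)\<^sup>2)))"
    by (rule sum_indep_normal[OF K indep \<sigma>_pos normal])
  moreover have eq: "(\<lambda>\<omega>. \<Sum>k\<in>K. ?X k \<omega>) = step_integral B \<tau> n c"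
    unfolding step_integral_def by (intro ext sum.mono_neutral_left) (auto simp: K_def)
  moreover have "0 < sqrt (\<Sum>k\<in>K. (\<sigma> k)\<^sup>2)"
    using K \<sigma>_pos by (auto intro!: sum_pos simp: zero_less_power2 less_imp_neq[THEN not_sym])
  ultimately show thesis
    by (intro that[of "sqrt (\<Sum>k\<in>K. (\<sigma> k)\<^sup>2)"]) (simp_all only: sum.neutral_const)
qed

lemma step_integral_moments_from_0:
  assumes \<tau>: "time_partition \<tau> n 0 b" and b: "0 \<le> b" "b \<le> T"
  shows "\<exists>v\<ge>0. \<forall>k. (\<integral>\<^sup>+\<omega>. ennreal (step_integral B \<tau> n c \<omega> ^ (2 * k)) \<partial>M) = ennreal (gaussian_moment k * v ^ k)"
proof (cases "\<exists>k<n. c k \<noteq> 0")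
  case True
  then obtain \<sigma> where \<sigma>: "0 < \<sigma>" and d: "distributed M lborel (step_integral B \<tau> n c) (normal_density 0 \<sigma>)"
    using step_integral_normal[OF \<tau> b(2)] by blast
  have "(\<integral>\<^sup>+\<omega>. ennreal (step_integral B \<tau> n c \<omega> ^ (2 * k)) \<partial>M) = ennreal (gaussian_moment k * (\<sigma>\<^sup>2) ^ k)" for k
    using normal_even_moment[OF d \<sigma>, of k]
    by (subst nn_integral_eq_integral) (auto simp: gaussian_moment_def)
  then show ?thesis by (intro exI[of _ "\<sigma>\<^sup>2"]) simp
next
  case False
  then have "step_integral B \<tau> n c = (\<lambda>\<omega>. 0)"
    by (auto simp: step_integral_def)
  then have "(\<integral>\<^sup>+\<omega>. ennreal (step_integral B \<tau> n c \<omega> ^ (2 * k)) \<partial>M) = ennreal (gaussian_moment k * 0 ^ k)" for k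
    by (cases k) (simp_all add: gaussian_moment_def emeasure_space_1)
  then show ?thesis by blast
qed

text \<open>
  The independence of increments is given for partitions that start at \<open>0\<close>.  One more interval
  \<open>{0..a}\<close> with coefficient \<open>0\<close> makes the given partition one of these.
\<close>

lemma step_integral_moments:
  assumes \<tau>: "time_partition \<tau> n a b" and ab: "0 \<le> a" "a \<le> b" "b \<le> T"
  shows "\<exists>v\<ge>0. (\<forall>k. (\<integral>\<^sup>+\<omega>. ennreal (step_integral B \<tau> n c \<omega> ^ (2 * k)) \<partial>M) = ennreal (gaussian_moment k * v ^ k))
    \<and> (\<integral>\<^sup>+x. ennreal ((step_fun \<tau> n c x)\<^sup>2) \<partial>lborel) = ennreal v"
proof -
  have "\<exists>\<tau>' n' c'. time_partition \<tau>' n' 0 b \<and> step_integral B \<tau>' n' c' = step_integral B \<tau> n c"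
  proof (cases "a = 0")
    case False
    define \<tau>' where "\<tau>' = case_nat 0 \<tau>"
    have "time_partition \<tau>' (Suc n) 0 b"
      using \<tau> False ab by (auto simp: time_partition_def \<tau>'_def split: nat.split)
    moreover have "step_integral B \<tau>' (Suc n) (case_nat 0 c) = step_integral B \<tau> n c"
      unfolding step_integral_def sum.lessThan_Suc_shift by (simp add: \<tau>'_def)
    ultimately show ?thesis by blast
  qed (use \<tau> in blast)
  then obtain \<tau>' n' c' where \<tau>': "time_partition \<tau>' n' 0 b"
    and eq: "step_integral B \<tau>' n' c' = step_integral B \<tau> n c" by blast
  have "0 \<le> b" using ab by simp
  from step_integral_moments_from_0[OF \<tau>' this ab(3), of c']
  obtain v where v: "0 \<le> v"
    "\<And>k. (\<integral>\<^sup>+\<omega>. ennreal (step_integral B \<tau> n c \<omega> ^ (2 * k)) \<partial>M) = ennreal (gaussian_moment k * v ^ k)"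
    unfolding eq by blast
  have "(\<integral>\<^sup>+x. ennreal ((step_fun \<tau> n c x)\<^sup>2) \<partial>lborel) = ennreal v"
    using nn_isometry[OF simple_integral_step[OF \<tau> ab], of c] v(2)[of 1]
    by (simp add: gaussian_moment_def)
  then show ?thesis using v by blast
qed

text \<open>
  The integral is the almost sure limit of a subsequence of Gaussian variables, so Fatou's lemma
  carries their moments over.  Since \<open>v > 0\<close>, the squared distances of the approximations from \<open>f\<close> are
  eventually below \<open>v\<close>, and then their squared norms are at most \<open>4 v\<close>.
\<close>

lemma wiener_integral_moment:
  assumes I: "has_wiener_integral M B a b f I" and ab: "0 \<le> a" "a \<le> b" "b \<le> T"
    and f [measurable]: "f \<in> borel_measurable borel"
    and v: "0 < v" "(\<integral>\<^sup>+s\<in>{a..b}. ennreal ((f s)\<^sup>2) \<partial>lborel) \<le> ennreal v"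
  shows "(\<integral>\<^sup>+\<omega>. ennreal (I \<omega> ^ (2 * k)) \<partial>M) \<le> ennreal (gaussian_moment k * (4 * v) ^ k)"
proof -
  obtain \<tau> n c where \<tau>: "\<And>j. time_partition (\<tau> j) (n j) a b"
    and f_lim: "(\<lambda>j. \<integral>\<^sup>+s\<in>{a..b}. ennreal ((f s - step_fun (\<tau> j) (n j) (c j) s)\<^sup>2) \<partial>lborel) \<longlonglongrightarrow> 0"
    and I_lim: "(\<lambda>j. \<integral>\<^sup>+\<omega>. ennreal ((I \<omega> - step_integral B (\<tau> j) (n j) (c j) \<omega>)\<^sup>2) \<partial>M) \<longlonglongrightarrow> 0"
    and I_meas [measurable]: "I \<in> borel_measurable M"
    using I unfolding has_wiener_integral_def by blast
  define S where "S = (\<lambda>j. step_integral B (\<tau> j) (n j) (c j))"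
  define \<phi> where "\<phi> = (\<lambda>j. step_fun (\<tau> j) (n j) (c j))"
  have "0 \<le> T" using ab by simp
  have S_simple: "simple_integral (S j) (\<phi> j)" for j
    unfolding S_def \<phi>_def by (rule simple_integral_step[OF \<tau> ab])
  have [measurable]: "S j \<in> borel_measurable M" "\<phi> j \<in> borel_measurable borel" for j
    using simple_integral_measurable[OF S_simple \<open>0 \<le> T\<close>] by auto
  obtain r where r: "strict_mono r" "AE \<omega> in M. (\<lambda>j. (I \<omega> - S (r j) \<omega>)\<^sup>2) \<longlonglongrightarrow> 0"
  proof -
    have "(\<lambda>j. \<integral>\<^sup>+\<omega>. ennreal ((I \<omega> - S j \<omega>)\<^sup>2) \<partial>M) \<longlonglongrightarrow> 0"
      using I_lim by (simp only: S_def)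
    then have "\<exists>r. strict_mono r \<and> (AE \<omega> in M. (\<lambda>j. (I \<omega> - S (r j) \<omega>)\<^sup>2) \<longlonglongrightarrow> 0)"
      by (rule AE_tendsto_0_subseq[rotated -1]) auto
    then show thesis using that by blast
  qed
  from r(2) have S_lim: "AE \<omega> in M. (\<lambda>j. S (r j) \<omega> ^ (2 * k)) \<longlonglongrightarrow> I \<omega> ^ (2 * k)"
  proof eventually_elim
    case (elim \<omega>)
    then have "(\<lambda>j. sqrt ((I \<omega> - S (r j) \<omega>)\<^sup>2)) \<longlonglongrightarrow> sqrt 0" by (intro tendsto_real_sqrt)
    then have "(\<lambda>j. I \<omega> - S (r j) \<omega>) \<longlonglongrightarrow> 0" by (simp add: tendsto_rabs_zero_iff)
    then have "(\<lambda>j. I \<omega> - (I \<omega> - S (r j) \<omega>)) \<longlonglongrightarrow> I \<omega> - 0" by (intro tendsto_intros)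
    then show ?case by (intro tendsto_power) simp
  qed
  have "eventually (\<lambda>j. (\<integral>\<^sup>+s\<in>{a..b}. ennreal ((f s - \<phi> j s)\<^sup>2) \<partial>lborel) < ennreal v) sequentially"
    using order_tendstoD(2)[OF f_lim, of "ennreal v"] v(1) unfolding \<phi>_def by simp
  then have ev: "eventually (\<lambda>j. (\<integral>\<^sup>+s\<in>{a..b}. ennreal ((f s - \<phi> (r j) s)\<^sup>2) \<partial>lborel) < ennreal v) sequentially"
    by (rule eventually_subseq[OF r(1)])
  show ?thesis
  proof (rule nn_integral_Fatou[OF _ S_lim])
    show "eventually (\<lambda>j. (\<integral>\<^sup>+\<omega>. ennreal (S (r j) \<omega> ^ (2 * k)) \<partial>M)
        \<le> ennreal (gaussian_moment k * (4 * v) ^ k)) sequentially"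
      using ev
    proof eventually_elim
      case (elim j)
      obtain w where w: "0 \<le> w"
        "\<And>k. (\<integral>\<^sup>+\<omega>. ennreal (S (r j) \<omega> ^ (2 * k)) \<partial>M) = ennreal (gaussian_moment k * w ^ k)"
        "(\<integral>\<^sup>+x. ennreal ((\<phi> (r j) x)\<^sup>2) \<partial>lborel) = ennreal w"
        using step_integral_moments[OF \<tau> ab] unfolding S_def \<phi>_def by blast
      have "ennreal w \<le> (\<integral>\<^sup>+x. (2 * (ennreal ((f x)\<^sup>2) * indicator {a..b} x)
          + 2 * (ennreal ((f x - \<phi> (r j) x)\<^sup>2) * indicator {a..b} x)) \<partial>lborel)"
        unfolding w(3)[symmetric]
      proof (rule nn_integral_mono)
        fix x
        have "ennreal ((\<phi> (r j) x)\<^sup>2) \<le> ennreal (2 * (f x)\<^sup>2 + 2 * (f x - \<phi> (r j) x)\<^sup>2)"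
          using sq_diff_le[of "f x" "f x - \<phi> (r j) x"] by (intro ennreal_leI) simp
        also have "\<dots> = 2 * ennreal ((f x)\<^sup>2) + 2 * ennreal ((f x - \<phi> (r j) x)\<^sup>2)"
          by (simp add: ennreal_mult)
        finally show "ennreal ((\<phi> (r j) x)\<^sup>2) \<le> 2 * (ennreal ((f x)\<^sup>2) * indicator {a..b} x)
          + 2 * (ennreal ((f x - \<phi> (r j) x)\<^sup>2) * indicator {a..b} x)"
          using step_fun_outside[OF \<tau>, of x "r j" "c (r j)"]
          by (cases "x \<in> {a..b}") (auto simp: \<phi>_def)
      qed
      also have "\<dots> = 2 * (\<integral>\<^sup>+s\<in>{a..b}. ennreal ((f s)\<^sup>2) \<partial>lborel)
          + 2 * (\<integral>\<^sup>+s\<in>{a..b}. ennreal ((f s - \<phi> (r j) s)\<^sup>2) \<partial>lborel)"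
        by (simp add: nn_integral_add nn_integral_cmult)
      also have "\<dots> \<le> 2 * ennreal v + 2 * ennreal v"
        using v(2) elim by (intro add_mono mult_left_mono) (auto intro: less_imp_le)
      also have "\<dots> = ennreal (4 * v)"
        using v(1) by (simp add: ennreal_mult flip: distrib_right)
      finally have "w \<le> 4 * v" using v(1) by simp
      then show ?case
        unfolding w(2) using w(1) gaussian_moment_pos[of k]
        by (intro ennreal_leI mult_left_mono power_mono) auto
    qed
  qed measurable
qed

end

section \<open>Existence of Wiener integrals\<close>

context brownian
begin

text \<open>
  On dyadic partitions a Lipschitz function is approximated up to \<open>O(2\<^sup>-\<^sup>j)\<close>.  The isometry makes
  the integrals \<open>S j\<close> a Cauchy sequence in \<open>L\<^sup>2\<close> with squared distances \<open>O(4\<^sup>-\<^sup>j)\<close>, small enough for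
  almost sure convergence; by Fatou's lemma the pointwise limit is also the limit in \<open>L\<^sup>2\<close>.
\<close>

lemma wiener_integral_exists:
  assumes ab: "0 \<le> a" "a \<le> b" "b \<le> T"
    and f [measurable]: "f \<in> borel_measurable borel"
    and lip: "\<And>s t. a \<le> s \<Longrightarrow> s \<le> t \<Longrightarrow> t \<le> b \<Longrightarrow> \<bar>f t - f s\<bar> \<le> L * (t - s)"
  shows "\<exists>I. has_wiener_integral M B a b f I"
proof (cases "a = b")
  case True
  have "time_partition (\<lambda>_. a) 0 a b" using True by (simp add: time_partition_def)
  moreover have "(\<integral>\<^sup>+s\<in>{a..b}. ennreal ((f s - step_fun (\<lambda>_. a) 0 (\<lambda>_. 0) s)\<^sup>2) \<partial>lborel) = 0"
    unfolding True
    by (subst nn_integral_0_iff_AE) (auto simp: step_fun_def intro: AE_mp[OF AE_lborel_singleton[of b]])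
  ultimately have "has_wiener_integral M B a b f (\<lambda>_. 0)"
    unfolding has_wiener_integral_def
    by (intro conjI exI[of _ "\<lambda>_ _. a"] exI[of _ "\<lambda>_. 0"] exI[of _ "\<lambda>_ _. 0"])
       (simp_all add: step_integral_def)
  then show ?thesis by blast
next
  case False
  then have "a < b" using ab by simp
  have "0 \<le> T" using ab by simp
  have "0 \<le> L"
    using lip[of a b] \<open>a < b\<close> by (smt (verit) mult_neg_pos)
  define h where "h = (\<lambda>j::nat. (b - a) / 2 ^ j)"
  define \<tau> where "\<tau> = (\<lambda>j k. a + real k * h j)"
  define S where "S = (\<lambda>j. step_integral B (\<tau> j) (2 ^ j) (\<lambda>k. f (\<tau> j k)))"
  define \<phi> where "\<phi> = (\<lambda>j. step_fun (\<tau> j) (2 ^ j) (\<lambda>k. f (\<tau> j k)))"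
  have h_pos: "0 < h j" for j using \<open>a < b\<close> by (simp add: h_def)
  have \<tau>: "time_partition (\<tau> j) (2 ^ j) a b" for j
    using h_pos[of j] by (simp add: time_partition_def \<tau>_def h_def field_simps)
  have S_simple: "simple_integral (S j) (\<phi> j)" for j
    unfolding S_def \<phi>_def by (rule simple_integral_step[OF \<tau> ab])
  have [measurable]: "S j \<in> borel_measurable M" "\<phi> j \<in> borel_measurable borel" for j
    using simple_integral_measurable[OF S_simple \<open>0 \<le> T\<close>] by auto
  have approx: "\<bar>f s - \<phi> j s\<bar> \<le> L * h j" if s: "a < s" "s \<le> b" for s j
  proof -
    define x where "x = (s - a) / h j"
    \<comment> \<open>The cells of the partition are open on the left, so \<open>k\<close> is not the floor of \<open>x\<close>.\<close>
    define k where "k = nat (\<lceil>x\<rceil> - 1)"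
    have x: "0 < x" "x \<le> 2 ^ j"
      using s h_pos[of j] by (auto simp: x_def h_def field_simps)
    then have k: "real k < x" "x \<le> real k + 1"
      unfolding k_def by linarith+
    then have "real k < 2 ^ j" using x by linarith
    then have k_lt: "k < 2 ^ j" by simp
    have s_eq: "s = a + x * h j" using h_pos[of j] by (simp add: x_def)
    have in_iff: "s \<in> {\<tau> j i<..\<tau> j (Suc i)} \<longleftrightarrow> i = k" for i
    proof -
      have "s \<in> {\<tau> j i<..\<tau> j (Suc i)} \<longleftrightarrow> real i * h j < x * h j \<and> x * h j \<le> (real i + 1) * h j"
        by (simp add: s_eq \<tau>_def add.commute)
      also have "\<dots> \<longleftrightarrow> real i < x \<and> x \<le> real i + 1"
        using h_pos[of j] by (simp only: mult_less_cancel_right_pos mult_le_cancel_right_pos)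
      also have "\<dots> \<longleftrightarrow> i = k" using k by auto
      finally show ?thesis .
    qed
    have "\<phi> j s = (\<Sum>i<2 ^ j. if i = k then f (\<tau> j i) else 0)"
      unfolding \<phi>_def step_fun_def using in_iff by (intro sum.cong refl) (auto simp: indicator_def)
    then have "\<phi> j s = f (\<tau> j k)" using k_lt by simp
    moreover have "\<bar>f s - f (\<tau> j k)\<bar> \<le> L * (s - \<tau> j k)"
      using in_iff[of k] s h_pos[of j] by (intro lip) (auto simp: \<tau>_def)
    moreover have "s - \<tau> j k \<le> h j"
      using k h_pos[of j] by (auto simp: s_eq \<tau>_def left_diff_distrib[symmetric] intro: mult_left_le_one_le)
    ultimately show ?thesis using \<open>0 \<le> L\<close> by (smt (verit) mult_left_mono)
  qed
  define D where "D = 4 * L\<^sup>2 * (b - a) ^ 3"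
  have "0 \<le> D" using \<open>a < b\<close> by (simp add: D_def)
  have box: "(\<integral>\<^sup>+x. ennreal (4 * L\<^sup>2 * (h j)\<^sup>2) * indicator {a<..b} x \<partial>lborel) = ennreal (D / 4 ^ j)" for j
  proof -
    have "(\<integral>\<^sup>+x. ennreal (4 * L\<^sup>2 * (h j)\<^sup>2) * indicator {a<..b} x \<partial>lborel) = ennreal (4 * L\<^sup>2 * (h j)\<^sup>2 * (b - a))"
      using \<open>a < b\<close> by (simp add: nn_integral_cmult_indicator ennreal_mult'')
    also have "4 * L\<^sup>2 * (h j)\<^sup>2 * (b - a) = D / 4 ^ j"
    proof -
      have "(2 ^ j)\<^sup>2 = (4::real) ^ j" by (simp add: power2_eq_square flip: power_mult_distrib)
      then show ?thesis by (simp add: h_def D_def power_divide power3_eq_cube power2_eq_square)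
    qed
    finally show ?thesis .
  qed
  have cauchy: "(\<integral>\<^sup>+\<omega>. ennreal ((S k \<omega> - S j \<omega>)\<^sup>2) \<partial>M) \<le> ennreal (D / 4 ^ j)" if "j \<le> k" for j k
  proof -
    have "(\<integral>\<^sup>+\<omega>. ennreal ((S k \<omega> - S j \<omega>)\<^sup>2) \<partial>M) = (\<integral>\<^sup>+x. ennreal ((\<phi> k x - \<phi> j x)\<^sup>2) \<partial>lborel)"
      by (rule nn_isometry[OF simple_integral_diff[OF S_simple S_simple]])
    also have "\<dots> \<le> (\<integral>\<^sup>+x. ennreal (4 * L\<^sup>2 * (h j)\<^sup>2) * indicator {a<..b} x \<partial>lborel)"
    proof (rule nn_integral_mono)
      fix x
      show "ennreal ((\<phi> k x - \<phi> j x)\<^sup>2) \<le> ennreal (4 * L\<^sup>2 * (h j)\<^sup>2) * indicator {a<..b} x"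
      proof (cases "x \<in> {a<..b}")
        case True
        have "h k \<le> h j"
          using \<open>a < b\<close> that by (auto simp: h_def intro!: divide_left_mono power_increasing)
        then have "\<bar>\<phi> k x - \<phi> j x\<bar> \<le> 2 * (L * h j)"
          using approx[of x k] approx[of x j] True mult_left_mono[OF \<open>h k \<le> h j\<close> \<open>0 \<le> L\<close>] by auto
        then have "(\<phi> k x - \<phi> j x)\<^sup>2 \<le> (2 * (L * h j))\<^sup>2"
          by (metis abs_ge_zero power2_abs power_mono)
        then show ?thesis using True by (simp add: power_mult_distrib ennreal_leI mult.assoc)
      next
        case False
        then show ?thesis using step_fun_outside[OF \<tau>] by (simp add: \<phi>_def)
      qed
    qed
    finally show ?thesis by (simp only: box)
  qed
  have "AE \<omega> in M. summable (\<lambda>j. 2 ^ j * (S (Suc j) \<omega> - S j \<omega>)\<^sup>2)"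
  proof (rule AE_summable_of_nn_integral)
    have "(\<integral>\<^sup>+\<omega>. ennreal (2 ^ j * (S (Suc j) \<omega> - S j \<omega>)\<^sup>2) \<partial>M) \<le> ennreal (D * (1/2) ^ j)" for j
    proof -
      have "(\<integral>\<^sup>+\<omega>. ennreal (2 ^ j * (S (Suc j) \<omega> - S j \<omega>)\<^sup>2) \<partial>M)
          = ennreal (2 ^ j) * (\<integral>\<^sup>+\<omega>. ennreal ((S (Suc j) \<omega> - S j \<omega>)\<^sup>2) \<partial>M)"
        by (simp add: ennreal_mult nn_integral_cmult)
      also have "\<dots> \<le> ennreal (2 ^ j) * ennreal (D / 4 ^ j)"
        by (intro mult_left_mono cauchy) auto
      also have "\<dots> = ennreal (2 ^ j * (D / 4 ^ j))"
        using \<open>0 \<le> D\<close> by (intro ennreal_mult[symmetric]) auto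
      also have "2 ^ j * (D / 4 ^ j) = D * (1/2) ^ j"
      proof -
        have "(4::real) ^ j = 2 ^ j * 2 ^ j" by (simp flip: power_mult_distrib)
        then show ?thesis by (simp add: power_divide)
      qed
      finally show ?thesis .
    qed
    then have "(\<Sum>j. \<integral>\<^sup>+\<omega>. ennreal (2 ^ j * (S (Suc j) \<omega> - S j \<omega>)\<^sup>2) \<partial>M) \<le> (\<Sum>j. ennreal (D * (1/2) ^ j))"
      by (intro suminf_le) auto
    also have "\<dots> = ennreal (\<Sum>j. D * (1/2) ^ j)"
      using \<open>0 \<le> D\<close> by (intro suminf_ennreal2) (auto intro: summable_mult summable_geometric)
    finally show "(\<Sum>j. \<integral>\<^sup>+\<omega>. ennreal (2 ^ j * (S (Suc j) \<omega> - S j \<omega>)\<^sup>2) \<partial>M) < \<infinity>"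
      by (rule le_less_trans) simp
  qed auto
  then have conv: "AE \<omega> in M. (\<lambda>j. S j \<omega>) \<longlonglongrightarrow> lim (\<lambda>j. S j \<omega>)"
  proof eventually_elim
    case (elim \<omega>)
    have "summable (\<lambda>j. (2 ^ j * (S (Suc j) \<omega> - S j \<omega>)\<^sup>2 + (1/2) ^ j) / 2)"
      by (intro summable_divide summable_add elim summable_geometric) simp
    moreover have "norm (S (Suc j) \<omega> - S j \<omega>) \<le> (2 ^ j * (S (Suc j) \<omega> - S j \<omega>)\<^sup>2 + (1/2) ^ j) / 2" for j
    proof -
      \<comment> \<open>For \<open>p = 2 ^ j\<close> and \<open>y\<close> the increment both terms are summable over \<open>j\<close>.\<close>
      have "2 * \<bar>y\<bar> \<le> p * y\<^sup>2 + 1 / p" if "0 < p" for p y :: real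
      proof -
        have "0 \<le> (p * \<bar>y\<bar> - 1)\<^sup>2 / p" using that by simp
        also have "\<dots> = p * y\<^sup>2 + 1 / p - 2 * \<bar>y\<bar>"
          using that by (simp add: power2_diff field_simps power2_eq_square)
        finally show ?thesis by simp
      qed
      from this[of "2 ^ j" "S (Suc j) \<omega> - S j \<omega>"] show ?thesis by (simp add: power_divide)
    qed
    ultimately have "summable (\<lambda>j. S (Suc j) \<omega> - S j \<omega>)"
      by (rule summable_comparison_test'[of _ 0])
    then have "convergent (\<lambda>n. \<Sum>j<n. S (Suc j) \<omega> - S j \<omega>)"
      by (simp add: summable_iff_convergent)
    then have "convergent (\<lambda>n. (S n \<omega> - S 0 \<omega>) + S 0 \<omega>)"
      unfolding sum_lessThan_telescope[of "\<lambda>j. S j \<omega>"] by (intro convergent_add convergent_const)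
    then show ?case by (simp add: convergent_LIMSEQ_iff)
  qed
  define I where "I = (\<lambda>\<omega>. lim (\<lambda>j. S j \<omega>))"
  have I_meas [measurable]: "I \<in> borel_measurable M"
    unfolding I_def by measurable
  have "(\<integral>\<^sup>+\<omega>. ennreal ((I \<omega> - S j \<omega>)\<^sup>2) \<partial>M) \<le> ennreal (D / 4 ^ j)" for j
  proof (rule nn_integral_Fatou[where u="\<lambda>k \<omega>. (S k \<omega> - S j \<omega>)\<^sup>2"])
    show "AE \<omega> in M. (\<lambda>k. (S k \<omega> - S j \<omega>)\<^sup>2) \<longlonglongrightarrow> (I \<omega> - S j \<omega>)\<^sup>2"
      using conv by eventually_elim (auto simp: I_def intro!: tendsto_intros)
    show "eventually (\<lambda>k. (\<integral>\<^sup>+\<omega>. ennreal ((S k \<omega> - S j \<omega>)\<^sup>2) \<partial>M) \<le> ennreal (D / 4 ^ j)) sequentially"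
      using eventually_ge_at_top[of j] by eventually_elim (rule cauchy)
  qed measurable
  note I_bound = this
  have lim0: "(\<lambda>j. ennreal (D / 4 ^ j)) \<longlonglongrightarrow> 0"
  proof -
    have "(\<lambda>j. D * (1/4) ^ j) \<longlonglongrightarrow> D * 0"
      by (intro tendsto_mult tendsto_const LIMSEQ_realpow_zero) auto
    then have "(\<lambda>j. ennreal (D * (1/4) ^ j)) \<longlonglongrightarrow> ennreal (D * 0)"
      by (rule tendsto_ennrealI)
    then show ?thesis by (simp add: power_divide)
  qed
  have I_lim: "(\<lambda>j. \<integral>\<^sup>+\<omega>. ennreal ((I \<omega> - S j \<omega>)\<^sup>2) \<partial>M) \<longlonglongrightarrow> 0"
    by (rule tendsto_sandwich[OF _ _ tendsto_const lim0]) (simp_all add: I_bound)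
  have "(\<integral>\<^sup>+s\<in>{a..b}. ennreal ((f s - \<phi> j s)\<^sup>2) \<partial>lborel) \<le> ennreal (D / 4 ^ j)" for j
  proof -
    have "(\<integral>\<^sup>+s\<in>{a..b}. ennreal ((f s - \<phi> j s)\<^sup>2) \<partial>lborel)
        \<le> (\<integral>\<^sup>+x. ennreal (4 * L\<^sup>2 * (h j)\<^sup>2) * indicator {a<..b} x \<partial>lborel)"
    proof (rule nn_integral_mono_AE, rule AE_mp[OF AE_lborel_singleton[of a]], rule AE_I2, rule impI)
      fix x assume "x \<noteq> a"
      show "ennreal ((f x - \<phi> j x)\<^sup>2) * indicator {a..b} x \<le> ennreal (4 * L\<^sup>2 * (h j)\<^sup>2) * indicator {a<..b} x"
      proof (cases "x \<in> {a<..b}")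
        case True
        have "\<bar>f x - \<phi> j x\<bar> \<le> 2 * (L * h j)"
          using approx[of x j] True \<open>0 \<le> L\<close> h_pos[of j] by (smt (verit) greaterThanAtMost_iff mult_nonneg_nonneg)
        then have "(f x - \<phi> j x)\<^sup>2 \<le> (2 * (L * h j))\<^sup>2"
          by (metis abs_ge_zero power2_abs power_mono)
        then show ?thesis using True by (simp add: power_mult_distrib ennreal_leI mult.assoc)
      qed (use \<open>x \<noteq> a\<close> in \<open>auto simp: indicator_def\<close>)
    qed
    then show ?thesis by (simp only: box)
  qed
  note f_bound = this
  have f_lim: "(\<lambda>j. \<integral>\<^sup>+s\<in>{a..b}. ennreal ((f s - \<phi> j s)\<^sup>2) \<partial>lborel) \<longlonglongrightarrow> 0"
    by (rule tendsto_sandwich[OF _ _ tendsto_const lim0]) (simp_all add: f_bound)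
  have "has_wiener_integral M B a b f I"
    unfolding has_wiener_integral_def
    by (intro conjI exI[of _ \<tau>] exI[of _ "\<lambda>j. 2 ^ j"] exI[of _ "\<lambda>j k. f (\<tau> j k)"] allI
        I_meas \<tau> f_lim[unfolded \<phi>_def] I_lim[unfolded S_def])
  then show ?thesis by blast
qed

end

section \<open>Additivity of Wiener integrals\<close>

lemma sum4_sq_le: "((w::real) - x - y + z)\<^sup>2 \<le> 4 * (w\<^sup>2 + x\<^sup>2 + y\<^sup>2 + z\<^sup>2)"
proof -
  have "((w - x) - (y - z))\<^sup>2 \<le> 2 * (w - x)\<^sup>2 + 2 * (y - z)\<^sup>2" by (rule sq_diff_le)
  then show ?thesis
    using sq_diff_le[of w x] sq_diff_le[of y z] by (simp add: algebra_simps)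
qed

context brownian
begin

text \<open>
  The integral of the step functions \<open>\<phi> j - r \<phi>0 j - \<phi>1 j\<close>, which approximate \<open>0\<close>, tends to
  \<open>I - r I0 - I1\<close> in \<open>L\<^sup>2\<close>.  For \<open>r = 1\<close> this is additivity; the factor \<open>r\<close> accounts for exponential
  kernels, which change by a constant factor when the right end point moves.
\<close>

lemma wiener_integral_split:
  assumes ab: "0 \<le> a" "a \<le> b" "b \<le> d" "d \<le> T"
    and I: "has_wiener_integral M B a d f I"
    and I0: "has_wiener_integral M B a b g I0"
    and I1: "has_wiener_integral M B b d f I1"
    and f [measurable]: "f \<in> borel_measurable borel" and g [measurable]: "g \<in> borel_measurable borel"
    and fg: "\<And>s. a \<le> s \<Longrightarrow> s \<le> b \<Longrightarrow> f s = r * g s"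
  shows "AE \<omega> in M. I \<omega> = r * I0 \<omega> + I1 \<omega>"
proof -
  have "0 \<le> T" "a \<le> d" "b \<le> T" "0 \<le> b" using ab by simp_all
  obtain \<tau> n c where \<tau>: "\<And>j. time_partition (\<tau> j) (n j) a d"
    and f_lim: "(\<lambda>j. \<integral>\<^sup>+s\<in>{a..d}. ennreal ((f s - step_fun (\<tau> j) (n j) (c j) s)\<^sup>2) \<partial>lborel) \<longlonglongrightarrow> 0"
    and I_lim: "(\<lambda>j. \<integral>\<^sup>+\<omega>. ennreal ((I \<omega> - step_integral B (\<tau> j) (n j) (c j) \<omega>)\<^sup>2) \<partial>M) \<longlonglongrightarrow> 0"
    and I_meas [measurable]: "I \<in> borel_measurable M"
    using I unfolding has_wiener_integral_def by blast
  obtain \<tau>0 n0 c0 where \<tau>0: "\<And>j. time_partition (\<tau>0 j) (n0 j) a b"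
    and g_lim: "(\<lambda>j. \<integral>\<^sup>+s\<in>{a..b}. ennreal ((g s - step_fun (\<tau>0 j) (n0 j) (c0 j) s)\<^sup>2) \<partial>lborel) \<longlonglongrightarrow> 0"
    and I0_lim: "(\<lambda>j. \<integral>\<^sup>+\<omega>. ennreal ((I0 \<omega> - step_integral B (\<tau>0 j) (n0 j) (c0 j) \<omega>)\<^sup>2) \<partial>M) \<longlonglongrightarrow> 0"
    and I0_meas [measurable]: "I0 \<in> borel_measurable M"
    using I0 unfolding has_wiener_integral_def by blast
  obtain \<tau>1 n1 c1 where \<tau>1: "\<And>j. time_partition (\<tau>1 j) (n1 j) b d"
    and f1_lim: "(\<lambda>j. \<integral>\<^sup>+s\<in>{b..d}. ennreal ((f s - step_fun (\<tau>1 j) (n1 j) (c1 j) s)\<^sup>2) \<partial>lborel) \<longlonglongrightarrow> 0"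
    and I1_lim: "(\<lambda>j. \<integral>\<^sup>+\<omega>. ennreal ((I1 \<omega> - step_integral B (\<tau>1 j) (n1 j) (c1 j) \<omega>)\<^sup>2) \<partial>M) \<longlonglongrightarrow> 0"
    and I1_meas [measurable]: "I1 \<in> borel_measurable M"
    using I1 unfolding has_wiener_integral_def by blast
  define S \<phi> where "S = (\<lambda>j. step_integral B (\<tau> j) (n j) (c j))" and "\<phi> = (\<lambda>j. step_fun (\<tau> j) (n j) (c j))"
  define S0 \<phi>0 where "S0 = (\<lambda>j. step_integral B (\<tau>0 j) (n0 j) (c0 j))" and "\<phi>0 = (\<lambda>j. step_fun (\<tau>0 j) (n0 j) (c0 j))"
  define S1 \<phi>1 where "S1 = (\<lambda>j. step_integral B (\<tau>1 j) (n1 j) (c1 j))" and "\<phi>1 = (\<lambda>j. step_fun (\<tau>1 j) (n1 j) (c1 j))"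
  have si: "simple_integral (S j) (\<phi> j)" "simple_integral (S0 j) (\<phi>0 j)" "simple_integral (S1 j) (\<phi>1 j)" for j
    unfolding S_def \<phi>_def S0_def \<phi>0_def S1_def \<phi>1_def
    by (rule simple_integral_step[OF \<tau>] simple_integral_step[OF \<tau>0] simple_integral_step[OF \<tau>1];
        use ab in simp)+
  have [measurable]: "S j \<in> borel_measurable M" "S0 j \<in> borel_measurable M" "S1 j \<in> borel_measurable M"
    "\<phi> j \<in> borel_measurable borel" "\<phi>0 j \<in> borel_measurable borel" "\<phi>1 j \<in> borel_measurable borel" for j
    using simple_integral_measurable[OF si(1) \<open>0 \<le> T\<close>] simple_integral_measurable[OF si(2) \<open>0 \<le> T\<close>]
      simple_integral_measurable[OF si(3) \<open>0 \<le> T\<close>] by auto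
  define e where "e = (\<lambda>j. \<integral>\<^sup>+\<omega>. ennreal ((I \<omega> - S j \<omega>)\<^sup>2) \<partial>M)"
  define e0 where "e0 = (\<lambda>j. \<integral>\<^sup>+\<omega>. ennreal ((I0 \<omega> - S0 j \<omega>)\<^sup>2) \<partial>M)"
  define e1 where "e1 = (\<lambda>j. \<integral>\<^sup>+\<omega>. ennreal ((I1 \<omega> - S1 j \<omega>)\<^sup>2) \<partial>M)"
  define h where "h = (\<lambda>j. \<integral>\<^sup>+s\<in>{a..d}. ennreal ((f s - \<phi> j s)\<^sup>2) \<partial>lborel)"
  define h0 where "h0 = (\<lambda>j. \<integral>\<^sup>+s\<in>{a..b}. ennreal ((g s - \<phi>0 j s)\<^sup>2) \<partial>lborel)"
  define h1 where "h1 = (\<lambda>j. \<integral>\<^sup>+s\<in>{b..d}. ennreal ((f s - \<phi>1 j s)\<^sup>2) \<partial>lborel)"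
  define R where "R = ennreal (r\<^sup>2)"
  have scale: "ennreal ((r * x)\<^sup>2) = R * ennreal (x\<^sup>2)" for x
    by (simp add: R_def power_mult_distrib ennreal_mult)
  have sum4: "ennreal ((w - r * x - y + z)\<^sup>2)
      \<le> 4 * (ennreal (w\<^sup>2) + R * ennreal (x\<^sup>2) + ennreal (y\<^sup>2) + ennreal (z\<^sup>2))" for w x y z
  proof -
    have "ennreal ((w - r * x - y + z)\<^sup>2) \<le> ennreal (4 * (w\<^sup>2 + (r * x)\<^sup>2 + y\<^sup>2 + z\<^sup>2))"
      by (intro ennreal_leI sum4_sq_le)
    also have "\<dots> = 4 * (ennreal (w\<^sup>2) + R * ennreal (x\<^sup>2) + ennreal (y\<^sup>2) + ennreal (z\<^sup>2))"
      unfolding scale[symmetric] by (simp add: ennreal_mult)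
    finally show ?thesis .
  qed
  have step: "(\<integral>\<^sup>+\<omega>. ennreal ((S j \<omega> - r * S0 j \<omega> - S1 j \<omega>)\<^sup>2) \<partial>M) \<le> 4 * (h j + R * h0 j + h1 j)" for j
  proof -
    have "(\<integral>\<^sup>+\<omega>. ennreal ((S j \<omega> - r * S0 j \<omega> - S1 j \<omega>)\<^sup>2) \<partial>M)
        = (\<integral>\<^sup>+x. ennreal ((\<phi> j x - r * \<phi>0 j x - \<phi>1 j x)\<^sup>2) \<partial>lborel)"
      by (rule nn_isometry) (intro simple_integral_diff scale si simple_integral.scale)
    also have "\<dots> \<le> (\<integral>\<^sup>+x. 4 * (ennreal ((f x - \<phi> j x)\<^sup>2) * indicator {a..d} x
        + R * (ennreal ((g x - \<phi>0 j x)\<^sup>2) * indicator {a..b} x)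
        + ennreal ((f x - \<phi>1 j x)\<^sup>2) * indicator {b..d} x) \<partial>lborel)"
    proof (rule nn_integral_mono)
      fix x
      consider "x \<notin> {a<..d}" | "x \<in> {a<..b}" | "x \<in> {b<..d}" by fastforce
      then show "ennreal ((\<phi> j x - r * \<phi>0 j x - \<phi>1 j x)\<^sup>2) \<le> 4 * (ennreal ((f x - \<phi> j x)\<^sup>2) * indicator {a..d} x
        + R * (ennreal ((g x - \<phi>0 j x)\<^sup>2) * indicator {a..b} x)
        + ennreal ((f x - \<phi>1 j x)\<^sup>2) * indicator {b..d} x)"
      proof cases
        case 1
        then have "\<phi> j x = 0" "\<phi>0 j x = 0" "\<phi>1 j x = 0"
          using step_fun_outside[OF \<tau>, of x] step_fun_outside[OF \<tau>0, of x] step_fun_outside[OF \<tau>1, of x] ab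
          by (auto simp: \<phi>_def \<phi>0_def \<phi>1_def)
        then show ?thesis by simp
      next
        case 2
        then have "\<phi>1 j x = 0" using step_fun_outside[OF \<tau>1, of x] by (simp add: \<phi>1_def)
        then have "\<phi> j x - r * \<phi>0 j x - \<phi>1 j x = - (f x - \<phi> j x) - r * - (g x - \<phi>0 j x) - 0 + 0"
          using fg[of x] 2 by (simp add: algebra_simps)
        then have "ennreal ((\<phi> j x - r * \<phi>0 j x - \<phi>1 j x)\<^sup>2)
            \<le> 4 * (ennreal ((f x - \<phi> j x)\<^sup>2) + R * ennreal ((g x - \<phi>0 j x)\<^sup>2))"
          using sum4[of "- (f x - \<phi> j x)" "- (g x - \<phi>0 j x)" 0 0] by (simp only: power2_minus) simp
        also have "\<dots> \<le> 4 * (ennreal ((f x - \<phi> j x)\<^sup>2) * indicator {a..d} x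
            + R * (ennreal ((g x - \<phi>0 j x)\<^sup>2) * indicator {a..b} x)
            + ennreal ((f x - \<phi>1 j x)\<^sup>2) * indicator {b..d} x)"
          using 2 ab by (intro mult_left_mono) auto
        finally show ?thesis .
      next
        case 3
        then have "\<phi>0 j x = 0" using step_fun_outside[OF \<tau>0, of x] by (simp add: \<phi>0_def)
        then have "\<phi> j x - r * \<phi>0 j x - \<phi>1 j x = - (f x - \<phi> j x) - r * 0 - - (f x - \<phi>1 j x) + 0"
          by (simp add: algebra_simps)
        then have "ennreal ((\<phi> j x - r * \<phi>0 j x - \<phi>1 j x)\<^sup>2)
            \<le> 4 * (ennreal ((f x - \<phi> j x)\<^sup>2) + ennreal ((f x - \<phi>1 j x)\<^sup>2))"
          using sum4[of "- (f x - \<phi> j x)" 0 "- (f x - \<phi>1 j x)" 0] by (simp only: power2_minus) simp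
        also have "\<dots> \<le> 4 * (ennreal ((f x - \<phi> j x)\<^sup>2) * indicator {a..d} x
            + R * (ennreal ((g x - \<phi>0 j x)\<^sup>2) * indicator {a..b} x)
            + ennreal ((f x - \<phi>1 j x)\<^sup>2) * indicator {b..d} x)"
          using 3 ab by (intro mult_left_mono) (auto intro!: add_right_mono)
        finally show ?thesis .
      qed
    qed
    also have "\<dots> = 4 * (h j + R * h0 j + h1 j)"
      unfolding h_def h0_def h1_def by (simp add: nn_integral_add nn_integral_cmult)
    finally show ?thesis .
  qed
  have bound: "(\<integral>\<^sup>+\<omega>. ennreal ((I \<omega> - (r * I0 \<omega> + I1 \<omega>))\<^sup>2) \<partial>M)
      \<le> 4 * (e j + R * e0 j + e1 j + 4 * (h j + R * h0 j + h1 j))" for j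
  proof -
    have "(\<integral>\<^sup>+\<omega>. ennreal ((I \<omega> - (r * I0 \<omega> + I1 \<omega>))\<^sup>2) \<partial>M)
        \<le> (\<integral>\<^sup>+\<omega>. 4 * (ennreal ((I \<omega> - S j \<omega>)\<^sup>2) + R * ennreal ((I0 \<omega> - S0 j \<omega>)\<^sup>2)
          + ennreal ((I1 \<omega> - S1 j \<omega>)\<^sup>2) + ennreal ((S j \<omega> - r * S0 j \<omega> - S1 j \<omega>)\<^sup>2)) \<partial>M)"
    proof (rule nn_integral_mono)
      fix \<omega>
      have "I \<omega> - (r * I0 \<omega> + I1 \<omega>)
          = (I \<omega> - S j \<omega>) - r * (I0 \<omega> - S0 j \<omega>) - (I1 \<omega> - S1 j \<omega>) + (S j \<omega> - r * S0 j \<omega> - S1 j \<omega>)"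
        by (simp add: algebra_simps)
      then show "ennreal ((I \<omega> - (r * I0 \<omega> + I1 \<omega>))\<^sup>2) \<le> 4 * (ennreal ((I \<omega> - S j \<omega>)\<^sup>2) + R * ennreal ((I0 \<omega> - S0 j \<omega>)\<^sup>2)
          + ennreal ((I1 \<omega> - S1 j \<omega>)\<^sup>2) + ennreal ((S j \<omega> - r * S0 j \<omega> - S1 j \<omega>)\<^sup>2))"
        by (simp only: sum4)
    qed
    also have "\<dots> = 4 * (e j + R * e0 j + e1 j + (\<integral>\<^sup>+\<omega>. ennreal ((S j \<omega> - r * S0 j \<omega> - S1 j \<omega>)\<^sup>2) \<partial>M))"
      unfolding e_def e0_def e1_def by (simp add: nn_integral_add nn_integral_cmult)
    also have "\<dots> \<le> 4 * (e j + R * e0 j + e1 j + 4 * (h j + R * h0 j + h1 j))"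
      by (intro mult_left_mono add_left_mono step) simp
    finally show ?thesis .
  qed
  have "(\<lambda>j. 4 * (e j + R * e0 j + e1 j + 4 * (h j + R * h0 j + h1 j)))
      \<longlonglongrightarrow> 4 * (0 + R * 0 + 0 + 4 * (0 + R * 0 + 0))"
    unfolding e_def e0_def e1_def h_def h0_def h1_def S_def \<phi>_def S0_def \<phi>0_def S1_def \<phi>1_def R_def
    by (intro ennreal_tendsto_cmult tendsto_add f_lim I_lim g_lim I0_lim f1_lim I1_lim) auto
  then have lim: "(\<lambda>j. 4 * (e j + R * e0 j + e1 j + 4 * (h j + R * h0 j + h1 j))) \<longlonglongrightarrow> 0" by simp
  have "(\<integral>\<^sup>+\<omega>. ennreal ((I \<omega> - (r * I0 \<omega> + I1 \<omega>))\<^sup>2) \<partial>M) \<le> 0"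
    by (rule LIMSEQ_le_const[OF lim]) (use bound in blast)
  then have "AE \<omega> in M. ennreal ((I \<omega> - (r * I0 \<omega> + I1 \<omega>))\<^sup>2) = 0"
    by (subst (asm) le_zero_eq, subst (asm) nn_integral_0_iff_AE) auto
  then show ?thesis by eventually_elim (simp add: ennreal_eq_0_iff)
qed

end

section \<open>Ornstein--Uhlenbeck processes\<close>

lemma one_minus_exp_le: "1 - exp (- x) \<le> (x::real)"
  using exp_ge_add_one_self[of "- x"] by simp

lemma sum_power_le: "0 \<le> x \<Longrightarrow> 0 \<le> y \<Longrightarrow> (x + y) ^ p \<le> 2 ^ p * (x ^ p + y ^ p)" for x y :: real
proof -
  assume xy: "0 \<le> x" "0 \<le> y"
  have "(x + y) ^ p \<le> (2 * max x y) ^ p" using xy by (intro power_mono) auto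
  also have "\<dots> = 2 ^ p * max x y ^ p" by (rule power_mult_distrib)
  also have "max x y ^ p \<le> x ^ p + y ^ p" using xy by (auto simp: max_def)
  finally show ?thesis by simp
qed

lemma diff_even_power_le: "(x - y) ^ (2 * p) \<le> 4 ^ p * (x ^ (2 * p) + y ^ (2 * p))" for x y :: real
proof -
  have "(x - y) ^ (2 * p) \<le> (2 * x\<^sup>2 + 2 * y\<^sup>2) ^ p"
    unfolding power_mult by (intro power_mono sq_diff_le) simp
  also have "\<dots> \<le> 2 ^ p * ((2 * x\<^sup>2) ^ p + (2 * y\<^sup>2) ^ p)"
    by (rule sum_power_le) auto
  also have "\<dots> = (2 ^ p * 2 ^ p) * (x ^ (2 * p) + y ^ (2 * p))"
    by (simp only: power_mult_distrib power_mult) (simp add: algebra_simps)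
  also have "2 ^ p * 2 ^ p = (4::real) ^ p" by (simp flip: power_mult_distrib)
  finally show ?thesis .
qed

definition exp_kernel :: "real \<Rightarrow> real \<Rightarrow> real \<Rightarrow> real" where
  "exp_kernel \<nu> b s = exp (- \<nu> * (b - s))"

lemma measurable_exp_kernel [measurable]: "exp_kernel \<nu> b \<in> borel_measurable borel"
  unfolding exp_kernel_def[abs_def] by measurable

lemma exp_kernel_lipschitz:
  assumes "0 \<le> \<nu>" "s \<le> t" "t \<le> b"
  shows "\<bar>exp_kernel \<nu> b t - exp_kernel \<nu> b s\<bar> \<le> \<nu> * (t - s)"
proof -
  have "exp_kernel \<nu> b s = exp_kernel \<nu> b t * exp (- (\<nu> * (t - s)))"
    by (simp add: exp_kernel_def algebra_simps flip: exp_add)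
  then have eq: "exp_kernel \<nu> b t - exp_kernel \<nu> b s = exp_kernel \<nu> b t * (1 - exp (- (\<nu> * (t - s))))"
    by (simp add: algebra_simps)
  have "0 \<le> 1 - exp (- (\<nu> * (t - s)))" using assms by simp
  moreover have "exp_kernel \<nu> b t * (1 - exp (- (\<nu> * (t - s)))) \<le> 1 * (\<nu> * (t - s))"
    using assms by (intro mult_mono one_minus_exp_le) (auto simp: exp_kernel_def)
  ultimately show ?thesis unfolding eq by (simp add: exp_kernel_def)
qed

text \<open>
  The bound \<open>b - a\<close> is the one of Brownian motion and good on short intervals, \<open>1 / \<nu>\<close> is the one
  of the stationary process and good on long ones.
\<close>

lemma exp_kernel_L2:
  assumes "0 < \<nu>" "a \<le> b"
  shows "(\<integral>\<^sup>+s\<in>{a..b}. ennreal ((exp_kernel \<nu> b s)\<^sup>2) \<partial>lborel) \<le> ennreal (min (b - a) (1 / \<nu>))"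
proof -
  have "(\<integral>\<^sup>+s\<in>{a..b}. ennreal ((exp_kernel \<nu> b s)\<^sup>2) \<partial>lborel) \<le> (\<integral>\<^sup>+s. indicator {a..b} s \<partial>lborel)"
  proof (rule nn_integral_mono)
    fix s
    have "(exp_kernel \<nu> b s)\<^sup>2 \<le> 1" if "s \<le> b"
      using that assms by (intro power_le_one) (auto simp: exp_kernel_def)
    then show "ennreal ((exp_kernel \<nu> b s)\<^sup>2) * indicator {a..b} s \<le> indicator {a..b} s"
      by (auto simp: indicator_def)
  qed
  also have "\<dots> = ennreal (b - a)" using assms by simp
  finally have 1: "(\<integral>\<^sup>+s\<in>{a..b}. ennreal ((exp_kernel \<nu> b s)\<^sup>2) \<partial>lborel) \<le> ennreal (b - a)" .
  have "(\<integral>\<^sup>+s\<in>{a..b}. ennreal ((exp_kernel \<nu> b s)\<^sup>2) \<partial>lborel)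
      = ennreal ((exp_kernel \<nu> b b)\<^sup>2 / (2 * \<nu>) - (exp_kernel \<nu> b a)\<^sup>2 / (2 * \<nu>))"
  proof (rule nn_integral_FTC_Icc)
    fix s
    show "((\<lambda>s. (exp_kernel \<nu> b s)\<^sup>2 / (2 * \<nu>)) has_real_derivative (exp_kernel \<nu> b s)\<^sup>2) (at s)"
      unfolding exp_kernel_def
      by (rule derivative_eq_intros refl | use assms in \<open>simp add: power2_eq_square\<close>)+
  qed (use assms in auto)
  also have "\<dots> \<le> ennreal (1 / \<nu>)"
  proof (rule ennreal_leI)
    have "(exp_kernel \<nu> b b)\<^sup>2 / (2 * \<nu>) - (exp_kernel \<nu> b a)\<^sup>2 / (2 * \<nu>) \<le> 1 / (2 * \<nu>)"
      using assms by (simp add: exp_kernel_def)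
    also have "\<dots> \<le> 1 / \<nu>" using assms by (simp add: field_simps)
    finally show "(exp_kernel \<nu> b b)\<^sup>2 / (2 * \<nu>) - (exp_kernel \<nu> b a)\<^sup>2 / (2 * \<nu>) \<le> 1 / \<nu>" .
  qed
  finally show ?thesis using 1 by (simp add: min_def)
qed

definition ou_const :: "nat \<Rightarrow> real" where
  "ou_const p = 2 * 16 ^ p * gaussian_moment p"

lemma ou_const_pos: "0 < ou_const p"
  by (simp add: ou_const_def gaussian_moment_pos)

context brownian
begin

text \<open>
  The stochastic convolution over \<open>{a..b}\<close>; for \<open>a = 0\<close>, as a process in \<open>b\<close>, it is the
  Ornstein--Uhlenbeck process with rate \<open>\<nu>\<close> that starts at \<open>0\<close>.
\<close>

definition ou :: "real \<Rightarrow> real \<Rightarrow> real \<Rightarrow> 'w \<Rightarrow> real" where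
  "ou \<nu> a b = wiener_integral M B a b (exp_kernel \<nu> b)"

lemma ou_has_wiener_integral:
  assumes "0 \<le> \<nu>" "0 \<le> a" "a \<le> b" "b \<le> T"
  shows "has_wiener_integral M B a b (exp_kernel \<nu> b) (ou \<nu> a b)"
proof -
  have "\<exists>I. has_wiener_integral M B a b (exp_kernel \<nu> b) I"
    using assms by (intro wiener_integral_exists[where L=\<nu>] exp_kernel_lipschitz) auto
  then show ?thesis unfolding ou_def wiener_integral_def by (rule someI_ex)
qed

lemma ou_measurable:
  assumes "0 \<le> \<nu>" "0 \<le> a" "a \<le> b" "b \<le> T"
  shows "ou \<nu> a b \<in> borel_measurable M"
  using ou_has_wiener_integral[OF assms] by (simp add: has_wiener_integral_def)

lemma ou_split:
  assumes "0 \<le> \<nu>" "0 \<le> a" "a \<le> b" "b \<le> d" "d \<le> T"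
  shows "AE \<omega> in M. ou \<nu> a d \<omega> = exp (- \<nu> * (d - b)) * ou \<nu> a b \<omega> + ou \<nu> b d \<omega>"
proof (rule wiener_integral_split)
  show "exp_kernel \<nu> d s = exp (- \<nu> * (d - b)) * exp_kernel \<nu> b s" for s
    by (simp add: exp_kernel_def algebra_simps flip: exp_add)
qed (use assms in \<open>auto intro!: ou_has_wiener_integral\<close>)

lemma ou_degenerate:
  assumes "0 \<le> \<nu>" "0 \<le> a" "a \<le> T"
  shows "AE \<omega> in M. ou \<nu> a a \<omega> = 0"
  using ou_split[of \<nu> a a a] assms by simp

lemma ou_moment:
  assumes "0 < \<nu>" "0 \<le> a" "a \<le> b" "b \<le> T" "0 < v" "min (b - a) (1 / \<nu>) \<le> v"
  shows "(\<integral>\<^sup>+\<omega>. ennreal (ou \<nu> a b \<omega> ^ (2 * k)) \<partial>M) \<le> ennreal (gaussian_moment k * (4 * v) ^ k)"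
proof (rule wiener_integral_moment)
  show "has_wiener_integral M B a b (exp_kernel \<nu> b) (ou \<nu> a b)"
    using assms by (intro ou_has_wiener_integral) auto
  show "(\<integral>\<^sup>+s\<in>{a..b}. ennreal ((exp_kernel \<nu> b s)\<^sup>2) \<partial>lborel) \<le> ennreal v"
    using exp_kernel_L2[of \<nu> a b] assms by (meson ennreal_leI order_trans)
qed (use assms in auto)

text \<open>
  The increment is the sum of a multiple of the value at time \<open>s\<close> and of the integral over
  \<open>{s..t}\<close>; both have variances of at most \<open>v = min h (1 / \<nu>)\<close>.  Of \<open>v\<^sup>p\<close> three factors are estimated
  by \<open>h\<close>, as many as chaining uses up, and all others by \<open>1 / \<nu>\<close>.
\<close>

lemma ou_increment_moment:
  assumes \<nu>: "0 < \<nu>" and st: "0 \<le> s" "s \<le> t" "t \<le> T" and h: "t - s \<le> h" "0 < h" and p: "3 \<le> p"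
  shows "(\<integral>\<^sup>+\<omega>. ennreal ((ou \<nu> 0 t \<omega> - ou \<nu> 0 s \<omega>) ^ (2 * p)) \<partial>M) \<le> ennreal (ou_const p * h ^ 3 / \<nu> ^ (p - 3))"
proof -
  define v where "v = min h (1 / \<nu>)"
  define r where "r = exp (- \<nu> * (t - s))"
  have v: "0 < v" "v \<le> h" "v \<le> 1 / \<nu>" using \<nu> h by (auto simp: v_def)
  have [measurable]: "ou \<nu> 0 s \<in> borel_measurable M" "ou \<nu> s t \<in> borel_measurable M"
    using \<nu> st by (auto intro!: ou_measurable)
  have r: "0 \<le> 1 - r" "1 - r \<le> 1" "1 - r \<le> \<nu> * h"
  proof -
    have "1 - r \<le> \<nu> * (t - s)" using one_minus_exp_le[of "\<nu> * (t - s)"] by (simp add: r_def)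
    also have "\<dots> \<le> \<nu> * h" using \<nu> h by simp
    finally show "1 - r \<le> \<nu> * h" .
  qed (use \<nu> st in \<open>auto simp: r_def\<close>)
  have drift: "(1 - r) ^ (2 * p) * (1 / \<nu>) ^ p \<le> v ^ p"
  proof -
    have "(1 - r)\<^sup>2 \<le> (1 - r) * 1" unfolding power2_eq_square using r by (intro mult_left_mono) auto
    then have "(1 - r)\<^sup>2 / \<nu> \<le> (1 - r) / \<nu>" using \<nu> by (simp add: divide_right_mono)
    moreover have "(1 - r) / \<nu> \<le> h" "(1 - r) / \<nu> \<le> 1 / \<nu>" using r \<nu> by (auto simp: field_simps)
    ultimately have "(1 - r)\<^sup>2 / \<nu> \<le> v" unfolding v_def by auto
    then have "((1 - r)\<^sup>2 / \<nu>) ^ p \<le> v ^ p" using \<nu> by (intro power_mono) auto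
    then show ?thesis by (simp add: power_mult power_divide)
  qed
  have "(\<integral>\<^sup>+\<omega>. ennreal ((ou \<nu> 0 t \<omega> - ou \<nu> 0 s \<omega>) ^ (2 * p)) \<partial>M)
      \<le> (\<integral>\<^sup>+\<omega>. ennreal (4 ^ p) * (ennreal (ou \<nu> s t \<omega> ^ (2 * p))
            + ennreal ((1 - r) ^ (2 * p)) * ennreal (ou \<nu> 0 s \<omega> ^ (2 * p))) \<partial>M)"
  proof (rule nn_integral_mono_AE)
    have "AE \<omega> in M. ou \<nu> 0 t \<omega> = r * ou \<nu> 0 s \<omega> + ou \<nu> s t \<omega>"
      unfolding r_def using \<nu> st by (intro ou_split) auto
    then show "AE \<omega> in M. ennreal ((ou \<nu> 0 t \<omega> - ou \<nu> 0 s \<omega>) ^ (2 * p))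
        \<le> ennreal (4 ^ p) * (ennreal (ou \<nu> s t \<omega> ^ (2 * p)) + ennreal ((1 - r) ^ (2 * p)) * ennreal (ou \<nu> 0 s \<omega> ^ (2 * p)))"
    proof eventually_elim
      case (elim \<omega>)
      have "ou \<nu> 0 t \<omega> - ou \<nu> 0 s \<omega> = ou \<nu> s t \<omega> - (1 - r) * ou \<nu> 0 s \<omega>"
        using elim by (simp add: algebra_simps)
      then have "(ou \<nu> 0 t \<omega> - ou \<nu> 0 s \<omega>) ^ (2 * p)
          \<le> 4 ^ p * (ou \<nu> s t \<omega> ^ (2 * p) + (1 - r) ^ (2 * p) * ou \<nu> 0 s \<omega> ^ (2 * p))"
        using diff_even_power_le[of "ou \<nu> s t \<omega>" "(1 - r) * ou \<nu> 0 s \<omega>" p]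
        by (simp add: power_mult_distrib)
      then have "ennreal ((ou \<nu> 0 t \<omega> - ou \<nu> 0 s \<omega>) ^ (2 * p))
          \<le> ennreal (4 ^ p * (ou \<nu> s t \<omega> ^ (2 * p) + (1 - r) ^ (2 * p) * ou \<nu> 0 s \<omega> ^ (2 * p)))"
        by (rule ennreal_leI)
      also have "\<dots> = ennreal (4 ^ p) * (ennreal (ou \<nu> s t \<omega> ^ (2 * p)) + ennreal ((1 - r) ^ (2 * p)) * ennreal (ou \<nu> 0 s \<omega> ^ (2 * p)))"
        by (simp add: ennreal_mult ennreal_plus zero_le_even_power)
      finally show ?case .
    qed
  qed
  also have "\<dots> = ennreal (4 ^ p) * ((\<integral>\<^sup>+\<omega>. ennreal (ou \<nu> s t \<omega> ^ (2 * p)) \<partial>M)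
      + ennreal ((1 - r) ^ (2 * p)) * (\<integral>\<^sup>+\<omega>. ennreal (ou \<nu> 0 s \<omega> ^ (2 * p)) \<partial>M))"
    by (simp add: nn_integral_add nn_integral_cmult)
  also have "\<dots> \<le> ennreal (4 ^ p) * (ennreal (gaussian_moment p * (4 * v) ^ p)
      + ennreal ((1 - r) ^ (2 * p)) * ennreal (gaussian_moment p * (4 * (1 / \<nu>)) ^ p))"
    using \<nu> st h v by (intro mult_left_mono add_mono ou_moment) (auto simp: v_def)
  also have "\<dots> = ennreal (4 ^ p * (gaussian_moment p * (4 * v) ^ p
      + (1 - r) ^ (2 * p) * (gaussian_moment p * (4 * (1 / \<nu>)) ^ p)))"
    using gaussian_moment_pos[of p] v \<nu>
    by (simp add: ennreal_mult ennreal_plus zero_le_even_power)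
  also have "\<dots> \<le> ennreal (ou_const p * h ^ 3 / \<nu> ^ (p - 3))"
  proof (rule ennreal_leI)
    have "4 ^ p * (gaussian_moment p * (4 * v) ^ p + (1 - r) ^ (2 * p) * (gaussian_moment p * (4 * (1 / \<nu>)) ^ p))
        = (4 ^ p * 4 ^ p * gaussian_moment p) * (v ^ p + (1 - r) ^ (2 * p) * (1 / \<nu>) ^ p)"
      by (simp only: power_mult_distrib) (simp add: algebra_simps)
    also have "\<dots> \<le> (4 ^ p * 4 ^ p * gaussian_moment p) * (v ^ p + v ^ p)"
      using drift gaussian_moment_pos[of p] by (intro mult_left_mono) auto
    also have "\<dots> = ou_const p * v ^ p"
      unfolding ou_const_def by (simp flip: power_mult_distrib)
    also have "v ^ p = v ^ 3 * v ^ (p - 3)" using p by (simp flip: power_add)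
    also have "\<dots> \<le> h ^ 3 * (1 / \<nu>) ^ (p - 3)"
      using v by (intro mult_mono power_mono) auto
    finally show "4 ^ p * (gaussian_moment p * (4 * v) ^ p + (1 - r) ^ (2 * p) * (gaussian_moment p * (4 * (1 / \<nu>)) ^ p))
        \<le> ou_const p * h ^ 3 / \<nu> ^ (p - 3)"
      using ou_const_pos[of p] by (simp add: power_divide)
  qed
  finally show ?thesis .
qed

end

section \<open>A maximal bound by chaining\<close>

definition dyadic :: "real \<Rightarrow> nat \<Rightarrow> nat \<Rightarrow> real" where
  "dyadic T j k = T * real k / 2 ^ j"

definition dyadic_floor :: "real \<Rightarrow> nat \<Rightarrow> real \<Rightarrow> nat" where
  "dyadic_floor T j t = nat \<lfloor>2 ^ j * (t / T)\<rfloor>"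

lemma two_power_cubed: "(2 ^ j) ^ 3 = (8 :: real) ^ j"
proof -
  have "(2 ^ j) ^ 3 = ((2 :: real) ^ 3) ^ j" by (simp only: power_mult[symmetric] mult.commute)
  then show ?thesis by simp
qed

lemma dyadic_double: "dyadic T (Suc j) (2 * k) = dyadic T j k"
  by (simp add: dyadic_def)

lemma dyadic_floor_Suc:
  assumes "0 < T" "0 \<le> t"
  shows "dyadic_floor T (Suc j) t = 2 * dyadic_floor T j t \<or>
         dyadic_floor T (Suc j) t = Suc (2 * dyadic_floor T j t)"
proof -
  define x where "x = 2 ^ j * (t / T)"
  have "0 \<le> x" using assms by (simp add: x_def)
  have "\<lfloor>2 * x\<rfloor> = 2 * \<lfloor>x\<rfloor> \<or> \<lfloor>2 * x\<rfloor> = 2 * \<lfloor>x\<rfloor> + 1" by linarith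
  moreover have "0 \<le> \<lfloor>x\<rfloor>" using \<open>0 \<le> x\<close> by simp
  ultimately have "nat \<lfloor>2 * x\<rfloor> = 2 * nat \<lfloor>x\<rfloor> \<or> nat \<lfloor>2 * x\<rfloor> = Suc (2 * nat \<lfloor>x\<rfloor>)" by linarith
  then show ?thesis by (simp add: dyadic_floor_def x_def mult.assoc)
qed

lemma dyadic_floor_le:
  assumes "0 < T" "0 \<le> t" "t \<le> T"
  shows "dyadic_floor T j t \<le> 2 ^ j"
proof -
  have "2 ^ j * (t / T) \<le> 2 ^ j * 1" using assms by (intro mult_left_mono) auto
  then have "\<lfloor>2 ^ j * (t / T)\<rfloor> \<le> \<lfloor>real_of_int (2 ^ j)\<rfloor>" by (intro floor_mono) simp
  then have "\<lfloor>2 ^ j * (t / T)\<rfloor> \<le> 2 ^ j" by (simp only: floor_of_int)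
  then show ?thesis by (simp add: dyadic_floor_def nat_le_iff)
qed

lemma dyadic_floor_approx:
  assumes "0 < T" "0 \<le> t"
  shows "0 \<le> dyadic T j (dyadic_floor T j t)" "dyadic T j (dyadic_floor T j t) \<le> t"
    "t - dyadic T j (dyadic_floor T j t) \<le> T / 2 ^ j"
proof -
  define x where "x = 2 ^ j * (t / T)"
  define k where "k = dyadic_floor T j t"
  have "0 \<le> x" using assms by (simp add: x_def)
  then have k: "real k \<le> x" "x \<le> real k + 1" unfolding k_def dyadic_floor_def x_def[symmetric] by linarith+
  have t: "t = T / 2 ^ j * x" using assms by (simp add: x_def)
  have d: "dyadic T j k = T / 2 ^ j * real k" by (simp add: dyadic_def)
  have c: "0 < T / 2 ^ j" using assms by simp
  have "dyadic T j k \<le> t"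
    unfolding d t using c k by (intro mult_left_mono) auto
  moreover have "t - dyadic T j k \<le> T / 2 ^ j"
  proof -
    have "t - dyadic T j k = T / 2 ^ j * (x - real k)" unfolding d t by (simp add: right_diff_distrib)
    also have "\<dots> \<le> T / 2 ^ j * 1" using c k by (intro mult_left_mono) auto
    finally show ?thesis by simp
  qed
  moreover have "0 \<le> dyadic T j k" unfolding d using c assms by simp
  ultimately show "0 \<le> dyadic T j (dyadic_floor T j t)" "dyadic T j (dyadic_floor T j t) \<le> t"
    "t - dyadic T j (dyadic_floor T j t) \<le> T / 2 ^ j"
    unfolding k_def by blast+
qed

text \<open>
  The \<open>2p\<close>-th power of the sum of the geometric series with ratio \<open>2 powr (- 1 / (2p))\<close>.
\<close>

definition chain_const :: "nat \<Rightarrow> real" where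
  "chain_const p = (1 / (1 - root (2 * p) (1 / 2))) ^ (2 * p)"

lemma root_half: "0 < p \<Longrightarrow> 0 < root (2 * p) (1 / 2) \<and> root (2 * p) (1 / 2) < 1"
  by simp

text \<open>
  The dyadic approximations of \<open>t\<close> from below on consecutive levels are equal or neighbours on
  the finer level, so \<open>z t\<close> is a sum of increments, one for each level.  By assumption that of
  level \<open>j\<close> is at most the \<open>2p\<close>-th root of \<open>v / 2\<^sup>j\<close>.
\<close>

lemma chaining:
  fixes z :: "real \<Rightarrow> real"
  assumes T: "0 < T" and t: "0 \<le> t" "t \<le> T" and p: "0 < p" and "z 0 = 0"
    and inc: "\<And>j k. k < 2 ^ j \<Longrightarrow> 2 ^ j * (z (dyadic T j (Suc k)) - z (dyadic T j k)) ^ (2 * p) \<le> v"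
    and lim: "(\<lambda>j. z (dyadic T j (dyadic_floor T j t))) \<longlonglongrightarrow> z t"
  shows "z t ^ (2 * p) \<le> chain_const p * v"
proof -
  define \<rho> where "\<rho> = root (2 * p) (1 / 2)"
  define w where "w = root (2 * p) v"
  let ?z = "\<lambda>j. z (dyadic T j (dyadic_floor T j t))"
  have \<rho>: "0 < \<rho>" "\<rho> < 1" using root_half[OF p] by (auto simp: \<rho>_def)
  have "0 \<le> 2 ^ 0 * (z (dyadic T 0 (Suc 0)) - z (dyadic T 0 0)) ^ (2 * p)"
    by (simp add: zero_le_even_power)
  also have "\<dots> \<le> v" by (rule inc) simp
  finally have "0 \<le> v" .
  then have "0 \<le> w" using p by (simp add: w_def)
  have step: "\<bar>z (dyadic T j (Suc k)) - z (dyadic T j k)\<bar> \<le> w * \<rho> ^ j" if "k < 2 ^ j" for j k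
  proof -
    let ?d = "z (dyadic T j (Suc k)) - z (dyadic T j k)"
    have "\<bar>?d\<bar> ^ (2 * p) \<le> v * (1 / 2) ^ j"
      using inc[OF that] by (simp add: power_divide field_simps power_even_abs)
    then have "root (2 * p) (\<bar>?d\<bar> ^ (2 * p)) \<le> root (2 * p) (v * (1 / 2) ^ j)"
      using p by simp
    then show ?thesis
      using p by (simp add: real_root_power_cancel real_root_mult real_root_power w_def \<rho>_def)
  qed
  have bound: "\<bar>?z J\<bar> \<le> w * (\<Sum>j\<le>J. \<rho> ^ j)" for J
  proof (induction J)
    case 0
    have "dyadic_floor T 0 t \<le> 1" using dyadic_floor_le[OF T t, of 0] by simp
    then consider "dyadic_floor T 0 t = 0" | "dyadic_floor T 0 t = Suc 0" by linarith
    then show ?case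
      using step[of 0 0] \<open>z 0 = 0\<close> \<open>0 \<le> w\<close> by cases (auto simp: dyadic_def)
  next
    case (Suc J)
    let ?k = "dyadic_floor T J t"
    have "\<bar>?z (Suc J) - ?z J\<bar> \<le> w * \<rho> ^ Suc J"
      using dyadic_floor_Suc[OF T t(1), of J]
    proof
      assume "dyadic_floor T (Suc J) t = 2 * ?k"
      then show ?thesis using \<open>0 \<le> w\<close> \<rho> by (simp add: dyadic_double)
    next
      assume k: "dyadic_floor T (Suc J) t = Suc (2 * ?k)"
      then have "2 * ?k < 2 ^ Suc J" using dyadic_floor_le[OF T t, of "Suc J"] by simp
      from step[OF this] show ?thesis unfolding k dyadic_double .
    qed
    then show ?case using Suc by (simp add: distrib_left)
  qed
  have "\<bar>z t\<bar> \<le> w * (1 / (1 - \<rho>))"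
  proof (rule LIMSEQ_le_const2[OF tendsto_rabs[OF lim]], intro exI allI impI)
    fix J
    have "(\<Sum>j\<le>J. \<rho> ^ j) \<le> (\<Sum>j. \<rho> ^ j)"
      using \<rho> by (intro sum_le_suminf summable_geometric) auto
    also have "\<dots> = 1 / (1 - \<rho>)" using \<rho> by (intro suminf_geometric) auto
    finally show "\<bar>?z J\<bar> \<le> w * (1 / (1 - \<rho>))"
      using bound[of J] mult_left_mono[OF _ \<open>0 \<le> w\<close>] order_trans by blast
  qed
  then have "\<bar>z t\<bar> ^ (2 * p) \<le> (w * (1 / (1 - \<rho>))) ^ (2 * p)"
    by (intro power_mono) auto
  also have "\<dots> = w ^ (2 * p) * chain_const p"
    by (simp only: power_mult_distrib chain_const_def \<rho>_def)
  also have "w ^ (2 * p) = v" unfolding w_def using p \<open>0 \<le> v\<close> by (intro real_root_pow_pos2) auto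
  finally show ?thesis by (simp add: power_even_abs mult.commute)
qed

lemma chain_const_pos: "0 < p \<Longrightarrow> 0 < chain_const p"
  using root_half[of p] by (simp add: chain_const_def)

context brownian
begin

text \<open>
  The weight \<open>2\<^sup>j\<close> gives the increments of level \<open>j\<close> the geometric decay that \<open>chaining\<close> requires.
\<close>

definition ou_modulus :: "real \<Rightarrow> nat \<Rightarrow> 'w \<Rightarrow> ennreal" where
  "ou_modulus \<nu> p \<omega> = (\<Sum>j. ennreal (2 ^ j) *
     (\<Sum>k<2 ^ j. ennreal ((ou \<nu> 0 (dyadic T j (Suc k)) \<omega> - ou \<nu> 0 (dyadic T j k) \<omega>) ^ (2 * p))))"

lemma dyadic_in: "0 < T \<Longrightarrow> k \<le> 2 ^ j \<Longrightarrow> 0 \<le> dyadic T j k \<and> dyadic T j k \<le> T"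
proof -
  assume *: "0 < T" "k \<le> 2 ^ j"
  then have "real k \<le> 2 ^ j" by (metis of_nat_le_iff of_nat_numeral of_nat_power)
  then show ?thesis using *(1) by (simp add: dyadic_def field_simps)
qed

lemma ou_dyadic_measurable:
  "0 < T \<Longrightarrow> 0 \<le> \<nu> \<Longrightarrow> k \<le> 2 ^ j \<Longrightarrow> ou \<nu> 0 (dyadic T j k) \<in> borel_measurable M"
  using dyadic_in[of k j] by (intro ou_measurable) auto

lemma ou_modulus_measurable:
  assumes "0 < T" "0 \<le> \<nu>"
  shows "ou_modulus \<nu> p \<in> borel_measurable M"
  unfolding ou_modulus_def[abs_def]
  by (intro borel_measurable_suminf_order borel_measurable_times_ennreal borel_measurable_sum
      measurable_ennreal borel_measurable_power borel_measurable_diff ou_dyadic_measurable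
      borel_measurable_const measurable_compose[OF _ measurable_ennreal]) (use assms in auto)

text \<open>
  Level \<open>j\<close> has \<open>2\<^sup>j\<close> increments of weight \<open>2\<^sup>j\<close>, each with a moment of the order of \<open>8\<^sup>-\<^sup>j\<close>; what
  remains is the convergent series of the \<open>2\<^sup>-\<^sup>j\<close>.
\<close>

lemma ou_modulus_integral:
  assumes T: "0 < T" and \<nu>: "0 < \<nu>" and p: "3 \<le> p"
  shows "(\<integral>\<^sup>+\<omega>. ou_modulus \<nu> p \<omega> \<partial>M) \<le> ennreal (2 * ou_const p * T ^ 3 / \<nu> ^ (p - 3))"
proof -
  let ?D = "\<lambda>j k \<omega>. ennreal ((ou \<nu> 0 (dyadic T j (Suc k)) \<omega> - ou \<nu> 0 (dyadic T j k) \<omega>) ^ (2 * p))"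
  define c where "c = ou_const p * T ^ 3 / \<nu> ^ (p - 3)"
  have "0 \<le> c" using T \<nu> ou_const_pos[of p] by (simp add: c_def)
  have D_meas: "?D j k \<in> borel_measurable M" if "k < 2 ^ j" for j k
    using ou_dyadic_measurable[OF T, of \<nu> k j] ou_dyadic_measurable[OF T, of \<nu> "Suc k" j] \<nu> that
    by (intro measurable_compose[OF _ measurable_ennreal] borel_measurable_power borel_measurable_diff) auto
  have D_int: "(\<integral>\<^sup>+\<omega>. ?D j k \<omega> \<partial>M) \<le> ennreal (c * (1 / 8) ^ j)" if "k < 2 ^ j" for j k
  proof -
    have "dyadic T j (Suc k) - dyadic T j k = T / 2 ^ j"
      by (simp add: dyadic_def algebra_simps add_divide_distrib)
    moreover have "0 \<le> dyadic T j k" "dyadic T j k \<le> dyadic T j (Suc k)" "dyadic T j (Suc k) \<le> T"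
      using dyadic_in[OF T, of k j] dyadic_in[OF T, of "Suc k" j] that calculation T by auto
        (smt (verit) divide_pos_pos zero_less_power)
    ultimately have "(\<integral>\<^sup>+\<omega>. ?D j k \<omega> \<partial>M) \<le> ennreal (ou_const p * (T / 2 ^ j) ^ 3 / \<nu> ^ (p - 3))"
      using T by (intro ou_increment_moment \<nu> p) auto
    also have "(T / 2 ^ j) ^ 3 = T ^ 3 * (1 / 8) ^ j"
      by (simp add: power_divide two_power_cubed)
    finally show ?thesis by (simp add: c_def mult_ac)
  qed
  have "(\<integral>\<^sup>+\<omega>. ou_modulus \<nu> p \<omega> \<partial>M) = (\<Sum>j. \<integral>\<^sup>+\<omega>. ennreal (2 ^ j) * (\<Sum>k<2 ^ j. ?D j k \<omega>) \<partial>M)"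
    unfolding ou_modulus_def
    by (intro nn_integral_suminf borel_measurable_times_ennreal borel_measurable_sum D_meas) auto
  also have "\<dots> = (\<Sum>j. ennreal (2 ^ j) * (\<Sum>k<2 ^ j. \<integral>\<^sup>+\<omega>. ?D j k \<omega> \<partial>M))"
  proof (intro suminf_cong)
    fix j
    have "(\<integral>\<^sup>+\<omega>. ennreal (2 ^ j) * (\<Sum>k<2 ^ j. ?D j k \<omega>) \<partial>M)
        = ennreal (2 ^ j) * (\<integral>\<^sup>+\<omega>. (\<Sum>k<2 ^ j. ?D j k \<omega>) \<partial>M)"
      by (intro nn_integral_cmult borel_measurable_sum D_meas) (simp only: lessThan_iff)
    also have "(\<integral>\<^sup>+\<omega>. (\<Sum>k<2 ^ j. ?D j k \<omega>) \<partial>M) = (\<Sum>k<2 ^ j. \<integral>\<^sup>+\<omega>. ?D j k \<omega> \<partial>M)"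
      by (intro nn_integral_sum D_meas) (simp only: lessThan_iff)
    finally show "(\<integral>\<^sup>+\<omega>. ennreal (2 ^ j) * (\<Sum>k<2 ^ j. ?D j k \<omega>) \<partial>M)
        = ennreal (2 ^ j) * (\<Sum>k<2 ^ j. \<integral>\<^sup>+\<omega>. ?D j k \<omega> \<partial>M)" .
  qed
  also have "\<dots> \<le> (\<Sum>j. ennreal (c * (1 / 2) ^ j))"
  proof (intro suminf_le)
    fix j
    have "ennreal (2 ^ j) * (\<Sum>k<2 ^ j. \<integral>\<^sup>+\<omega>. ?D j k \<omega> \<partial>M)
        \<le> ennreal (2 ^ j) * (\<Sum>k<(2::nat) ^ j. ennreal (c * (1 / 8) ^ j))"
      by (intro mult_left_mono sum_mono D_int) auto
    also have "(\<Sum>k<(2::nat) ^ j. ennreal (c * (1 / 8) ^ j)) = ennreal (\<Sum>k<(2::nat) ^ j. c * (1 / 8) ^ j)"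
      using \<open>0 \<le> c\<close> by (intro sum_ennreal) auto
    also have "ennreal (2 ^ j) * \<dots> = ennreal (2 ^ j * (\<Sum>k<(2::nat) ^ j. c * (1 / 8) ^ j))"
      using \<open>0 \<le> c\<close> by (intro ennreal_mult[symmetric]) (auto intro!: sum_nonneg)
    also have "2 ^ j * (\<Sum>k<(2::nat) ^ j. c * (1 / 8) ^ j) = c * (1 / 2) ^ j"
    proof -
      have "(8::real) ^ j = 2 ^ j * (2 ^ j * 2 ^ j)" by (simp flip: power_mult_distrib)
      then show ?thesis by (simp add: power_divide)
    qed
    finally show "ennreal (2 ^ j) * (\<Sum>k<2 ^ j. \<integral>\<^sup>+\<omega>. ?D j k \<omega> \<partial>M) \<le> ennreal (c * (1 / 2) ^ j)" .
  qed auto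
  also have "\<dots> = ennreal (\<Sum>j. c * (1 / 2) ^ j)"
    using \<open>0 \<le> c\<close> by (intro suminf_ennreal2) (auto intro!: summable_mult summable_geometric)
  also have "(\<Sum>j. c * (1 / 2) ^ j) = 2 * c"
    by (subst suminf_mult) (auto simp: suminf_geometric intro!: summable_geometric)
  finally show ?thesis by (simp add: c_def mult_ac)
qed

text \<open>
  Each value is a version of its own stochastic integral, so nothing is known about
  the paths.  The sixth moments of the differences are summable, which suffices at a fixed time.
\<close>

lemma ou_dyadic_limit:
  assumes T: "0 < T" and \<nu>: "0 < \<nu>" and t: "0 \<le> t" "t \<le> T"
  shows "AE \<omega> in M. (\<lambda>j. ou \<nu> 0 (dyadic T j (dyadic_floor T j t)) \<omega>) \<longlonglongrightarrow> ou \<nu> 0 t \<omega>"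
proof -
  let ?s = "\<lambda>j. dyadic T j (dyadic_floor T j t)"
  define c where "c = ou_const 3 * T ^ 3"
  have "0 \<le> c" using T ou_const_pos[of 3] by (simp add: c_def)
  note s = dyadic_floor_approx[OF T t(1)]
  have [measurable]: "ou \<nu> 0 t \<in> borel_measurable M" "ou \<nu> 0 (?s j) \<in> borel_measurable M" for j
    using \<nu> t s[of j] by (auto intro!: ou_measurable)
  have "AE \<omega> in M. summable (\<lambda>j. (ou \<nu> 0 t \<omega> - ou \<nu> 0 (?s j) \<omega>) ^ (2 * 3))"
  proof (rule AE_summable_of_nn_integral)
    have "(\<Sum>j. \<integral>\<^sup>+\<omega>. ennreal ((ou \<nu> 0 t \<omega> - ou \<nu> 0 (?s j) \<omega>) ^ (2 * 3)) \<partial>M) \<le> (\<Sum>j. ennreal (c * (1 / 8) ^ j))"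
    proof (intro suminf_le)
      fix j
      have "(\<integral>\<^sup>+\<omega>. ennreal ((ou \<nu> 0 t \<omega> - ou \<nu> 0 (?s j) \<omega>) ^ (2 * 3)) \<partial>M)
          \<le> ennreal (ou_const 3 * (T / 2 ^ j) ^ 3 / \<nu> ^ (3 - 3))"
        using T s[of j] t by (intro ou_increment_moment \<nu>) auto
      also have "(T / 2 ^ j) ^ 3 = T ^ 3 * (1 / 8) ^ j"
        by (simp add: power_divide two_power_cubed)
      finally show "(\<integral>\<^sup>+\<omega>. ennreal ((ou \<nu> 0 t \<omega> - ou \<nu> 0 (?s j) \<omega>) ^ (2 * 3)) \<partial>M) \<le> ennreal (c * (1 / 8) ^ j)"
        by (simp add: c_def mult_ac)
    qed auto
    also have "\<dots> = ennreal (\<Sum>j. c * (1 / 8) ^ j)"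
      using \<open>0 \<le> c\<close> by (intro suminf_ennreal2) (auto intro!: summable_mult summable_geometric)
    finally show "(\<Sum>j. \<integral>\<^sup>+\<omega>. ennreal ((ou \<nu> 0 t \<omega> - ou \<nu> 0 (?s j) \<omega>) ^ (2 * 3)) \<partial>M) < \<infinity>"
      by (rule le_less_trans) simp
  qed (auto simp: zero_le_even_power)
  then show ?thesis
  proof eventually_elim
    case (elim \<omega>)
    then have "(\<lambda>j. (ou \<nu> 0 t \<omega> - ou \<nu> 0 (?s j) \<omega>) ^ (2 * 3)) \<longlonglongrightarrow> 0"
      by (rule summable_LIMSEQ_zero)
    then have "(\<lambda>j. root (2 * 3) (\<bar>ou \<nu> 0 t \<omega> - ou \<nu> 0 (?s j) \<omega>\<bar> ^ (2 * 3))) \<longlonglongrightarrow> root (2 * 3) 0"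
      by (intro tendsto_real_root) (simp add: power_even_abs)
    then have "(\<lambda>j. \<bar>ou \<nu> 0 t \<omega> - ou \<nu> 0 (?s j) \<omega>\<bar>) \<longlonglongrightarrow> 0"
      by (subst (asm) real_root_power_cancel) auto
    then have "(\<lambda>j. ou \<nu> 0 t \<omega> - (ou \<nu> 0 t \<omega> - ou \<nu> 0 (?s j) \<omega>)) \<longlonglongrightarrow> ou \<nu> 0 t \<omega> - 0"
      by (intro tendsto_diff tendsto_const) (simp add: tendsto_rabs_zero_iff)
    then show ?case by simp
  qed
qed

lemma ou_le_modulus:
  assumes T: "0 < T" and \<nu>: "0 < \<nu>" and t: "0 \<le> t" "t \<le> T" and p: "0 < p"
  shows "AE \<omega> in M. ou_modulus \<nu> p \<omega> < \<infinity> \<longrightarrow>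
    ou \<nu> 0 t \<omega> ^ (2 * p) \<le> chain_const p * enn2real (ou_modulus \<nu> p \<omega>)"
proof -
  have "AE \<omega> in M. ou \<nu> 0 0 \<omega> = 0" using ou_degenerate[of \<nu> 0] \<nu> T by simp
  with ou_dyadic_limit[OF T \<nu> t] show ?thesis
  proof eventually_elim
    case (elim \<omega>)
    show ?case
    proof
      assume fin: "ou_modulus \<nu> p \<omega> < \<infinity>"
      let ?D = "\<lambda>j k. (ou \<nu> 0 (dyadic T j (Suc k)) \<omega> - ou \<nu> 0 (dyadic T j k) \<omega>) ^ (2 * p)"
      show "ou \<nu> 0 t \<omega> ^ (2 * p) \<le> chain_const p * enn2real (ou_modulus \<nu> p \<omega>)"
      proof (rule chaining[OF T t p, where z="\<lambda>s. ou \<nu> 0 s \<omega>"])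
        fix j k :: nat assume k: "k < 2 ^ j"
        have "ennreal (2 ^ j * ?D j k) = ennreal (2 ^ j) * ennreal (?D j k)"
          by (simp add: ennreal_mult zero_le_even_power)
        also have "\<dots> \<le> ennreal (2 ^ j) * (\<Sum>k<2 ^ j. ennreal (?D j k))"
          using k member_le_sum[of k "{..<2 ^ j}" "\<lambda>k. ennreal (?D j k)"] by (intro mult_left_mono) auto
        also have "\<dots> \<le> ou_modulus \<nu> p \<omega>"
          unfolding ou_modulus_def
          using sum_le_suminf[of "\<lambda>j. ennreal (2 ^ j) * (\<Sum>k<2 ^ j. ennreal (?D j k))" "{j}"] by simp
        finally have le: "ennreal (2 ^ j * ?D j k) \<le> ou_modulus \<nu> p \<omega>" .
        have "2 ^ j * ?D j k = enn2real (ennreal (2 ^ j * ?D j k))"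
          by (simp add: zero_le_even_power)
        also have "\<dots> \<le> enn2real (ou_modulus \<nu> p \<omega>)"
          by (rule enn2real_mono[OF le]) (use fin in simp)
        finally show "2 ^ j * ?D j k \<le> enn2real (ou_modulus \<nu> p \<omega>)" .
      qed (use elim in auto)
    qed
  qed
qed

end

section \<open>Expansion of the solution in spherical harmonics\<close>

lemma sum_symmetric_int:
  fixes f :: "int \<Rightarrow> 'a :: comm_monoid_add"
  shows "(\<Sum>m\<in>{- int l..int l}. f m) = f 0 + (\<Sum>m=1..l. f (int m) + f (- int m))"
proof (induction l)
  case (Suc l)
  have "{- int (Suc l)..int (Suc l)} = insert (int (Suc l)) (insert (- int (Suc l)) {- int l..int l})"
    by auto
  then show ?case
    using Suc by (simp add: add_ac)
qed simp

text \<open>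
  The coefficients of \<open>u 0 Y\<^sub>l\<^sub>0 + sqrt 2 \<Sum>\<^sub>m (u m Re Y\<^sub>l\<^sub>m + v m Im Y\<^sub>l\<^sub>m)\<close> in the complex basis.
\<close>

definition noise_mode :: "(nat \<Rightarrow> real) \<Rightarrow> (nat \<Rightarrow> real) \<Rightarrow> int \<Rightarrow> complex" where
  "noise_mode u v m =
     (if m = 0 then of_real (u 0)
      else if 0 < m then Complex (u (nat m)) (- v (nat m)) / of_real (sqrt 2)
      else (-1) ^ nat (- m) * Complex (u (nat (- m))) (v (nat (- m))) / of_real (sqrt 2))"

lemma noise_mode_expansion:
  "of_real (u 0) * sph_harm l 0 x
     + of_real (sqrt 2) * (\<Sum>m=1..l. of_real (u m * Re (sph_harm l (int m) x) + v m * Im (sph_harm l (int m) x)))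
   = (\<Sum>m\<in>{- int l..int l}. noise_mode u v m * sph_harm l m x)"
proof -
  have term_eq: "of_real (sqrt 2) * of_real (u m * Re (sph_harm l (int m) x) + v m * Im (sph_harm l (int m) x))
      = noise_mode u v (int m) * sph_harm l (int m) x + noise_mode u v (- int m) * sph_harm l (- int m) x"
    if m: "m \<in> {1..l}" for m
  proof -
    define y where "y = sph_harm l (int m) x"
    have neg: "sph_harm l (- int m) x = (-1) ^ m * cnj y"
      using m by (simp add: y_def sph_harm_def)
    have sgn: "(- 1 :: complex) ^ m * (- 1) ^ m = 1"
      by (simp add: power_mult_distrib[symmetric])
    define q where "q = complex_of_real (sqrt 2)"
    define w where "w = complex_of_real (u m * Re y + v m * Im y)"
    have q: "q * q = 2" "q \<noteq> 0" by (simp_all add: q_def flip: of_real_mult)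
    have modes: "noise_mode u v (int m) = Complex (u m) (- v m) / q"
        "noise_mode u v (- int m) = (-1) ^ m * (Complex (u m) (v m) / q)"
      using m by (auto simp: noise_mode_def q_def)
    have "2 * w = Complex (u m) (- v m) * y + Complex (u m) (v m) * cnj y"
      by (simp add: w_def complex_eq_iff)
    then have "q * q * w = Complex (u m) (- v m) * y + Complex (u m) (v m) * cnj y"
      by (simp only: q)
    then have "q * w = (Complex (u m) (- v m) * y + Complex (u m) (v m) * cnj y) / q"
      using q(2) by (simp add: eq_divide_eq mult_ac)
    also have "\<dots> = Complex (u m) (- v m) / q * y
        + ((-1) ^ m * (-1) ^ m) * (Complex (u m) (v m) / q * cnj y)"
      by (simp add: sgn add_divide_distrib)
    also have "\<dots> = noise_mode u v (int m) * y + noise_mode u v (- int m) * ((-1) ^ m * cnj y)"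
      unfolding modes by (simp only: mult_ac)
    finally have "q * w = noise_mode u v (int m) * y + noise_mode u v (- int m) * ((-1) ^ m * cnj y)" .
    then show ?thesis unfolding neg q_def w_def y_def .
  qed
  have zero: "noise_mode u v 0 = of_real (u 0)" by (simp add: noise_mode_def)
  show ?thesis
    unfolding sum_symmetric_int sum_distrib_left zero
    by (intro arg_cong2[where f="(+)"] sum.cong refl term_eq)
qed

lemma noise_mode_bound:
  assumes "nat \<bar>m\<bar> \<le> l" and u: "\<And>j. j \<le> l \<Longrightarrow> (u j)\<^sup>2 \<le> b" and v: "\<And>j. 1 \<le> j \<Longrightarrow> j \<le> l \<Longrightarrow> (v j)\<^sup>2 \<le> b"
  shows "(cmod (noise_mode u v m))\<^sup>2 \<le> b"
proof (cases "m = 0")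
  case True
  then show ?thesis using u[of 0] by (simp add: noise_mode_def)
next
  case False
  define j where "j = nat \<bar>m\<bar>"
  have "\<exists>w. (w = v j \<or> w = - v j) \<and> cmod (noise_mode u v m) = cmod (Complex (u j) w) / sqrt 2"
    using False by (auto simp: noise_mode_def norm_divide norm_mult norm_power j_def)
  then obtain w where "w\<^sup>2 = (v j)\<^sup>2" "cmod (noise_mode u v m) = cmod (Complex (u j) w) / sqrt 2"
    by (metis power2_minus)
  moreover have "(cmod (Complex (u j) w))\<^sup>2 = (u j)\<^sup>2 + w\<^sup>2" by (simp add: cmod_power2)
  ultimately have "(cmod (noise_mode u v m))\<^sup>2 = ((u j)\<^sup>2 + (v j)\<^sup>2) / 2"
    by (simp only: power_divide) simp
  also have "\<dots> \<le> b"
  proof -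
    have "1 \<le> j" "j \<le> l" using assms(1) False by (auto simp: j_def)
    then show ?thesis using u[of j] v[of j] by simp
  qed
  finally show ?thesis .
qed

lemma L2_tail_bound:
  assumes c: "\<And>l m. \<kappa> < l \<Longrightarrow> nat \<bar>m\<bar> \<le> l \<Longrightarrow> (cmod (c l m))\<^sup>2 \<le> g l" and "\<kappa> \<le> N"
  shows "(L2_norm (\<lambda>x. (\<Sum>l\<le>\<kappa>. \<Sum>m\<in>{- int l..int l}. c l m * sph_harm l m x)
      - (\<Sum>l\<le>N. \<Sum>m\<in>{- int l..int l}. c l m * sph_harm l m x)))\<^sup>2
    \<le> (\<Sum>l\<in>{\<kappa><..N}. (2 * real l + 1) * g l)"
proof -
  define S where "S = Sigma {\<kappa><..N} (\<lambda>l. {- int l..int l})"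
  have S: "finite S" "\<And>l m. (l, m) \<in> S \<Longrightarrow> nat \<bar>m\<bar> \<le> l" by (auto simp: S_def)
  have split: "{..N} = {..\<kappa>} \<union> {\<kappa><..N}" "{..\<kappa>} \<inter> {\<kappa><..N} = {}" using \<open>\<kappa> \<le> N\<close> by auto
  have "(\<Sum>l\<le>\<kappa>. \<Sum>m\<in>{- int l..int l}. c l m * sph_harm l m x)
      - (\<Sum>l\<le>N. \<Sum>m\<in>{- int l..int l}. c l m * sph_harm l m x)
      = (\<Sum>(l, m)\<in>S. (- c l m) * sph_harm l m x)" for x
    unfolding split(1) S_def
    by (subst sum.union_disjoint) (auto simp: sum.Sigma[symmetric] sum_negf)
  then have "(L2_norm (\<lambda>x. (\<Sum>l\<le>\<kappa>. \<Sum>m\<in>{- int l..int l}. c l m * sph_harm l m x)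
      - (\<Sum>l\<le>N. \<Sum>m\<in>{- int l..int l}. c l m * sph_harm l m x)))\<^sup>2 = (\<Sum>(l, m)\<in>S. (cmod (- c l m))\<^sup>2)"
    by (simp only: L2_norm_sq_sph_sum[OF S, of "\<lambda>l m. - c l m"])
  also have "\<dots> = (\<Sum>l\<in>{\<kappa><..N}. \<Sum>m\<in>{- int l..int l}. (cmod (c l m))\<^sup>2)"
    unfolding S_def by (simp add: sum.Sigma[symmetric])
  also have "\<dots> \<le> (\<Sum>l\<in>{\<kappa><..N}. \<Sum>m\<in>{- int l..int l}. g l)"
    using c by (intro sum_mono) auto
  also have "\<dots> = (\<Sum>l\<in>{\<kappa><..N}. (2 * real l + 1) * g l)"
    by (intro sum.cong refl) simp
  finally show ?thesis .
qed

definition heat_mode ::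
    "'w measure \<Rightarrow> (nat \<Rightarrow> real) \<Rightarrow> (nat \<Rightarrow> nat \<Rightarrow> nat \<Rightarrow> real \<Rightarrow> 'w \<Rightarrow> real)
       \<Rightarrow> ('w \<Rightarrow> real ^ 3 \<Rightarrow> complex) \<Rightarrow> real \<Rightarrow> 'w \<Rightarrow> nat \<Rightarrow> int \<Rightarrow> complex" where
  "heat_mode M A B X0 t \<omega> l m =
     of_real (exp (- eigval l * t)) * L2_inner (X0 \<omega>) (sph_harm l m)
     + of_real (sqrt (A l)) *
       noise_mode (\<lambda>j. noise_coeff M B 1 l j 0 t \<omega>) (\<lambda>j. noise_coeff M B 2 l j 0 t \<omega>) m"

lemma heat_component_expansion:
  "heat_component M A B X0 l t \<omega> x = (\<Sum>m\<in>{- int l..int l}. heat_mode M A B X0 t \<omega> l m * sph_harm l m x)"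
  unfolding heat_component_def heat_noise_def initial_part_def heat_mode_def
    noise_mode_expansion[of "\<lambda>j. noise_coeff M B 1 l j 0 t \<omega>" l x "\<lambda>j. noise_coeff M B 2 l j 0 t \<omega>"]
  by (simp only: sum_distrib_left sum.distrib distrib_right mult.assoc)

lemma cmod_add_sq_le: "(cmod (a + b))\<^sup>2 \<le> 2 * (cmod a)\<^sup>2 + 2 * (cmod b)\<^sup>2"
  using cmod_diff_sq_le[of a "- b"] by simp

lemma heat_mode_bound:
  assumes X0: "X0 \<omega> \<in> L2_sphere" and A: "0 \<le> A l" and m: "nat \<bar>m\<bar> \<le> l"
    and b: "\<And>i j. (i, l, j) \<in> noise_indices \<Longrightarrow> (noise_coeff M B i l j 0 t \<omega>)\<^sup>2 \<le> b"
  shows "(cmod (heat_mode M A B X0 t \<omega> l m))\<^sup>2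
    \<le> 2 * (exp (- 2 * (eigval l * t)) * (((L2_norm (X0 \<omega>))\<^sup>2 + 1) / 2)\<^sup>2) + 2 * (A l * b)"
proof -
  let ?n = "noise_mode (\<lambda>j. noise_coeff M B 1 l j 0 t \<omega>) (\<lambda>j. noise_coeff M B 2 l j 0 t \<omega>) m"
  have "(cmod ?n)\<^sup>2 \<le> b"
    using m by (rule noise_mode_bound) (auto intro!: b simp: noise_indices_def)
  then have 1: "(cmod (of_real (sqrt (A l)) * ?n))\<^sup>2 \<le> A l * b"
    using A by (simp add: norm_mult power_mult_distrib mult_left_mono)
  have "(cmod (L2_inner (X0 \<omega>) (sph_harm l m)))\<^sup>2 \<le> (((L2_norm (X0 \<omega>))\<^sup>2 + 1) / 2)\<^sup>2"
    by (intro power_mono L2_inner_sph_harm_le X0 m) simp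
  moreover have "(exp (- eigval l * t))\<^sup>2 = exp (- 2 * (eigval l * t))"
    by (simp flip: exp_double)
  ultimately have 2: "(cmod (of_real (exp (- eigval l * t)) * L2_inner (X0 \<omega>) (sph_harm l m)))\<^sup>2
      \<le> exp (- 2 * (eigval l * t)) * (((L2_norm (X0 \<omega>))\<^sup>2 + 1) / 2)\<^sup>2"
    by (simp add: norm_mult power_mult_distrib mult_left_mono)
  show ?thesis
    unfolding heat_mode_def by (rule order_trans[OF cmod_add_sq_le]) (use 1 2 in linarith)
qed

lemma eigval_nonneg: "0 \<le> eigval l"
  by (simp add: eigval_def)

lemma (in brownian) ou_eq_wiener_integral:
  "ou (eigval l) a b = wiener_integral M B a b (\<lambda>s. exp (- eigval l * (b - s)))"
  unfolding ou_def exp_kernel_def[abs_def] ..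

lemma Q_wiener_brownian:
  assumes "prob_space M" "isotropic_Q_wiener M T A B" "(i, l, m) \<in> noise_indices"
  shows "brownian M T (B i l m)"
  using assms by (auto simp: isotropic_Q_wiener_def brownian_def brownian_axioms_def)

lemma noise_coeff_eq_ou:
  assumes "brownian M T (B i l m)"
  shows "noise_coeff M B i l m a b = brownian.ou M (B i l m) (eigval l) a b"
  unfolding noise_coeff_def brownian.ou_eq_wiener_integral[OF assms] ..

text \<open>
  A step of the recursion is the splitting of the stochastic convolution at a grid point.  The
  identities hold almost surely, and there are only countably many of them.
\<close>

lemma heat_recursion_eq_component:
  assumes M: "prob_space M" and W: "isotropic_Q_wiener M T A B" and t: "t \<le> T"
    and \<tau>: "time_partition \<tau> n 0 t"
  shows "AE \<omega> in M. \<forall>l x. heat_recursion M A B X0 l \<tau> n \<omega> x = heat_component M A B X0 l t \<omega> x"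
proof -
  interpret prob_space M by (rule M)
  have bounds: "0 \<le> \<tau> k" "\<tau> k \<le> T" if "k \<le> n" for k
    using time_partition_bounds[OF \<tau> that] t by auto
  have zero: "AE \<omega> in M. \<forall>q\<in>noise_indices. case q of (i, l, m) \<Rightarrow> noise_coeff M B i l m 0 0 \<omega> = 0"
  proof (subst AE_ball_countable)
    show "\<forall>q\<in>noise_indices. AE \<omega> in M. case q of (i, l, m) \<Rightarrow> noise_coeff M B i l m 0 0 \<omega> = 0"
    proof clarify
      fix i l m assume q: "(i, l, m) \<in> noise_indices"
      note bm = Q_wiener_brownian[OF M W q]
      show "AE \<omega> in M. noise_coeff M B i l m 0 0 \<omega> = 0"
        unfolding noise_coeff_eq_ou[where B=B, OF bm]
        using bounds[of 0] by (intro brownian.ou_degenerate[OF bm] eigval_nonneg) auto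
    qed
  qed simp
  have split: "AE \<omega> in M. \<forall>q\<in>noise_indices. \<forall>k\<in>{..<n}. case q of (i, l, m) \<Rightarrow>
      noise_coeff M B i l m 0 (\<tau> (Suc k)) \<omega> = exp (- eigval l * (\<tau> (Suc k) - \<tau> k)) * noise_coeff M B i l m 0 (\<tau> k) \<omega>
        + noise_coeff M B i l m (\<tau> k) (\<tau> (Suc k)) \<omega>"
  proof (subst AE_ball_countable, simp, intro ballI, subst AE_ball_countable, simp, intro ballI, clarify)
    fix i l m k assume q: "(i, l, m) \<in> noise_indices" and k: "k < n"
    note bm = Q_wiener_brownian[OF M W q]
    show "AE \<omega> in M. noise_coeff M B i l m 0 (\<tau> (Suc k)) \<omega>
        = exp (- eigval l * (\<tau> (Suc k) - \<tau> k)) * noise_coeff M B i l m 0 (\<tau> k) \<omega>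
        + noise_coeff M B i l m (\<tau> k) (\<tau> (Suc k)) \<omega>"
      unfolding noise_coeff_eq_ou[where B=B, OF bm]
      using bounds[of k] bounds[of "Suc k"] time_partition_mono[OF \<tau>, of k "Suc k"] k
      by (intro brownian.ou_split[OF bm] eigval_nonneg) auto
  qed
  from zero split show ?thesis
  proof eventually_elim
    case (elim \<omega>)
    have "heat_recursion M A B X0 l \<tau> k \<omega> x = heat_component M A B X0 l (\<tau> k) \<omega> x" if "k \<le> n" for l x k
      using that
    proof (induction k)
      case 0
      have "noise_coeff M B i l m 0 0 \<omega> = 0" if "(i, l, m) \<in> noise_indices" for i m
        using elim(1) that by blast
      then have "heat_noise M A B l 0 0 \<omega> x = 0"
        by (simp add: heat_noise_def noise_indices_def)
      then show ?case using \<tau> by (simp add: heat_component_def time_partition_def)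
    next
      case (Suc k)
      define r where "r = exp (- eigval l * (\<tau> (Suc k) - \<tau> k))"
      have c: "noise_coeff M B i l m 0 (\<tau> (Suc k)) \<omega> = r * noise_coeff M B i l m 0 (\<tau> k) \<omega>
          + noise_coeff M B i l m (\<tau> k) (\<tau> (Suc k)) \<omega>" if "(i, l, m) \<in> noise_indices" for i m
        using elim(2) that Suc.prems unfolding r_def by fastforce
      have c1: "noise_coeff M B 1 l m 0 (\<tau> (Suc k)) \<omega> = r * noise_coeff M B 1 l m 0 (\<tau> k) \<omega>
          + noise_coeff M B 1 l m (\<tau> k) (\<tau> (Suc k)) \<omega>" if "m \<le> l" for m
        using that by (intro c) (simp add: noise_indices_def)
      have c2: "noise_coeff M B 2 l m 0 (\<tau> (Suc k)) \<omega> = r * noise_coeff M B 2 l m 0 (\<tau> k) \<omega>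
          + noise_coeff M B 2 l m (\<tau> k) (\<tau> (Suc k)) \<omega>" if "m \<in> {1..l}" for m
        using that by (intro c) (simp add: noise_indices_def)
      let ?s = "\<lambda>a b m. of_real (noise_coeff M B 1 l m a b \<omega> * Re (sph_harm l (int m) x)
                             + noise_coeff M B 2 l m a b \<omega> * Im (sph_harm l (int m) x)) :: complex"
      have "(\<Sum>m=1..l. ?s 0 (\<tau> (Suc k)) m) = (\<Sum>m=1..l. of_real r * ?s 0 (\<tau> k) m + ?s (\<tau> k) (\<tau> (Suc k)) m)"
      proof (intro sum.cong refl)
        fix m assume m: "m \<in> {1..l}"
        then have "m \<le> l" by simp
        show "?s 0 (\<tau> (Suc k)) m = of_real r * ?s 0 (\<tau> k) m + ?s (\<tau> k) (\<tau> (Suc k)) m"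
          unfolding c1[OF \<open>m \<le> l\<close>] c2[OF m] by (simp add: algebra_simps)
      qed
      then have sum_eq: "(\<Sum>m=1..l. ?s 0 (\<tau> (Suc k)) m)
          = of_real r * (\<Sum>m=1..l. ?s 0 (\<tau> k) m) + (\<Sum>m=1..l. ?s (\<tau> k) (\<tau> (Suc k)) m)"
        by (simp only: sum.distrib sum_distrib_left)
      have noise: "heat_noise M A B l 0 (\<tau> (Suc k)) \<omega> x
          = of_real r * heat_noise M A B l 0 (\<tau> k) \<omega> x + heat_noise M A B l (\<tau> k) (\<tau> (Suc k)) \<omega> x"
        unfolding heat_noise_def sum_eq c1[OF le0] by (simp add: algebra_simps)
      have "exp (- eigval l * \<tau> (Suc k)) = r * exp (- eigval l * \<tau> k)"
        by (simp add: r_def algebra_simps flip: exp_add)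
      note decay = this
      have IH: "heat_recursion M A B X0 l \<tau> k \<omega> x = heat_component M A B X0 l (\<tau> k) \<omega> x"
        using Suc by simp
      have "heat_recursion M A B X0 l \<tau> (Suc k) \<omega> x
          = of_real r * heat_component M A B X0 l (\<tau> k) \<omega> x + heat_noise M A B l (\<tau> k) (\<tau> (Suc k)) \<omega> x"
        by (simp only: heat_recursion.simps r_def IH)
      also have "\<dots> = heat_component M A B X0 l (\<tau> (Suc k)) \<omega> x"
        unfolding heat_component_def noise decay by (simp add: algebra_simps)
      finally show ?case .
    qed
    from this[of n] show ?case using \<tau> by (simp add: time_partition_def)
  qed
qed

section \<open>A bound for all modes of the noise\<close>

lemma exp_le_powr:
  assumes "0 < \<delta>"
  obtains c where "0 \<le> c" "\<And>l::nat. 1 \<le> l \<Longrightarrow> exp (- 2 * (\<delta> * real l)) \<le> c * real l powr (- q)"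
proof -
  have "(\<lambda>l::nat. real l powr q * exp (- 2 * (\<delta> * real l))) \<longlonglongrightarrow> 0"
    using assms by real_asymp
  then have "Bseq (\<lambda>l::nat. real l powr q * exp (- 2 * (\<delta> * real l)))"
    by (intro convergent_imp_Bseq convergentI)
  then obtain c where c: "0 < c" "\<And>l::nat. norm (real l powr q * exp (- 2 * (\<delta> * real l))) \<le> c"
    unfolding Bseq_def by blast
  have "exp (- 2 * (\<delta> * real l)) \<le> c * real l powr (- q)" if "1 \<le> l" for l :: nat
  proof -
    have "exp (- 2 * (\<delta> * real l)) = (real l powr q * exp (- 2 * (\<delta> * real l))) * real l powr (- q)"
      using that by (simp add: powr_minus)
    also have "\<dots> \<le> c * real l powr (- q)"
      using c(2)[of l] by (intro mult_right_mono) auto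
    finally show ?thesis .
  qed
  then show thesis using that[of c] c(1) by simp
qed

lemma eigval_ge_sq: "(real l)\<^sup>2 \<le> eigval l"
  by (simp add: eigval_def power2_eq_square algebra_simps)

lemma finite_noise_modes: "finite {(i, m). (i, l, m) \<in> noise_indices}"
  and card_noise_modes: "card {(i, m). (i, l, m) \<in> noise_indices} \<le> 2 * Suc l"
proof -
  have sub: "{(i, m). (i, l, m) \<in> noise_indices} \<subseteq> {1, 2} \<times> {..l}"
    by (auto simp: noise_indices_def)
  show "finite {(i, m). (i, l, m) \<in> noise_indices}"
    by (rule finite_subset[OF sub]) simp
  have "card {(i, m). (i, l, m) \<in> noise_indices} \<le> card ({1, 2 :: nat} \<times> {..l})"
    by (rule card_mono[OF _ sub]) simp
  then show "card {(i, m). (i, l, m) \<in> noise_indices} \<le> 2 * Suc l"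
    by (simp add: card_cartesian_product)
qed

text \<open>
  Weighted with \<open>\<nu> ^ (p - 5)\<close>, where \<open>\<nu> = l (l + 1)\<close>, the modulus of a mode has an expectation of the
  order of \<open>\<nu>\<^sup>-\<^sup>2\<close>.  With at most \<open>2 (l + 1)\<close> modes in degree \<open>l\<close> the sum over all modes is integrable,
  hence almost surely finite, and it dominates every single term.  The exponent \<open>- 2 + 10 / p\<close> is
  that of the \<open>p\<close>-th root of \<open>\<nu> ^ (5 - p)\<close>.
\<close>

lemma noise_envelope:
  assumes M: "prob_space M" and T: "0 < T" and W: "isotropic_Q_wiener M T A B" and p: "5 \<le> p"
  shows "\<exists>G\<in>borel_measurable M. (\<forall>\<omega>. 0 \<le> G \<omega>) \<and> (\<forall>t\<in>{0..T}. AE \<omega> in M. \<forall>q\<in>noise_indices.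
    case q of (i, l, m) \<Rightarrow> 1 \<le> l \<longrightarrow> (noise_coeff M B i l m 0 t \<omega>)\<^sup>2 \<le> G \<omega> * real l powr (- 2 + 10 / real p))"
proof -
  interpret prob_space M by (rule M)
  define Q where "Q = (\<lambda>l. {(i, m). (i, l, m) \<in> noise_indices})"
  define V where "V = (\<lambda>q l. brownian.ou_modulus M T (B (fst q) l (snd q)) (eigval l) p)"
  define H where "H = (\<lambda>\<omega>. \<Sum>l. \<Sum>q\<in>Q (Suc l). ennreal (eigval (Suc l) ^ (p - 5)) * V q (Suc l) \<omega>)"
  define K where "K = 2 * ou_const p * T ^ 3"
  have "0 < p" "3 \<le> p" "0 \<le> K" using p T ou_const_pos[of p] by (auto simp: K_def)
  have pos: "0 < eigval (Suc l)" for l by (simp add: eigval_def)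
  have bm: "brownian M T (B i l m)" if "(i, m) \<in> Q l" for i l m
    using that by (intro Q_wiener_brownian[OF M W]) (simp add: Q_def)
  have V_meas: "V q l \<in> borel_measurable M" if "q \<in> Q l" for q l
    unfolding V_def using that
    by (intro brownian.ou_modulus_measurable[OF bm T eigval_nonneg]) simp
  have term_meas: "(\<lambda>\<omega>. ennreal (eigval (Suc l) ^ (p - 5)) * V q (Suc l) \<omega>) \<in> borel_measurable M"
    if "q \<in> Q (Suc l)" for q l
    using V_meas[OF that] by simp
  have H_meas [measurable]: "H \<in> borel_measurable M"
    unfolding H_def by (intro borel_measurable_suminf_order borel_measurable_sum term_meas)
  have term_int: "(\<integral>\<^sup>+\<omega>. ennreal (eigval (Suc l) ^ (p - 5)) * V q (Suc l) \<omega> \<partial>M) \<le> ennreal (K / eigval (Suc l) ^ 2)"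
    if q: "q \<in> Q (Suc l)" for q l
  proof -
    obtain i m where im: "q = (i, m)" by (cases q)
    have "(\<integral>\<^sup>+\<omega>. ennreal (eigval (Suc l) ^ (p - 5)) * V q (Suc l) \<omega> \<partial>M)
        = ennreal (eigval (Suc l) ^ (p - 5)) * (\<integral>\<^sup>+\<omega>. V q (Suc l) \<omega> \<partial>M)"
      by (rule nn_integral_cmult[OF V_meas[OF q]])
    also have "\<dots> \<le> ennreal (eigval (Suc l) ^ (p - 5)) * ennreal (K / eigval (Suc l) ^ (p - 3))"
      using brownian.ou_modulus_integral[OF bm T pos \<open>3 \<le> p\<close>, of i m "Suc l"] q
      by (intro mult_left_mono) (auto simp: V_def K_def im)
    also have "\<dots> = ennreal (eigval (Suc l) ^ (p - 5) * (K / eigval (Suc l) ^ (p - 3)))"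
      using pos[of l] \<open>0 \<le> K\<close> by (intro ennreal_mult[symmetric]) auto
    also have "eigval (Suc l) ^ (p - 5) * (K / eigval (Suc l) ^ (p - 3)) = K / eigval (Suc l) ^ 2"
    proof -
      have "p - 3 = (p - 5) + 2" using p by simp
      then have "eigval (Suc l) ^ (p - 3) = eigval (Suc l) ^ (p - 5) * eigval (Suc l) ^ 2"
        by (simp only: power_add)
      then show ?thesis using pos[of l] by simp
    qed
    finally show ?thesis .
  qed
  have level: "(\<Sum>q\<in>Q (Suc l). ennreal (K / eigval (Suc l) ^ 2)) \<le> ennreal (4 * K * inverse (real (Suc l) ^ 2))" for l
  proof -
    define x where "x = real (Suc l)"
    have x: "1 \<le> x" by (simp add: x_def)
    have "(\<Sum>q\<in>Q (Suc l). ennreal (K / eigval (Suc l) ^ 2)) = ennreal (\<Sum>q\<in>Q (Suc l). K / eigval (Suc l) ^ 2)"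
      using \<open>0 \<le> K\<close> by (intro sum_ennreal) auto
    also have "\<dots> = ennreal (real (card (Q (Suc l))) * (K / eigval (Suc l) ^ 2))" by simp
    also have "\<dots> \<le> ennreal (4 * K * inverse (x ^ 2))"
    proof (rule ennreal_leI)
      have "real (card (Q (Suc l))) \<le> real (2 * Suc (Suc l))"
        unfolding Q_def of_nat_le_iff by (rule card_noise_modes)
      also have "\<dots> = 2 * (x + 1)" by (simp add: x_def)
      also have "\<dots> \<le> 4 * x\<^sup>2" using x power_increasing[of 1 2 x] by simp
      finally have c: "real (card (Q (Suc l))) \<le> 4 * x\<^sup>2" .
      have "x\<^sup>2 \<le> eigval (Suc l)" unfolding x_def by (rule eigval_ge_sq)
      then have "(x\<^sup>2)\<^sup>2 \<le> eigval (Suc l) ^ 2" by (intro power_mono) auto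
      then have "K / eigval (Suc l) ^ 2 \<le> K / (x\<^sup>2)\<^sup>2"
        using x \<open>0 \<le> K\<close> pos[of l] by (intro divide_left_mono) (auto intro!: mult_pos_pos)
      then have "real (card (Q (Suc l))) * (K / eigval (Suc l) ^ 2) \<le> 4 * x\<^sup>2 * (K / (x\<^sup>2)\<^sup>2)"
        using c \<open>0 \<le> K\<close> by (intro mult_mono) auto
      also have "\<dots> = 4 * K * inverse (x ^ 2)"
        using x by (simp add: field_simps power2_eq_square)
      finally show "real (card (Q (Suc l))) * (K / eigval (Suc l) ^ 2) \<le> 4 * K * inverse (x ^ 2)" .
    qed
    finally show ?thesis unfolding x_def .
  qed
  have "(\<integral>\<^sup>+\<omega>. H \<omega> \<partial>M)
      = (\<Sum>l. \<integral>\<^sup>+\<omega>. (\<Sum>q\<in>Q (Suc l). ennreal (eigval (Suc l) ^ (p - 5)) * V q (Suc l) \<omega>) \<partial>M)"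
    unfolding H_def by (intro nn_integral_suminf borel_measurable_sum term_meas)
  also have "\<dots> = (\<Sum>l. \<Sum>q\<in>Q (Suc l). \<integral>\<^sup>+\<omega>. ennreal (eigval (Suc l) ^ (p - 5)) * V q (Suc l) \<omega> \<partial>M)"
    by (intro suminf_cong nn_integral_sum term_meas)
  also have "\<dots> \<le> (\<Sum>l. ennreal (4 * K * inverse (real (Suc l) ^ 2)))"
    by (intro suminf_le order_trans[OF sum_mono level] term_int) auto
  also have "\<dots> = ennreal (\<Sum>l. 4 * K * inverse (real (Suc l) ^ 2))"
  proof (rule suminf_ennreal2)
    show "summable (\<lambda>l. 4 * K * inverse (real (Suc l) ^ 2))"
      using inverse_power_summable[of 2, where 'a=real]
      by (intro summable_mult) (subst summable_Suc_iff[of "\<lambda>l. inverse (real l ^ 2)"], simp)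
  qed (use \<open>0 \<le> K\<close> in auto)
  finally have "(\<integral>\<^sup>+\<omega>. H \<omega> \<partial>M) < \<infinity>"
    by (rule le_less_trans) simp
  then have H_fin: "AE \<omega> in M. H \<omega> \<noteq> \<infinity>"
    by (intro nn_integral_PInf_AE) auto
  define G where "G = (\<lambda>\<omega>. root p (chain_const p * enn2real (H \<omega>)))"
  have root_meas: "root p \<in> borel_measurable borel"
    by (intro borel_measurable_continuous_onI continuous_on_real_root continuous_on_id)
  have G_meas: "G \<in> borel_measurable M"
    unfolding G_def by (rule measurable_compose[OF _ root_meas]) measurable
  have cc: "0 < chain_const p" using chain_const_pos \<open>0 < p\<close> by simp
  have G_nonneg: "0 \<le> G \<omega>" for \<omega>
    using cc \<open>0 < p\<close> by (simp add: G_def)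
  have bound: "AE \<omega> in M. \<forall>q\<in>noise_indices. case q of (i, l, m) \<Rightarrow>
      1 \<le> l \<longrightarrow> (noise_coeff M B i l m 0 t \<omega>)\<^sup>2 \<le> G \<omega> * real l powr (- 2 + 10 / real p)"
    if t: "t \<in> {0..T}" for t
  proof -
    have "AE \<omega> in M. \<forall>q\<in>noise_indices. case q of (i, l, m) \<Rightarrow> 1 \<le> l \<longrightarrow> V (i, m) l \<omega> < \<infinity> \<longrightarrow>
        noise_coeff M B i l m 0 t \<omega> ^ (2 * p) \<le> chain_const p * enn2real (V (i, m) l \<omega>)"
    proof (subst AE_ball_countable, simp, intro ballI, clarify)
      fix i l m assume q: "(i, l, m) \<in> noise_indices"
      then have bm': "brownian M T (B i l m)" by (intro bm) (simp add: Q_def)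
      show "AE \<omega> in M. 1 \<le> l \<longrightarrow> V (i, m) l \<omega> < \<infinity> \<longrightarrow>
          noise_coeff M B i l m 0 t \<omega> ^ (2 * p) \<le> chain_const p * enn2real (V (i, m) l \<omega>)"
      proof (cases l)
        case (Suc l')
        then have "0 < eigval l" using pos by simp
        have "AE \<omega> in M. V (i, m) l \<omega> < \<infinity> \<longrightarrow>
            noise_coeff M B i l m 0 t \<omega> ^ (2 * p) \<le> chain_const p * enn2real (V (i, m) l \<omega>)"
          unfolding noise_coeff_eq_ou[where B=B, OF bm'] V_def fst_conv snd_conv
          using t by (intro brownian.ou_le_modulus[OF bm' T \<open>0 < eigval l\<close>] \<open>0 < p\<close>) auto
        then show ?thesis by eventually_elim blast
      qed simp
    qed
    with H_fin show ?thesis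
    proof eventually_elim
      case (elim \<omega>)
      show ?case
      proof clarify
        fix i l m assume q: "(i, l, m) \<in> noise_indices" and l: "1 \<le> l"
        define z where "z = noise_coeff M B i l m 0 t \<omega>"
        define h where "h = enn2real (H \<omega>)"
        obtain l' where l': "l = Suc l'" using l by (cases l) auto
        have q': "(i, m) \<in> Q l" using q by (simp add: Q_def)
        define e where "e = eigval l ^ (p - 5)"
        have "0 < e" using pos[of l'] by (simp add: e_def l')
        have "ennreal e * V (i, m) l \<omega> \<le> (\<Sum>q\<in>Q l. ennreal e * V q l \<omega>)"
          using q' finite_noise_modes[of l] by (intro member_le_sum) (auto simp: Q_def)
        also have "\<dots> \<le> H \<omega>"
          unfolding H_def e_def l'
          using sum_le_suminf[of "\<lambda>l. \<Sum>q\<in>Q (Suc l). ennreal (eigval (Suc l) ^ (p - 5)) * V q (Suc l) \<omega>" "{l'}"]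
          by simp
        finally have le: "ennreal e * V (i, m) l \<omega> \<le> H \<omega>" .
        have fin: "V (i, m) l \<omega> < \<infinity>"
        proof (rule ccontr)
          assume "\<not> V (i, m) l \<omega> < \<infinity>"
          then have "V (i, m) l \<omega> = \<top>" by (simp add: less_top[symmetric])
          then show False using le elim(1) \<open>0 < e\<close> by (simp add: ennreal_mult_top top_unique)
        qed
        have "e * enn2real (V (i, m) l \<omega>) = enn2real (ennreal e * V (i, m) l \<omega>)"
          using \<open>0 < e\<close> by (simp add: enn2real_mult)
        also have "\<dots> \<le> h"
          unfolding h_def by (rule enn2real_mono[OF le]) (use elim(1) in \<open>simp add: less_top\<close>)
        finally have V_le: "enn2real (V (i, m) l \<omega>) \<le> h / e"
          using \<open>0 < e\<close> by (simp add: field_simps)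
        have "0 \<le> h" by (simp add: h_def)
        have "z ^ (2 * p) \<le> chain_const p * enn2real (V (i, m) l \<omega>)"
          using elim(2) q l fin unfolding z_def by blast
        also have "\<dots> \<le> chain_const p * (h / e)"
          using V_le cc by (intro mult_left_mono) auto
        also have "\<dots> \<le> chain_const p * (h / ((real l)\<^sup>2) ^ (p - 5))"
        proof -
          have "((real l)\<^sup>2) ^ (p - 5) \<le> e"
            unfolding e_def by (intro power_mono eigval_ge_sq) simp
          then show ?thesis
            using \<open>0 < e\<close> l \<open>0 \<le> h\<close> cc by (intro mult_left_mono divide_left_mono) auto
        qed
        finally have "(z\<^sup>2) ^ p \<le> (chain_const p * h) * (1 / ((real l)\<^sup>2) ^ (p - 5))"
          by (simp add: power_mult)
        then have "root p ((z\<^sup>2) ^ p) \<le> root p ((chain_const p * h) * (1 / ((real l)\<^sup>2) ^ (p - 5)))"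
          using \<open>0 < p\<close> by simp
        then have "z\<^sup>2 \<le> G \<omega> * root p (1 / ((real l)\<^sup>2) ^ (p - 5))"
          unfolding real_root_power_cancel[OF \<open>0 < p\<close> zero_le_power2]
            real_root_mult[of p "chain_const p * h"] by (simp only: G_def h_def)
        also have "root p (1 / ((real l)\<^sup>2) ^ (p - 5)) = real l powr (- 2 + 10 / real p)"
        proof -
          have "1 / ((real l)\<^sup>2) ^ (p - 5) = real l powr (- (2 * (real p - 5)))"
          proof -
            have "((real l)\<^sup>2) ^ (p - 5) = real l ^ (2 * (p - 5))" by (rule power_mult[symmetric])
            also have "\<dots> = real l powr real (2 * (p - 5))" using l by (intro powr_realpow[symmetric]) simp
            also have "real (2 * (p - 5)) = 2 * (real p - 5)" using p by (simp add: of_nat_diff)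
            finally show ?thesis by (simp only: powr_minus_divide)
          qed
          then have "root p (1 / ((real l)\<^sup>2) ^ (p - 5)) = (real l powr (- (2 * (real p - 5)))) powr (1 / real p)"
            using root_powr_inverse[of p "real l powr (- (2 * (real p - 5)))"] \<open>0 < p\<close> l by (simp only:) simp
          also have "\<dots> = real l powr (- 2 + 10 / real p)"
          proof -
            have "- (2 * (real p - 5)) * (1 / real p) = - 2 + 10 / real p" using \<open>0 < p\<close> by (simp add: field_simps)
            then show ?thesis by (simp only: powr_powr)
          qed
          finally show ?thesis .
        qed
        finally show "(noise_coeff M B i l m 0 t \<omega>)\<^sup>2 \<le> G \<omega> * real l powr (- 2 + 10 / real p)"
          unfolding z_def .
      qed
    qed
  qed
  show ?thesis using G_meas G_nonneg bound by blast
qed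

section \<open>Tail sums and rates\<close>

text \<open>
  The noise contributes the power \<open>1 - \<alpha> - 2 + 10 / p\<close> of \<open>l\<close>, which is split into the rate \<open>- \<gamma>\<close> and
  the summable \<open>- 1 - 1 / p\<close>; the decay of the initial value is only used to the same extent.
\<close>

lemma dominated_term:
  fixes l :: nat
  assumes l: "1 \<le> l" and e: "0 \<le> e" "e \<le> c * real l powr (- (\<gamma> + 2 + 1 / p))" "0 \<le> c" and R: "0 \<le> R"
    and a: "0 \<le> a" "a \<le> C * real l powr (- \<alpha>)" and G: "0 \<le> G" and \<gamma>: "\<gamma> = \<alpha> - 11 / p"
  shows "(2 * real l + 1) * (2 * (e * R) + 2 * (a * (G * real l powr (- 2 + 10 / p))))
    \<le> (6 * c * R + 6 * \<bar>C\<bar> * G) * (real l powr (- \<gamma>) * real l powr (- 1 - 1 / p))"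
proof -
  have l0: "0 < real l" using l by simp
  define w where "w = real l powr (- \<gamma>) * real l powr (- 1 - 1 / p)"
  have w: "real l * real l powr (- (\<gamma> + 2 + 1 / p)) = w"
    using l0 by (simp add: w_def powr_add[symmetric] powr_mult_base algebra_simps)
  have w': "real l * (real l powr (- \<alpha>) * real l powr (- 2 + 10 / p)) = w"
  proof -
    have "10 / p = 11 / p - 1 / p" by (simp add: diff_divide_distrib[symmetric])
    then have "1 + (- \<alpha> + (- 2 + 10 / p)) = - \<gamma> + (- 1 - 1 / p)" unfolding \<gamma> by linarith
    then show ?thesis
      using l0 by (simp only: w_def powr_add[symmetric] powr_mult_base less_imp_le)
  qed
  have "2 * (e * R) + 2 * (a * (G * real l powr (- 2 + 10 / p)))
      \<le> 2 * (c * real l powr (- (\<gamma> + 2 + 1 / p)) * R)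
        + 2 * ((\<bar>C\<bar> * real l powr (- \<alpha>)) * (G * real l powr (- 2 + 10 / p)))"
  proof -
    have "a \<le> \<bar>C\<bar> * real l powr (- \<alpha>)"
      using a(2) by (rule order_trans) (intro mult_right_mono, auto)
    then show ?thesis using e(2) R G by (intro add_mono mult_left_mono mult_right_mono) auto
  qed
  then have "(2 * real l + 1) * (2 * (e * R) + 2 * (a * (G * real l powr (- 2 + 10 / p))))
      \<le> (3 * real l) * (2 * (c * real l powr (- (\<gamma> + 2 + 1 / p)) * R)
        + 2 * ((\<bar>C\<bar> * real l powr (- \<alpha>)) * (G * real l powr (- 2 + 10 / p))))"
    using l e R a G by (intro mult_mono) auto
  also have "\<dots> = 6 * c * R * (real l * real l powr (- (\<gamma> + 2 + 1 / p)))
      + 6 * \<bar>C\<bar> * G * (real l * (real l powr (- \<alpha>) * real l powr (- 2 + 10 / p)))"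
    by (simp add: algebra_simps)
  also have "\<dots> = (6 * c * R + 6 * \<bar>C\<bar> * G) * w"
    unfolding w w' by (simp add: algebra_simps)
  finally show ?thesis unfolding w_def .
qed

lemma summable_powr_gt_1: "1 < s \<Longrightarrow> summable (\<lambda>l::nat. real l powr (- s))"
  by (subst summable_real_powr_iff) simp

lemma powr_tail_sum:
  assumes "1 \<le> \<kappa>" "0 \<le> \<gamma>" "1 < s"
  shows "(\<Sum>l\<in>{\<kappa><..N}. real l powr (- \<gamma>) * real l powr (- s))
    \<le> real \<kappa> powr (- \<gamma>) * (\<Sum>l. real l powr (- s))"
proof -
  have "(\<Sum>l\<in>{\<kappa><..N}. real l powr (- \<gamma>) * real l powr (- s))
      \<le> (\<Sum>l\<in>{\<kappa><..N}. real \<kappa> powr (- \<gamma>) * real l powr (- s))"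
    using assms by (intro sum_mono mult_right_mono powr_mono2') auto
  also have "\<dots> = real \<kappa> powr (- \<gamma>) * (\<Sum>l\<in>{\<kappa><..N}. real l powr (- s))"
    by (simp add: sum_distrib_left)
  also have "\<dots> \<le> real \<kappa> powr (- \<gamma>) * (\<Sum>l. real l powr (- s))"
    using summable_powr_gt_1[OF assms(3)] by (intro mult_left_mono sum_le_suminf) auto
  finally show ?thesis .
qed

text \<open>
  The error is the limit of the distances between partial sums, for which orthonormality is
  available.
\<close>

lemma L2_norm_diff_le_limit:
  assumes X: "X \<in> L2_sphere" and U: "\<And>N. U N \<in> L2_sphere"
    and lim: "(\<lambda>N. L2_norm (\<lambda>x. X x - U N x)) \<longlonglongrightarrow> 0"
    and bound: "\<And>N. \<kappa> \<le> N \<Longrightarrow> (L2_norm (\<lambda>x. U \<kappa> x - U N x))\<^sup>2 \<le> b"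
  shows "(L2_norm (\<lambda>x. X x - U \<kappa> x))\<^sup>2 \<le> 2 * b"
proof (rule LIMSEQ_le_const)
  show "(\<lambda>N. 2 * (L2_norm (\<lambda>x. X x - U N x))\<^sup>2 + 2 * b) \<longlonglongrightarrow> 2 * b"
    using tendsto_add[OF tendsto_mult[OF tendsto_const[of 2] tendsto_power[OF lim, of 2]] tendsto_const[of "2 * b"]]
    by simp
  show "\<exists>N0. \<forall>N\<ge>N0. (L2_norm (\<lambda>x. X x - U \<kappa> x))\<^sup>2 \<le> 2 * (L2_norm (\<lambda>x. X x - U N x))\<^sup>2 + 2 * b"
  proof (intro exI allI impI)
    fix N assume "\<kappa> \<le> N"
    have "(L2_norm (\<lambda>x. X x - U \<kappa> x))\<^sup>2 = (L2_norm (\<lambda>x. (X x - U N x) - (U \<kappa> x - U N x)))\<^sup>2"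
      by simp
    also have "\<dots> \<le> 2 * (L2_norm (\<lambda>x. X x - U N x))\<^sup>2 + 2 * (L2_norm (\<lambda>x. U \<kappa> x - U N x))\<^sup>2"
      by (intro L2_norm_sq_diff_le L2_sphere_diff X U)
    also have "\<dots> \<le> 2 * (L2_norm (\<lambda>x. X x - U N x))\<^sup>2 + 2 * b"
      using bound[OF \<open>\<kappa> \<le> N\<close>] by simp
    finally show "(L2_norm (\<lambda>x. X x - U \<kappa> x))\<^sup>2 \<le> 2 * (L2_norm (\<lambda>x. X x - U N x))\<^sup>2 + 2 * b" .
  qed
qed

lemma rate_from_threshold:
  fixes \<kappa> :: nat
  assumes y: "0 \<le> y" "y \<le> x * real \<kappa> powr (- \<gamma>)" "y = n\<^sup>2" and x: "0 \<le> x"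
    and \<kappa>: "1 \<le> \<kappa>" "x powr (1 / (\<gamma> - 2 * \<beta>)) \<le> real \<kappa>" and \<beta>: "2 * \<beta> < \<gamma>"
  shows "n \<le> real \<kappa> powr (- \<beta>)"
proof -
  have "(x powr (1 / (\<gamma> - 2 * \<beta>))) powr (\<gamma> - 2 * \<beta>) \<le> real \<kappa> powr (\<gamma> - 2 * \<beta>)"
    using \<kappa> \<beta> by (intro powr_mono2) auto
  then have "x \<le> real \<kappa> powr (\<gamma> - 2 * \<beta>)"
    using \<beta> x by (simp add: powr_powr)
  then have "y \<le> real \<kappa> powr (\<gamma> - 2 * \<beta>) * real \<kappa> powr (- \<gamma>)"
    by (intro order_trans[OF y(2)] mult_right_mono) auto
  also have "\<dots> = (real \<kappa> powr (- \<beta>))\<^sup>2"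
    using \<kappa> by (simp add: powr_add[symmetric] power2_eq_square)
  finally show ?thesis unfolding y(3) by (rule power2_le_imp_le) simp
qed

section \<open>Almost sure rate of convergence\<close>

lemma sph_harm_sum_L2_sphere:
  "(\<lambda>x. \<Sum>l\<le>N. \<Sum>m\<in>{- int l..int l}. c l m * sph_harm l m x) \<in> L2_sphere"
  by (intro L2_sphere_sum L2_sphere_mult sph_harm_L2_sphere)

theorem corollary7p3:
  fixes M :: "'w measure" and T :: real
    and A :: "nat \<Rightarrow> real" and B :: "nat \<Rightarrow> nat \<Rightarrow> nat \<Rightarrow> real \<Rightarrow> 'w \<Rightarrow> real"
    and X0 :: "'w \<Rightarrow> real ^ 3 \<Rightarrow> complex" and X :: "real \<Rightarrow> 'w \<Rightarrow> real ^ 3 \<Rightarrow> complex"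
    and l0 :: nat and \<alpha> C :: real
  assumes "prob_space M"
    and "0 < T"
    and "isotropic_Q_wiener M T A B"
    and "L2_random_field M X0"
    and "heat_solution M T A B X0 X"
    and "0 < \<alpha>"
    and "\<And>l. l0 < l \<Longrightarrow> A l \<le> C * real l powr (- \<alpha>)"
  shows "\<forall>\<beta> \<delta>. \<beta> < \<alpha> / 2 \<and> 0 < \<delta> \<and> \<delta> \<le> T \<longrightarrow>
    (\<exists>\<kappa>0 \<in> measurable M (count_space (UNIV :: nat set)).
      \<forall>t\<in>{\<delta>..T}. \<forall>n \<tau>. 1 \<le> n \<and> time_partition \<tau> n 0 t \<longrightarrow>
        (AE \<omega> in M. \<forall>\<kappa>\<ge>\<kappa>0 \<omega>.
           L2_norm (\<lambda>x. X t \<omega> x - heat_approx M A B X0 \<kappa> \<tau> n \<omega> x) \<le> real \<kappa> powr (- \<beta>)))"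
proof (intro allI impI, elim conjE)
  fix \<beta> \<delta> :: real
  assume \<beta>: "\<beta> < \<alpha> / 2" and \<delta>: "0 < \<delta>" "\<delta> \<le> T"
  note M = assms(1) and T = assms(2) and W = assms(3)
  interpret prob_space M by (rule M)
  \<comment> \<open>As \<open>\<beta>\<close> may be negative, \<open>\<gamma> \<ge> 0\<close> has to be enforced besides \<open>\<gamma> > 2 \<beta>\<close>.\<close>
  define s where "s = min \<alpha> (\<alpha> - 2 * \<beta>)"
  have "0 < s" using \<beta> assms(6) by (simp add: s_def)
  obtain p :: nat where p: "5 \<le> p" "11 / real p < s"
  proof
    define p where "p = max 5 (nat \<lceil>11 / s\<rceil> + 1)"
    show "5 \<le> p" by (simp add: p_def)
    have "11 / s < real (nat \<lceil>11 / s\<rceil> + 1)" by linarith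
    also have "\<dots> \<le> real p" unfolding p_def of_nat_le_iff by simp
    finally show "11 / real p < s"
      using \<open>0 < s\<close> by (simp add: p_def field_simps)
  qed
  define \<gamma> where "\<gamma> = \<alpha> - 11 / real p"
  have \<gamma>: "0 \<le> \<gamma>" "2 * \<beta> < \<gamma>" using p(2) by (auto simp: \<gamma>_def s_def)
  obtain c where c: "0 \<le> c"
    "\<And>l::nat. 1 \<le> l \<Longrightarrow> exp (- 2 * (\<delta> * real l)) \<le> c * real l powr (- (\<gamma> + 2 + 1 / real p))"
    using exp_le_powr[OF \<delta>(1)] by blast
  obtain G where G_meas [measurable]: "G \<in> borel_measurable M" and G_nonneg: "\<And>\<omega>. 0 \<le> G \<omega>"
    and G: "\<And>t. t \<in> {0..T} \<Longrightarrow> AE \<omega> in M. \<forall>q\<in>noise_indices. case q of (i, l, m) \<Rightarrow>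
      1 \<le> l \<longrightarrow> (noise_coeff M B i l m 0 t \<omega>)\<^sup>2 \<le> G \<omega> * real l powr (- 2 + 10 / real p)"
    using noise_envelope[OF M T W p(1)] by blast
  define R where "R = (\<lambda>\<omega>. (((L2_norm (X0 \<omega>))\<^sup>2 + 1) / 2)\<^sup>2)"
  define F where "F = (\<lambda>\<omega>. 6 * c * R \<omega> + 6 * \<bar>C\<bar> * G \<omega>)"
  define Z where "Z = (\<Sum>l::nat. real l powr (- (1 + 1 / real p)))"
  \<comment> \<open>The summand \<open>l0\<close> brings the bound on \<open>A l\<close> into force beyond \<open>\<kappa>\<close>, and \<open>1\<close> makes \<open>\<kappa>\<close> positive.\<close>
  define \<kappa>0 where "\<kappa>0 = (\<lambda>\<omega>. nat \<lceil>(2 * (F \<omega> * Z)) powr (1 / (\<gamma> - 2 * \<beta>))\<rceil> + l0 + 1)"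
  have "\<forall>g\<in>L2_sphere. (\<lambda>\<omega>. L2_norm (\<lambda>x. X0 \<omega> x - g x)) \<in> borel_measurable M"
    using assms(4) by (simp add: L2_random_field_def)
  from bspec[OF this L2_sphere_zero]
  have [measurable]: "(\<lambda>\<omega>. L2_norm (X0 \<omega>)) \<in> borel_measurable M" by simp
  have [measurable]: "F \<in> borel_measurable M" unfolding F_def R_def by measurable
  have \<kappa>0_meas: "\<kappa>0 \<in> measurable M (count_space UNIV)"
    unfolding \<kappa>0_def by measurable
  have F_nonneg: "0 \<le> F \<omega>" for \<omega> using c(1) G_nonneg by (simp add: F_def R_def)
  have "0 \<le> Z"
    unfolding Z_def using p(1) by (intro suminf_nonneg summable_powr_gt_1) auto
  have A: "0 \<le> A l" for l using W by (simp add: isotropic_Q_wiener_def)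
  have bound: "AE \<omega> in M. \<forall>\<kappa>\<ge>\<kappa>0 \<omega>. L2_norm (\<lambda>x. X t \<omega> x - heat_approx M A B X0 \<kappa> \<tau> n \<omega> x) \<le> real \<kappa> powr (- \<beta>)"
    if t: "t \<in> {\<delta>..T}" and \<tau>: "time_partition \<tau> n 0 t" for t n \<tau>
  proof -
    have t': "t \<in> {0..T}" "t \<le> T" using t \<delta> by auto
    have "AE \<omega> in M. X t \<omega> \<in> L2_sphere \<and>
        (\<lambda>N. L2_norm (\<lambda>x. X t \<omega> x - (\<Sum>l\<le>N. heat_component M A B X0 l t \<omega> x))) \<longlonglongrightarrow> 0"
      using assms(5) t'(1) unfolding heat_solution_def by blast
    with G[OF t'(1)] heat_recursion_eq_component[OF M W t'(2) \<tau>, of X0] AE_space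
    show ?thesis
    proof eventually_elim
      case (elim \<omega>)
      define mode where "mode = heat_mode M A B X0 t \<omega>"
      define U where "U = (\<lambda>N x. \<Sum>l\<le>N. \<Sum>m\<in>{- int l..int l}. mode l m * sph_harm l m x)"
      define g where "g = (\<lambda>l. 2 * (exp (- 2 * (eigval l * t)) * R \<omega>)
        + 2 * (A l * (G \<omega> * real l powr (- 2 + 10 / real p))))"
      have U_L2: "U N \<in> L2_sphere" for N
        unfolding U_def by (rule sph_harm_sum_L2_sphere)
      have U_approx: "heat_approx M A B X0 \<kappa> \<tau> n \<omega> = U \<kappa>" for \<kappa>
        using elim(2) by (simp add: fun_eq_iff heat_approx_def heat_component_expansion U_def mode_def)
      have U_lim: "(\<lambda>N. L2_norm (\<lambda>x. X t \<omega> x - U N x)) \<longlonglongrightarrow> 0"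
        using elim(4) by (simp add: heat_component_expansion U_def mode_def)
      have X0: "X0 \<omega> \<in> L2_sphere"
        using assms(4) elim(3) by (simp add: L2_random_field_def)
      have mode_le: "(cmod (mode l m))\<^sup>2 \<le> g l" if "1 \<le> l" "nat \<bar>m\<bar> \<le> l" for l m
        unfolding mode_def g_def R_def
        using elim(1) that(1) by (intro heat_mode_bound X0 A that(2)) blast
      have g_le: "(2 * real l + 1) * g l \<le> F \<omega> * (real l powr (- \<gamma>) * real l powr (- 1 - 1 / real p))"
        if l: "1 \<le> l" "l0 < l" for l
        unfolding g_def F_def
      proof (rule dominated_term)
        have "\<delta> * real l \<le> t * eigval l"
          using t l(1) \<delta> by (intro mult_mono) (auto simp: eigval_def)
        then have "exp (- 2 * (eigval l * t)) \<le> exp (- 2 * (\<delta> * real l))"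
          by (simp add: mult.commute)
        then show "exp (- 2 * (eigval l * t)) \<le> c * real l powr (- (\<gamma> + 2 + 1 / real p))"
          using c(2)[OF l(1)] by (rule order_trans)
      qed (use l c A G_nonneg assms(7)[OF l(2)] in \<open>auto simp: R_def \<gamma>_def\<close>)
      show ?case
      proof (intro allI impI)
        fix \<kappa> assume \<kappa>: "\<kappa>0 \<omega> \<le> \<kappa>"
        then have "1 \<le> \<kappa>" "l0 < \<kappa>" by (auto simp: \<kappa>0_def)
        have threshold: "(2 * (F \<omega> * Z)) powr (1 / (\<gamma> - 2 * \<beta>)) \<le> real \<kappa>"
          using \<kappa> unfolding \<kappa>0_def by linarith
        have "(L2_norm (\<lambda>x. X t \<omega> x - U \<kappa> x))\<^sup>2 \<le> 2 * (F \<omega> * (real \<kappa> powr (- \<gamma>) * Z))"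
        proof (rule L2_norm_diff_le_limit[OF _ U_L2 U_lim])
          fix N assume "\<kappa> \<le> N"
          have "(L2_norm (\<lambda>x. U \<kappa> x - U N x))\<^sup>2 \<le> (\<Sum>l\<in>{\<kappa><..N}. (2 * real l + 1) * g l)"
            unfolding U_def using \<open>1 \<le> \<kappa>\<close> \<open>\<kappa> \<le> N\<close> by (intro L2_tail_bound mode_le) auto
          also have "\<dots> \<le> (\<Sum>l\<in>{\<kappa><..N}. F \<omega> * (real l powr (- \<gamma>) * real l powr (- 1 - 1 / real p)))"
            using \<open>l0 < \<kappa>\<close> by (intro sum_mono g_le) auto
          also have "\<dots> = F \<omega> * (\<Sum>l\<in>{\<kappa><..N}. real l powr (- \<gamma>) * real l powr (- (1 + 1 / real p)))"
            by (simp add: sum_distrib_left)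
          also have "\<dots> \<le> F \<omega> * (real \<kappa> powr (- \<gamma>) * Z)"
            unfolding Z_def using p(1) \<open>1 \<le> \<kappa>\<close> \<gamma>(1) F_nonneg
            by (intro mult_left_mono powr_tail_sum) auto
          finally show "(L2_norm (\<lambda>x. U \<kappa> x - U N x))\<^sup>2 \<le> F \<omega> * (real \<kappa> powr (- \<gamma>) * Z)" .
        qed (use elim(4) in blast)
        then have "(L2_norm (\<lambda>x. X t \<omega> x - U \<kappa> x))\<^sup>2 \<le> 2 * (F \<omega> * Z) * real \<kappa> powr (- \<gamma>)"
          by (simp add: mult_ac)
        then show "L2_norm (\<lambda>x. X t \<omega> x - heat_approx M A B X0 \<kappa> \<tau> n \<omega> x) \<le> real \<kappa> powr (- \<beta>)"
          unfolding U_approx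
          using \<open>0 \<le> Z\<close> F_nonneg[of \<omega>] \<open>1 \<le> \<kappa>\<close> threshold \<gamma>(2)
          by (intro rate_from_threshold[OF _ _ refl]) auto
      qed
    qed
  qed
  show "\<exists>\<kappa>0 \<in> measurable M (count_space (UNIV :: nat set)).
      \<forall>t\<in>{\<delta>..T}. \<forall>n \<tau>. 1 \<le> n \<and> time_partition \<tau> n 0 t \<longrightarrow>
        (AE \<omega> in M. \<forall>\<kappa>\<ge>\<kappa>0 \<omega>.
           L2_norm (\<lambda>x. X t \<omega> x - heat_approx M A B X0 \<kappa> \<tau> n \<omega> x) \<le> real \<kappa> powr (- \<beta>))"
    using \<kappa>0_meas bound by (intro bexI[of _ \<kappa>0]) blast+
qed

end
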